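(* Let $\mathbf{SkePerLCCon}$ be the category of all connected locally compact Hausdorff spaces and all skeletal perfect maps between them, and let $\mathbf{DSkePerLCCon}$ be the category whose objects are all connected complete local contact algebras and whose morphisms $\varphi:(A,\rho,\mathbb{B})\to(B,\eta,\mathbb{B}')$ are all complete Boolean homomorphisms $\varphi:A\to B$ satisfying (L1) for all $a,b\in A$, $\varphi(a)\,\eta\,\varphi(b)$ implies $a\,\rho\,b$; (L2) $b\in\mathbb{B}'$ implies $\varphi_\Lambda(b)\in\mathbb{B}$; and (L3) $a\in\mathbb{B}$ implies $\varphi(a)\in\mathbb{B}'$. Then $\mathbf{SkePerLCCon}$ and $\mathbf{DSkePerLCCon}$ are dually equivalent. In particular, the category $\mathbf{SkeCCon}$ of all connected compact Hausdorff spaces and all quasi-open maps between them is dually equivalent to the category $\mathbf{DSkeCCon}$ whose objects are all connected complete normal contact algebras and whose morphisms $\varphi:(A,C)\to(B,C')$ are all complete Boolean homomorphisms $\varphi:A\to B$ such that, for all $a,b\in A$, $\varphi(a)\,C'\,\varphi(b)$ implies $a\,C\,b$.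
   Context: A function $f:X\to Y$ between topological spaces is skeletal if $\mathrm{int}(f^{-1}(\mathrm{cl}(V)))\subseteq \mathrm{cl}(f^{-1}(V))$ for every open $V\subseteq Y$. A continuous map $f:X\to Y$ is quasi-open if $\mathrm{int}(f(U))\neq\emptyset$ for every non-empty open $U\subseteq X$. A map is perfect if it is continuous, closed, and all its point inverses are compact. Maps are not assumed to be onto. A space is connected if it is not the union of two disjoint non-empty open subsets (so the empty space counts as connected). A contact algebra $(B,C)$ is a Boolean algebra $B=(B,0,1,\vee,\wedge,{}^* )$ ($0=1$ is allowed; $^*$ is complement) with a binary relation $C$ on $B$ such that: (C1) $a\neq 0$ implies $aCa$; (C2) $aCb$ implies $a\ne 0$ and $b\neq 0$; (C3) $aCb$ implies $bCa$; (C4) $aC(b\vee c)$ iff $aCb$ or $aCc$. Write $a(-C)b$ for "not $aCb$", and $a\ll_C b$ iff $a(-C)b^*$. A contact algebra is connected if $aCa^*$ for every $a\neq 0,1$. It is a normal contact algebra if: (C5) if $a(-C)b$ then $a(-C)c$ and $b(-C)c^*$ for some $c\in B$; (C6) if $a\neq 1$ then there exists $b\neq 0$ with $b(-C)a$. A local contact algebra $(B,\rho,\mathbb{B})$ consists of a contact algebra $(B,\rho)$ and an ideal $\mathbb{B}$ of $B$ (possibly non-proper) such that: (BC1) if $a\in\mathbb{B}$, $c\in B$ and $a\ll_\rho c$ then $a\ll_\rho b\ll_\rho c$ for some $b\in\mathbb{B}$; (BC2) if $a\rho b$ then there is $c\in\mathbb{B}$ with $a\rho(c\wedge b)$; (BC3)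 if $a\ne 0$ then there is $b\in\mathbb{B}\setminus\{0\}$ with $b\ll_\rho a$. It is connected if the contact algebra $(B,\rho)$ is connected. "Complete" (for normal or local contact algebras) means that $B$ is a complete Boolean algebra. A complete Boolean homomorphism is one preserving all joins and meets. For such $\varphi:A\to B$, $\varphi_\Lambda:B\to A$ denotes its left adjoint: $b\le\varphi(a)$ iff $\varphi_\Lambda(b)\le a$. Composition of morphisms is composition of functions. Two categories are dually equivalent if one is equivalent to the opposite of the other. *)

theory Defs
  imports "HOL-Analysis.Analysis" "HOL-Algebra.Complete_Lattice"
begin

section \<open>Categories and dual equivalence\<close>

text \<open>
  A category is given by its objects, its hom-sets, its identities and its composition.
  Hom-sets of different pairs of objects need not be disjoint; \<open>Comp C X Y Z g f\<close> is the
  composite of \<open>f \<in> Hom C X Y\<close> followed by \<open>g \<in> Hom C Y Z\<close>.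
\<close>

record ('o, 'm) category =
  Obj :: "'o set"
  Hom :: "'o \<Rightarrow> 'o \<Rightarrow> 'm set"
  Ident :: "'o \<Rightarrow> 'm"
  Comp :: "'o \<Rightarrow> 'o \<Rightarrow> 'o \<Rightarrow> 'm \<Rightarrow> 'm \<Rightarrow> 'm"

definition is_category :: "('o, 'm) category \<Rightarrow> bool" where
  "is_category C \<longleftrightarrow>
     (\<forall>X\<in>Obj C. Ident C X \<in> Hom C X X) \<and>
     (\<forall>X\<in>Obj C. \<forall>Y\<in>Obj C. \<forall>Z\<in>Obj C. \<forall>f\<in>Hom C X Y. \<forall>g\<in>Hom C Y Z.
        Comp C X Y Z g f \<in> Hom C X Z) \<and>
     (\<forall>X\<in>Obj C. \<forall>Y\<in>Obj C. \<forall>f\<in>Hom C X Y.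
        Comp C X X Y f (Ident C X) = f \<and> Comp C X Y Y (Ident C Y) f = f) \<and>
     (\<forall>W\<in>Obj C. \<forall>X\<in>Obj C. \<forall>Y\<in>Obj C. \<forall>Z\<in>Obj C.
        \<forall>f\<in>Hom C W X. \<forall>g\<in>Hom C X Y. \<forall>h\<in>Hom C Y Z.
        Comp C W X Z (Comp C X Y Z h g) f = Comp C W Y Z h (Comp C W X Y g f))"

definition opposite :: "('o, 'm) category \<Rightarrow> ('o, 'm) category" where
  "opposite C =
     \<lparr> Obj = Obj C, Hom = (\<lambda>X Y. Hom C Y X), Ident = Ident C,
       Comp = (\<lambda>X Y Z g f. Comp C Z Y X f g) \<rparr>"

definition is_iso :: "('o, 'm) category \<Rightarrow> 'o \<Rightarrow> 'o \<Rightarrow> 'm \<Rightarrow> bool" where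
  "is_iso C X Y f \<longleftrightarrow>
     f \<in> Hom C X Y \<and>
     (\<exists>g\<in>Hom C Y X. Comp C X Y X g f = Ident C X \<and> Comp C Y X Y f g = Ident C Y)"

record ('o, 'm, 'p, 'n) functr =
  fobj :: "'o \<Rightarrow> 'p"
  fmor :: "'o \<Rightarrow> 'o \<Rightarrow> 'm \<Rightarrow> 'n"

definition is_functor ::
    "('o, 'm) category \<Rightarrow> ('p, 'n) category \<Rightarrow> ('o, 'm, 'p, 'n) functr \<Rightarrow> bool" where
  "is_functor C D F \<longleftrightarrow>
     (\<forall>X\<in>Obj C. fobj F X \<in> Obj D) \<and>
     (\<forall>X\<in>Obj C. \<forall>Y\<in>Obj C. \<forall>f\<in>Hom C X Y. fmor F X Y f \<in> Hom D (fobj F X) (fobj F Y)) \<and>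
     (\<forall>X\<in>Obj C. fmor F X X (Ident C X) = Ident D (fobj F X)) \<and>
     (\<forall>X\<in>Obj C. \<forall>Y\<in>Obj C. \<forall>Z\<in>Obj C. \<forall>f\<in>Hom C X Y. \<forall>g\<in>Hom C Y Z.
        fmor F X Z (Comp C X Y Z g f) =
          Comp D (fobj F X) (fobj F Y) (fobj F Z) (fmor F Y Z g) (fmor F X Y f))"

definition id_functor :: "('o, 'm, 'o, 'm) functr" where
  "id_functor = \<lparr> fobj = (\<lambda>X. X), fmor = (\<lambda>X Y f. f) \<rparr>"

definition comp_functor ::
    "('p, 'n, 'q, 'k) functr \<Rightarrow> ('o, 'm, 'p, 'n) functr \<Rightarrow> ('o, 'm, 'q, 'k) functr" where
  "comp_functor G F =
     \<lparr> fobj = (\<lambda>X. fobj G (fobj F X)),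
       fmor = (\<lambda>X Y f. fmor G (fobj F X) (fobj F Y) (fmor F X Y f)) \<rparr>"

definition naturally_isomorphic ::
    "('o, 'm) category \<Rightarrow> ('p, 'n) category \<Rightarrow>
     ('o, 'm, 'p, 'n) functr \<Rightarrow> ('o, 'm, 'p, 'n) functr \<Rightarrow> bool" where
  "naturally_isomorphic C D F G \<longleftrightarrow>
     (\<exists>t. (\<forall>X\<in>Obj C. is_iso D (fobj F X) (fobj G X) (t X)) \<and>
          (\<forall>X\<in>Obj C. \<forall>Y\<in>Obj C. \<forall>f\<in>Hom C X Y.
             Comp D (fobj F X) (fobj F Y) (fobj G Y) (t Y) (fmor F X Y f) =
             Comp D (fobj F X) (fobj G X) (fobj G Y) (fmor G X Y f) (t X)))"

definition equivalent_categories :: "('o, 'm) category \<Rightarrow> ('p, 'n) category \<Rightarrow> bool" where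
  "equivalent_categories C D \<longleftrightarrow>
     is_category C \<and> is_category D \<and>
     (\<exists>F G. is_functor C D F \<and> is_functor D C G \<and>
            naturally_isomorphic C C id_functor (comp_functor G F) \<and>
            naturally_isomorphic D D (comp_functor F G) id_functor)"

definition dually_equivalent :: "('o, 'm) category \<Rightarrow> ('p, 'n) category \<Rightarrow> bool" where
  "dually_equivalent C D \<longleftrightarrow> equivalent_categories C (opposite D)"

text \<open>
  HOL has no proper classes, so the class of all sets is represented by a universe: a family
  of subsets of some type that is closed under subsets and, up to bijection, under power sets.
  The members of a Grothendieck universe are an example.
\<close>

definition universe :: "('u set \<Rightarrow> bool) \<Rightarrow> bool" where
  "universe S \<longleftrightarrow>
     (\<forall>X Y. S X \<and> Y \<subseteq> X \<longrightarrow> S Y) \<and>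
     (\<forall>X. S X \<longrightarrow> (\<exists>Y. S Y \<and> Y \<approx> Pow X))"


section \<open>Spaces\<close>

definition skeletal_map :: "'a topology \<Rightarrow> 'b topology \<Rightarrow> ('a \<Rightarrow> 'b) \<Rightarrow> bool" where
  "skeletal_map X Y f \<longleftrightarrow>
     f \<in> topspace X \<rightarrow> topspace Y \<and>
     (\<forall>V. openin Y V \<longrightarrow>
        X interior_of {x \<in> topspace X. f x \<in> Y closure_of V}
          \<subseteq> X closure_of {x \<in> topspace X. f x \<in> V})"

definition quasi_open_map :: "'a topology \<Rightarrow> 'b topology \<Rightarrow> ('a \<Rightarrow> 'b) \<Rightarrow> bool" where
  "quasi_open_map X Y f \<longleftrightarrow>
     continuous_map X Y f \<and>
     (\<forall>U. openin X U \<and> U \<noteq> {} \<longrightarrow> Y interior_of (f ` U) \<noteq> {})"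

definition LCCon_space :: "'a topology \<Rightarrow> bool" where
  "LCCon_space X \<longleftrightarrow> connected_space X \<and> locally_compact_space X \<and> Hausdorff_space X"

definition CCon_space :: "'a topology \<Rightarrow> bool" where
  "CCon_space X \<longleftrightarrow> connected_space X \<and> compact_space X \<and> Hausdorff_space X"

text \<open>
  Morphisms are extensional functions, so that they are determined by their values on the space.
  A perfect map is a continuous \<^const>\<open>proper_map\<close>; the library's \<^const>\<open>perfect_map\<close>
  is not used because it includes surjectivity.
\<close>

definition SkePer_hom :: "'a topology \<Rightarrow> 'b topology \<Rightarrow> ('a \<Rightarrow> 'b) set" where
  "SkePer_hom X Y =
     {f \<in> topspace X \<rightarrow>\<^sub>E topspace Y.
        skeletal_map X Y f \<and> continuous_map X Y f \<and> proper_map X Y f}"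

definition QOpen_hom :: "'a topology \<Rightarrow> 'b topology \<Rightarrow> ('a \<Rightarrow> 'b) set" where
  "QOpen_hom X Y = {f \<in> topspace X \<rightarrow>\<^sub>E topspace Y. quasi_open_map X Y f}"

definition SkePerLCCon :: "('u set \<Rightarrow> bool) \<Rightarrow> ('u topology, 'u \<Rightarrow> 'u) category" where
  "SkePerLCCon S =
     \<lparr> Obj = {X. LCCon_space X \<and> S (topspace X)},
       Hom = SkePer_hom,
       Ident = (\<lambda>X. \<lambda>x\<in>topspace X. x),
       Comp = (\<lambda>X Y Z g f. compose (topspace X) g f) \<rparr>"

definition SkeCCon :: "('u set \<Rightarrow> bool) \<Rightarrow> ('u topology, 'u \<Rightarrow> 'u) category" where
  "SkeCCon S =
     \<lparr> Obj = {X. CCon_space X \<and> S (topspace X)},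
       Hom = QOpen_hom,
       Ident = (\<lambda>X. \<lambda>x\<in>topspace X. x),
       Comp = (\<lambda>X Y Z g f. compose (topspace X) g f) \<rparr>"


section \<open>Contact algebras\<close>

locale boolean_lattice = bounded_lattice +
  assumes distrib:
      "\<lbrakk>x \<in> carrier L; y \<in> carrier L; z \<in> carrier L\<rbrakk>
        \<Longrightarrow> x \<sqinter> (y \<squnion> z) = (x \<sqinter> y) \<squnion> (x \<sqinter> z)"
    and complemented:
      "x \<in> carrier L \<Longrightarrow> \<exists>y\<in>carrier L. x \<squnion> y = \<top> \<and> x \<sqinter> y = \<bottom>"

definition bcompl :: "('a, 'm) gorder_scheme \<Rightarrow> 'a \<Rightarrow> 'a" where
  "bcompl L x =
     (THE y. y \<in> carrier L \<and> x \<squnion>\<^bsub>L\<^esub> y = \<top>\<^bsub>L\<^esub> \<and> x \<sqinter>\<^bsub>L\<^esub> y = \<bottom>\<^bsub>L\<^esub>)"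

record 'a contact_algebra = "'a gorder" +
  contact :: "'a \<Rightarrow> 'a \<Rightarrow> bool"

definition well_inside :: "('a, 'm) contact_algebra_scheme \<Rightarrow> 'a \<Rightarrow> 'a \<Rightarrow> bool" where
  "well_inside B a b \<longleftrightarrow> \<not> contact B a (bcompl B b)"

locale contact_algebra = boolean_lattice B
  for B :: "('a, 'm) contact_algebra_scheme" (structure) +
  assumes C1: "\<lbrakk>a \<in> carrier B; a \<noteq> \<bottom>\<rbrakk> \<Longrightarrow> contact B a a"
    and C2: "\<lbrakk>a \<in> carrier B; b \<in> carrier B; contact B a b\<rbrakk> \<Longrightarrow> a \<noteq> \<bottom> \<and> b \<noteq> \<bottom>"
    and C3: "\<lbrakk>a \<in> carrier B; b \<in> carrier B; contact B a b\<rbrakk> \<Longrightarrow> contact B b a"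
    and C4: "\<lbrakk>a \<in> carrier B; b \<in> carrier B; c \<in> carrier B\<rbrakk>
        \<Longrightarrow> contact B a (b \<squnion> c) \<longleftrightarrow> contact B a b \<or> contact B a c"

definition connected_contact :: "('a, 'm) contact_algebra_scheme \<Rightarrow> bool" where
  "connected_contact B \<longleftrightarrow>
     (\<forall>a\<in>carrier B. a \<noteq> \<bottom>\<^bsub>B\<^esub> \<and> a \<noteq> \<top>\<^bsub>B\<^esub> \<longrightarrow> contact B a (bcompl B a))"

locale normal_contact_algebra = contact_algebra +
  assumes C5: "\<lbrakk>a \<in> carrier B; b \<in> carrier B; \<not> contact B a b\<rbrakk>
        \<Longrightarrow> \<exists>c\<in>carrier B. \<not> contact B a c \<and> \<not> contact B b (bcompl B c)"
    and C6: "\<lbrakk>a \<in> carrier B; a \<noteq> \<top>\<rbrakk> \<Longrightarrow> \<exists>b\<in>carrier B. b \<noteq> \<bottom> \<and> \<not> contact B b a"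

record 'a local_contact_algebra = "'a contact_algebra" +
  bdd :: "'a set"

locale local_contact_algebra = contact_algebra B
  for B :: "('a, 'm) local_contact_algebra_scheme" (structure) +
  assumes bdd_sub: "bdd B \<subseteq> carrier B"
    and bdd_bot: "\<bottom> \<in> bdd B"
    and bdd_join: "\<lbrakk>a \<in> bdd B; b \<in> bdd B\<rbrakk> \<Longrightarrow> a \<squnion> b \<in> bdd B"
    and bdd_down: "\<lbrakk>a \<in> bdd B; b \<in> carrier B; b \<sqsubseteq> a\<rbrakk> \<Longrightarrow> b \<in> bdd B"
    and BC1: "\<lbrakk>a \<in> bdd B; c \<in> carrier B; well_inside B a c\<rbrakk>
        \<Longrightarrow> \<exists>b\<in>bdd B. well_inside B a b \<and> well_inside B b c"
    and BC2: "\<lbrakk>a \<in> carrier B; b \<in> carrier B; contact B a b\<rbrakk>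
        \<Longrightarrow> \<exists>c\<in>bdd B. contact B a (c \<sqinter> b)"
    and BC3: "\<lbrakk>a \<in> carrier B; a \<noteq> \<bottom>\<rbrakk> \<Longrightarrow> \<exists>b\<in>bdd B. b \<noteq> \<bottom> \<and> well_inside B b a"

definition DLCCon_algebra :: "'a local_contact_algebra \<Rightarrow> bool" where
  "DLCCon_algebra B \<longleftrightarrow>
     local_contact_algebra B \<and> complete_lattice B \<and> connected_contact B"

definition DCCon_algebra :: "'a contact_algebra \<Rightarrow> bool" where
  "DCCon_algebra B \<longleftrightarrow>
     normal_contact_algebra B \<and> complete_lattice B \<and> connected_contact B"

text \<open>
  \<^const>\<open>sup_pres\<close> and \<^const>\<open>inf_pres\<close> range over all subsets, including the empty one, so
  \<open>\<bottom>\<close>, \<open>\<top>\<close>, binary joins and meets, and hence complements are preserved too.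
\<close>

definition complete_boolean_hom ::
    "('a, 'm) gorder_scheme \<Rightarrow> ('b, 'n) gorder_scheme \<Rightarrow> ('a \<Rightarrow> 'b) \<Rightarrow> bool" where
  "complete_boolean_hom A B \<phi> \<longleftrightarrow>
     \<phi> \<in> carrier A \<rightarrow>\<^sub>E carrier B \<and> sup_pres A B \<phi> \<and> inf_pres A B \<phi>"

definition left_adj ::
    "('a, 'm) gorder_scheme \<Rightarrow> ('b, 'n) gorder_scheme \<Rightarrow> ('a \<Rightarrow> 'b) \<Rightarrow> 'b \<Rightarrow> 'a" where
  "left_adj A B \<phi> b =
     (THE c. c \<in> carrier A \<and> (\<forall>a\<in>carrier A. b \<sqsubseteq>\<^bsub>B\<^esub> \<phi> a \<longleftrightarrow> c \<sqsubseteq>\<^bsub>A\<^esub> a))"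

definition DSke_hom ::
    "('a, 'm) contact_algebra_scheme \<Rightarrow> ('b, 'n) contact_algebra_scheme \<Rightarrow> ('a \<Rightarrow> 'b) set" where
  "DSke_hom A B =
     {\<phi>. complete_boolean_hom A B \<phi> \<and>
         (\<forall>a\<in>carrier A. \<forall>b\<in>carrier A. contact B (\<phi> a) (\<phi> b) \<longrightarrow> contact A a b)}"

definition DSkePer_hom ::
    "'a local_contact_algebra \<Rightarrow> 'b local_contact_algebra \<Rightarrow> ('a \<Rightarrow> 'b) set" where
  "DSkePer_hom A B =
     {\<phi> \<in> DSke_hom A B.
        (\<forall>b\<in>bdd B. left_adj A B \<phi> b \<in> bdd A) \<and> (\<forall>a\<in>bdd A. \<phi> a \<in> bdd B)}"

definition DSkePerLCCon ::
    "('u set \<Rightarrow> bool) \<Rightarrow> ('u local_contact_algebra, 'u \<Rightarrow> 'u) category" where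
  "DSkePerLCCon S =
     \<lparr> Obj = {B. DLCCon_algebra B \<and> S (carrier B)},
       Hom = DSkePer_hom,
       Ident = (\<lambda>B. \<lambda>a\<in>carrier B. a),
       Comp = (\<lambda>A B C \<psi> \<phi>. compose (carrier A) \<psi> \<phi>) \<rparr>"

definition DSkeCCon :: "('u set \<Rightarrow> bool) \<Rightarrow> ('u contact_algebra, 'u \<Rightarrow> 'u) category" where
  "DSkeCCon S =
     \<lparr> Obj = {B. DCCon_algebra B \<and> S (carrier B)},
       Hom = DSke_hom,
       Ident = (\<lambda>B. \<lambda>a\<in>carrier B. a),
       Comp = (\<lambda>A B C \<psi> \<phi>. compose (carrier A) \<psi> \<phi>) \<rparr>"


section \<open>The duality functor on spaces over arbitrary types\<close>

text \<open>
  A universe with an infinite member needs an underlying type that is larger than all finitely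
  iterated power sets of the natural numbers, and HOL does not provide one.  The
  duality is therefore also described independently of universes, by a functor defined on the spaces
  over all types: a space is sent to its algebra of regular closed sets, two of them being in
  contact iff they meet, and the bounded ones being the compact ones; a map \<open>f\<close> is sent to
  \<open>G \<mapsto> cl (f\<^sup>-\<^sup>1 (int G))\<close>.
\<close>

definition regular_closed :: "'a topology \<Rightarrow> 'a set set" where
  "regular_closed X = {F. F \<subseteq> topspace X \<and> X closure_of (X interior_of F) = F}"

definition RC :: "'a topology \<Rightarrow> 'a set contact_algebra" where
  "RC X = \<lparr> carrier = regular_closed X, eq = (=), le = (\<subseteq>),
            contact = (\<lambda>F G. F \<inter> G \<noteq> {}) \<rparr>"

definition RCL :: "'a topology \<Rightarrow> 'a set local_contact_algebra" where
  "RCL X = \<lparr> carrier = regular_closed X, eq = (=), le = (\<subseteq>),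
             contact = (\<lambda>F G. F \<inter> G \<noteq> {}),
             bdd = {F \<in> regular_closed X. compactin X F} \<rparr>"

definition RC_map ::
    "'a topology \<Rightarrow> 'b topology \<Rightarrow> ('a \<Rightarrow> 'b) \<Rightarrow> 'b set \<Rightarrow> 'a set" where
  "RC_map X Y f =
     (\<lambda>G\<in>regular_closed Y. X closure_of {x \<in> topspace X. f x \<in> Y interior_of G})"

text \<open>Isomorphism of algebras whose elements may have different types.\<close>

definition DSkePer_iso :: "'a local_contact_algebra \<Rightarrow> 'b local_contact_algebra \<Rightarrow> bool" where
  "DSkePer_iso A B \<longleftrightarrow>
     (\<exists>\<phi>\<in>DSkePer_hom A B. \<exists>\<psi>\<in>DSkePer_hom B A.
        compose (carrier A) \<psi> \<phi> = (\<lambda>a\<in>carrier A. a) \<and>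
        compose (carrier B) \<phi> \<psi> = (\<lambda>b\<in>carrier B. b))"

definition DSke_iso :: "'a contact_algebra \<Rightarrow> 'b contact_algebra \<Rightarrow> bool" where
  "DSke_iso A B \<longleftrightarrow>
     (\<exists>\<phi>\<in>DSke_hom A B. \<exists>\<psi>\<in>DSke_hom B A.
        compose (carrier A) \<psi> \<phi> = (\<lambda>a\<in>carrier A. a) \<and>
        compose (carrier B) \<phi> \<psi> = (\<lambda>b\<in>carrier B. b))"

end

theory Submission
  imports Defs
begin

text \<open>
  The duality sends a space to its algebra of regular closed sets; that this functor is fully
  faithful and essentially surjective rests on three observations.

  \<^item> \<^emph>\<open>Maps give homomorphisms.\<close>  For a continuous skeletal map \<open>f\<close> and open \<open>V\<close>, the open set
    \<open>f\<^sup>-\<^sup>1 (int (cl V))\<close> lies in \<open>cl (f\<^sup>-\<^sup>1 V)\<close>.  Hence \<open>\<phi> G = cl (f\<^sup>-\<^sup>1 (int G))\<close> commutes with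
    joins and complements (\<open>RC_map_sup\<close>, \<open>RC_map_neg\<close>).  It also satisfies
    \<open>f\<^sup>-\<^sup>1 (int G) \<subseteq> \<phi> G \<subseteq> f\<^sup>-\<^sup>1 G\<close>, and these two inclusions yield the contact condition and, as
    images and preimages of compact sets under \<open>f\<close> are compact, the two boundedness conditions.

  \<^item> \<^emph>\<open>Homomorphisms come from unique maps.\<close>  In a locally compact Hausdorff space the compact
    regular closed neighbourhoods of a point form a neighbourhood base.  So \<open>f x\<close> is the only
    point \<open>y\<close> such that \<open>x \<in> \<phi> G\<close> for every regular closed neighbourhood \<open>G\<close> of \<open>y\<close>
    (\<open>RC_map_inj\<close>).  Conversely a homomorphism \<open>\<phi>\<close> determines such a point for every \<open>x\<close>: a
    compact neighbourhood of \<open>x\<close> lies below some \<open>\<phi> K\<close> with \<open>K\<close> compact, so that if no point of \<open>K\<close>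
    qualified, then finitely many sets \<open>G\<close> with \<open>x \<notin> \<phi> G\<close> would cover \<open>K\<close> (\<open>RC_map_surj\<close>).

  \<^item> \<^emph>\<open>Algebras come from spaces.\<close>  Given a local contact algebra, an ultrafilter \<open>u\<close> with a bounded
    member spans the cluster of all elements that touch every member of \<open>u\<close>.  These clusters
    are the points of a locally compact Hausdorff space in which the sets \<open>star a\<close> of
    the clusters containing \<open>a\<close> are a base of the closed sets.  They are regular closed, two of them
    meet iff the elements are in contact, and \<open>star a\<close> is compact iff \<open>a\<close> is bounded.  If the algebra
    is complete, they are all the regular closed sets (\<open>representation\<close>).

  A fully faithful and essentially surjective functor is an equivalence
  (\<open>equivalent_categoriesI\<close>); to stay inside a universe, algebras of sets are replaced by copies along
  an injection of a power set.  The compact case is the restriction to full subcategories: on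
  compact Hausdorff spaces the quasi-open maps are the skeletal perfect ones, and a
  normal contact algebra is a local contact algebra all of whose elements are bounded.
\<close>


section \<open>Order and Boolean algebra\<close>

context complete_lattice
begin

lemma sup_eqI:
  assumes "S \<subseteq> carrier L" "s \<in> carrier L" "\<And>x. x \<in> S \<Longrightarrow> x \<sqsubseteq> s"
    "\<And>z. \<lbrakk>z \<in> carrier L; \<And>x. x \<in> S \<Longrightarrow> x \<sqsubseteq> z\<rbrakk> \<Longrightarrow> s \<sqsubseteq> z"
  shows "\<Squnion>S = s"
  using assms by (meson le_antisym sup_closed sup_least sup_upper)

lemma inf_eqI:
  assumes "S \<subseteq> carrier L" "s \<in> carrier L" "\<And>x. x \<in> S \<Longrightarrow> s \<sqsubseteq> x"
    "\<And>z. \<lbrakk>z \<in> carrier L; \<And>x. x \<in> S \<Longrightarrow> z \<sqsubseteq> x\<rbrakk> \<Longrightarrow> z \<sqsubseteq> s"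
  shows "\<Sqinter>S = s"
  using assms by (meson le_antisym inf_closed inf_greatest inf_lower)

lemma complete_bounded_lattice: "bounded_lattice L"
  by unfold_locales

end

context lattice
begin

lemma join_eqI:
  assumes "x \<in> carrier L" "y \<in> carrier L" "s \<in> carrier L" "x \<sqsubseteq> s" "y \<sqsubseteq> s"
    "\<And>z. \<lbrakk>z \<in> carrier L; x \<sqsubseteq> z; y \<sqsubseteq> z\<rbrakk> \<Longrightarrow> s \<sqsubseteq> z"
  shows "x \<squnion> y = s"
  using assms by (meson join_closed join_le join_left join_right le_antisym)

lemma meet_eqI:
  assumes "x \<in> carrier L" "y \<in> carrier L" "s \<in> carrier L" "s \<sqsubseteq> x" "s \<sqsubseteq> y"
    "\<And>z. \<lbrakk>z \<in> carrier L; z \<sqsubseteq> x; z \<sqsubseteq> y\<rbrakk> \<Longrightarrow> z \<sqsubseteq> s"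
  shows "x \<sqinter> y = s"
  using assms by (meson meet_closed meet_le meet_left meet_right le_antisym)

end

context boolean_lattice
begin

abbreviation neg :: "'a \<Rightarrow> 'a" where "neg \<equiv> bcompl L"

lemma bot_join [simp]: "x \<in> carrier L \<Longrightarrow> \<bottom> \<squnion> x = x"
  by (meson bottom_closed bottom_lower join_eqI le_refl)

lemma join_bot [simp]: "x \<in> carrier L \<Longrightarrow> x \<squnion> \<bottom> = x"
  using bot_join join_comm by metis

lemma meet_top_left [simp]: "x \<in> carrier L \<Longrightarrow> \<top> \<sqinter> x = x"
  by (meson top_closed top_higher meet_eqI le_refl)

lemma meet_top [simp]: "x \<in> carrier L \<Longrightarrow> x \<sqinter> \<top> = x"
  using meet_top_left meet_comm by metis

lemma le_meet_iff:
  "\<lbrakk>x \<in> carrier L; y \<in> carrier L; z \<in> carrier L\<rbrakk> \<Longrightarrow> z \<sqsubseteq> x \<sqinter> y \<longleftrightarrow> z \<sqsubseteq> x \<and> z \<sqsubseteq> y"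
  by (meson le_trans meet_closed meet_le meet_left meet_right)

lemma join_le_iff:
  "\<lbrakk>x \<in> carrier L; y \<in> carrier L; z \<in> carrier L\<rbrakk> \<Longrightarrow> x \<squnion> y \<sqsubseteq> z \<longleftrightarrow> x \<sqsubseteq> z \<and> y \<sqsubseteq> z"
  by (meson le_trans join_closed join_le join_left join_right)

lemma complement_unique:
  assumes "x \<in> carrier L" "y \<in> carrier L" "z \<in> carrier L"
    and "x \<squnion> y = \<top>" "x \<sqinter> y = \<bottom>" "x \<squnion> z = \<top>" "x \<sqinter> z = \<bottom>"
  shows "y = z"
proof -
  have "y = y \<sqinter> (x \<squnion> z)" using assms by simp
  also have "\<dots> = y \<sqinter> z"
    using assms distrib[of y x z] by (simp add: meet_comm)
  also have "\<dots> = z \<sqinter> (x \<squnion> y)"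
    using assms distrib[of z x y] by (simp add: meet_comm)
  also have "\<dots> = z" using assms by simp
  finally show ?thesis .
qed

lemma neg_eqI:
  assumes "x \<in> carrier L" "y \<in> carrier L" "x \<squnion> y = \<top>" "x \<sqinter> y = \<bottom>"
  shows "neg x = y"
  unfolding bcompl_def using assms complement_unique by (intro the_equality) blast+

lemma
  assumes "x \<in> carrier L"
  shows neg_closed [simp]: "neg x \<in> carrier L"
    and join_neg [simp]: "x \<squnion> neg x = \<top>"
    and meet_neg [simp]: "x \<sqinter> neg x = \<bottom>"
proof -
  obtain y where "y \<in> carrier L" "x \<squnion> y = \<top>" "x \<sqinter> y = \<bottom>"
    using complemented assms by blast
  with neg_eqI assms show "neg x \<in> carrier L" "x \<squnion> neg x = \<top>" "x \<sqinter> neg x = \<bottom>"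
    by auto
qed

lemma neg_neg [simp]: "x \<in> carrier L \<Longrightarrow> neg (neg x) = x"
  by (rule neg_eqI) (auto simp: join_comm[of _ "neg x"] meet_comm[of _ "neg x"])

lemma le_bot: "x \<in> carrier L \<Longrightarrow> x \<sqsubseteq> \<bottom> \<longleftrightarrow> x = \<bottom>"
  by (metis bottom_closed bottom_lower le_antisym le_refl)

lemma top_le: "x \<in> carrier L \<Longrightarrow> \<top> \<sqsubseteq> x \<longleftrightarrow> x = \<top>"
  by (metis top_closed top_higher le_antisym le_refl)

lemma le_neg_iff:
  assumes "x \<in> carrier L" "y \<in> carrier L"
  shows "x \<sqsubseteq> neg y \<longleftrightarrow> x \<sqinter> y = \<bottom>"
proof
  assume "x \<sqsubseteq> neg y"
  then have "x \<sqinter> y \<sqsubseteq> neg y"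
    using assms le_trans[OF meet_left[of x y]] by simp
  then have "x \<sqinter> y \<sqsubseteq> y \<sqinter> neg y"
    using assms by (simp add: le_meet_iff meet_right del: meet_neg)
  then show "x \<sqinter> y = \<bottom>" using assms by (simp add: le_bot)
next
  assume "x \<sqinter> y = \<bottom>"
  then have "x = x \<sqinter> neg y"
    using assms distrib[of x y "neg y"] by simp
  then show "x \<sqsubseteq> neg y" using assms by (metis meet_right neg_closed)
qed

lemma le_iff_meet_neg:
  "\<lbrakk>x \<in> carrier L; y \<in> carrier L\<rbrakk> \<Longrightarrow> x \<sqsubseteq> y \<longleftrightarrow> x \<sqinter> neg y = \<bottom>"
  using le_neg_iff[of x "neg y"] by simp

lemma neg_antimono: "\<lbrakk>x \<in> carrier L; y \<in> carrier L; x \<sqsubseteq> y\<rbrakk> \<Longrightarrow> neg y \<sqsubseteq> neg x"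
  by (metis le_iff_meet_neg le_neg_iff meet_comm neg_closed)

lemma neg_le_iff:
  assumes "x \<in> carrier L" "y \<in> carrier L"
  shows "neg x \<sqsubseteq> y \<longleftrightarrow> x \<squnion> y = \<top>"
proof
  assume "neg x \<sqsubseteq> y"
  then have "neg x \<sqsubseteq> x \<squnion> y"
    using assms le_trans[OF _ join_right[of x y]] by simp
  then have "x \<squnion> neg x \<sqsubseteq> x \<squnion> y"
    using assms by (simp add: join_le_iff join_left del: join_neg)
  then show "x \<squnion> y = \<top>" using assms by (simp add: top_le)
next
  assume "x \<squnion> y = \<top>"
  then have "neg x = neg x \<sqinter> y"
    using assms distrib[of "neg x" x y] by (simp add: meet_comm[of L "neg x" x])
  then show "neg x \<sqsubseteq> y" using assms by (metis meet_right neg_closed)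
qed

lemma meet_split:
  "\<lbrakk>x \<in> carrier L; y \<in> carrier L\<rbrakk> \<Longrightarrow> (x \<sqinter> y) \<squnion> (x \<sqinter> neg y) = x"
  using distrib[of x y "neg y"] by simp

lemma neg_top [simp]: "neg \<top> = \<bottom>" and neg_bot [simp]: "neg \<bottom> = \<top>"
  by (auto intro: neg_eqI)

lemma neg_eq_bot: "x \<in> carrier L \<Longrightarrow> neg x = \<bottom> \<longleftrightarrow> x = \<top>"
  by (metis neg_neg neg_bot neg_top)

definition ultrafilter :: "'a set \<Rightarrow> bool" where
  "ultrafilter u \<longleftrightarrow> u \<subseteq> carrier L \<and> \<bottom> \<notin> u \<and> (\<forall>x\<in>u. \<forall>y\<in>u. x \<sqinter> y \<in> u) \<and>
     (\<forall>x\<in>u. \<forall>y\<in>carrier L. x \<sqsubseteq> y \<longrightarrow> y \<in> u) \<and> (\<forall>x\<in>carrier L. x \<in> u \<or> neg x \<in> u)"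

definition ideal :: "'a set \<Rightarrow> bool" where
  "ideal I \<longleftrightarrow> I \<subseteq> carrier L \<and> \<bottom> \<in> I \<and> (\<forall>x\<in>I. \<forall>y\<in>I. x \<squnion> y \<in> I) \<and>
     (\<forall>x\<in>I. \<forall>y\<in>carrier L. y \<sqsubseteq> x \<longrightarrow> y \<in> I)"

text \<open>
  The ultrafilter is a filter that is maximal among those containing \<open>b\<close> and missing \<open>I\<close>.
\<close>

lemma ultrafilter_avoiding_ideal:
  assumes I: "ideal I" and b: "b \<in> carrier L" "b \<notin> I"
  obtains u where "ultrafilter u" "b \<in> u" "u \<inter> I = {}"
proof -
  define FF where "FF = {F. F \<subseteq> carrier L \<and> (\<forall>x\<in>F. \<forall>y\<in>F. x \<sqinter> y \<in> F) \<and>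
     (\<forall>x\<in>F. \<forall>y\<in>carrier L. x \<sqsubseteq> y \<longrightarrow> y \<in> F) \<and> b \<in> F \<and> F \<inter> I = {}}"
  have I': "I \<subseteq> carrier L" "\<bottom> \<in> I" "\<And>x y. x \<in> I \<Longrightarrow> y \<in> I \<Longrightarrow> x \<squnion> y \<in> I"
    "\<And>x y. x \<in> I \<Longrightarrow> y \<in> carrier L \<Longrightarrow> y \<sqsubseteq> x \<Longrightarrow> y \<in> I"
    using I unfolding ideal_def by auto
  have "{x \<in> carrier L. b \<sqsubseteq> x} \<in> FF"
    unfolding FF_def using b I' by (auto simp: le_meet_iff intro: le_trans)
  then have ne: "FF \<noteq> {}" by blast
  have "\<Union>C \<in> FF" if C: "C \<noteq> {}" "subset.chain FF C" for C
  proof -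
    have sub: "C \<subseteq> FF" and ch: "\<And>A B. A \<in> C \<Longrightarrow> B \<in> C \<Longrightarrow> A \<subseteq> B \<or> B \<subseteq> A"
      using C unfolding subset.chain_def by auto
    have meet: "x \<sqinter> y \<in> \<Union>C" if xy: "x \<in> \<Union>C" "y \<in> \<Union>C" for x y
    proof -
      obtain A B where "A \<in> C" "B \<in> C" "x \<in> A" "y \<in> B" using xy by blast
      then obtain D where D: "D \<in> C" "x \<in> D" "y \<in> D" using ch[of A B] by blast
      then have "x \<sqinter> y \<in> D" using sub unfolding FF_def by blast
      with D show ?thesis by blast
    qed
    show ?thesis
      unfolding FF_def using sub C(1) meet unfolding FF_def by blast
  qed
  from subset_Zorn_nonempty[OF ne this]
  obtain F where F: "F \<in> FF" and max: "\<And>G. G \<in> FF \<Longrightarrow> F \<subseteq> G \<Longrightarrow> G = F"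
    by metis
  have Fc: "F \<subseteq> carrier L" and Fm: "\<And>x y. x \<in> F \<Longrightarrow> y \<in> F \<Longrightarrow> x \<sqinter> y \<in> F"
    and Fu: "\<And>x y. x \<in> F \<Longrightarrow> y \<in> carrier L \<Longrightarrow> x \<sqsubseteq> y \<Longrightarrow> y \<in> F"
    and bF: "b \<in> F" and FI: "F \<inter> I = {}"
    using F unfolding FF_def by auto
  \<comment> \<open>If \<open>x \<notin> F\<close>, then the filter generated by \<open>F\<close> and \<open>x\<close> meets the ideal.\<close>
  have ext: "\<exists>f\<in>F. f \<sqinter> x \<in> I" if x: "x \<in> carrier L" "x \<notin> F" for x
  proof (rule ccontr)
    assume no: "\<not> ?thesis"
    define G where "G = {z \<in> carrier L. \<exists>f\<in>F. f \<sqinter> x \<sqsubseteq> z}"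
    have FG: "F \<subseteq> G" unfolding G_def using Fc x meet_left by blast
    have xG: "x \<in> G" unfolding G_def using bF Fc x by (auto intro: meet_right)
    have 1: "z \<sqinter> w \<in> G" if zw: "z \<in> G" "w \<in> G" for z w
    proof -
      obtain f g where fg: "f \<in> F" "g \<in> F" "f \<sqinter> x \<sqsubseteq> z" "g \<sqinter> x \<sqsubseteq> w"
        and c: "z \<in> carrier L" "w \<in> carrier L"
        using zw unfolding G_def by blast
      have fc: "f \<in> carrier L" "g \<in> carrier L" using fg Fc by auto
      have a: "(f \<sqinter> g) \<sqinter> x \<sqsubseteq> f" "(f \<sqinter> g) \<sqinter> x \<sqsubseteq> g" "(f \<sqinter> g) \<sqinter> x \<sqsubseteq> x"
        using fc x le_trans[OF meet_left[of "f \<sqinter> g" x]] by (auto simp: meet_left meet_right)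
      then have "(f \<sqinter> g) \<sqinter> x \<sqsubseteq> f \<sqinter> x" "(f \<sqinter> g) \<sqinter> x \<sqsubseteq> g \<sqinter> x"
        using fc x by (auto simp: le_meet_iff)
      then have "(f \<sqinter> g) \<sqinter> x \<sqsubseteq> z" "(f \<sqinter> g) \<sqinter> x \<sqsubseteq> w"
        using le_trans[OF _ fg(3)] le_trans[OF _ fg(4)] fc c x by auto
      then show ?thesis
        unfolding G_def using fc c x Fm[OF fg(1,2)]
        by (auto simp: le_meet_iff intro!: bexI[of _ "f \<sqinter> g"])
    qed
    have 2: "w \<in> G" if zw: "z \<in> G" "w \<in> carrier L" "z \<sqsubseteq> w" for z w
    proof -
      obtain f where f: "f \<in> F" "f \<sqinter> x \<sqsubseteq> z" and "z \<in> carrier L" using zw unfolding G_def by blast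
      then have "f \<sqinter> x \<sqsubseteq> w" using le_trans[OF f(2) zw(3)] zw x Fc by auto
      then show ?thesis unfolding G_def using f zw by blast
    qed
    have 3: "G \<inter> I = {}" unfolding G_def using no I'(4) x Fc meet_closed by blast
    have "G \<in> FF"
      unfolding FF_def mem_Collect_eq
    proof (intro conjI ballI impI)
      show "G \<subseteq> carrier L" by (simp add: G_def)
      show "b \<in> G" using FG bF by blast
    qed (use 1 2 3 in blast)+
    then have "G = F" using max FG by blast
    then show False using xG x by blast
  qed
  have "x \<in> F \<or> neg x \<in> F" if x: "x \<in> carrier L" for x
  proof (rule ccontr)
    assume "\<not> ?thesis"
    then obtain f g where fg: "f \<in> F" "f \<sqinter> x \<in> I" "g \<in> F" "g \<sqinter> neg x \<in> I"
      using ext[OF x] ext[of "neg x"] x by auto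
    define h where "h = f \<sqinter> g"
    have c: "f \<in> carrier L" "g \<in> carrier L" using fg Fc by auto
    have h: "h \<in> F" "h \<in> carrier L" "h \<sqsubseteq> f" "h \<sqsubseteq> g"
      unfolding h_def using fg Fm c by (auto intro: meet_left meet_right)
    have l: "h \<sqinter> x \<sqsubseteq> f \<sqinter> x" "h \<sqinter> neg x \<sqsubseteq> g \<sqinter> neg x"
      using le_trans[OF meet_left[of h x] h(3)] le_trans[OF meet_left[of h "neg x"] h(4)] h c x
      by (auto simp: le_meet_iff meet_right)
    then have "h \<sqinter> x \<in> I" "h \<sqinter> neg x \<in> I"
      using I'(4)[OF fg(2)] I'(4)[OF fg(4)] h x by auto
    then have "h \<in> I" using I'(3) meet_split[of h x] h x by force
    then show False using h FI by blast
  qed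
  then have "ultrafilter F" unfolding ultrafilter_def using Fc Fm Fu FI I' by blast
  with that bF FI show thesis by blast
qed

end

context contact_algebra
begin

lemma contact_mono_right:
  assumes "a \<in> carrier B" "b \<in> carrier B" "c \<in> carrier B" "contact B a b" "b \<sqsubseteq> c"
  shows "contact B a c"
proof -
  have "c = b \<squnion> c"
    using assms by (metis join_eqI le_refl)
  then show ?thesis using C4[of a b c] assms by simp
qed

lemma contact_mono:
  assumes "a \<in> carrier B" "b \<in> carrier B" "a' \<in> carrier B" "b' \<in> carrier B"
    "contact B a b" "a \<sqsubseteq> a'" "b \<sqsubseteq> b'"
  shows "contact B a' b'"
  using assms by (meson C3 contact_mono_right)

lemma contact_meet:
  assumes "a \<in> carrier B" "b \<in> carrier B" "a \<sqinter> b \<noteq> \<bottom>"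
  shows "contact B a b"
  using assms by (meson C1 contact_mono meet_closed meet_left meet_right)

lemma well_inside_le:
  assumes "a \<in> carrier B" "b \<in> carrier B" "well_inside B a b"
  shows "a \<sqsubseteq> b"
  using assms contact_meet[of a "neg b"] le_iff_meet_neg[of a b] unfolding well_inside_def by auto

lemma not_contact_bot: "a \<in> carrier B \<Longrightarrow> \<not> contact B a \<bottom>"
  using C2[of a \<bottom>] by auto

end


section \<open>Regular closed sets of a space\<close>

lemma regular_closed_iff: "F \<in> regular_closed X \<longleftrightarrow> X closure_of (X interior_of F) = F"
  unfolding regular_closed_def by (auto simp: in_closure_of)

lemma regular_closed_closedin: "F \<in> regular_closed X \<Longrightarrow> closedin X F"
  unfolding regular_closed_iff by (metis closedin_closure_of)

lemma regular_closed_subset: "F \<in> regular_closed X \<Longrightarrow> F \<subseteq> topspace X"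
  by (simp add: regular_closed_def)

lemma closure_of_interior_regular_closed:
  "F \<in> regular_closed X \<Longrightarrow> X closure_of (X interior_of F) = F"
  by (simp add: regular_closed_iff)

lemma closure_of_open_regular_closed:
  assumes "openin X U" shows "X closure_of U \<in> regular_closed X"
proof -
  have "U \<subseteq> X interior_of (X closure_of U)"
    using assms by (simp add: closure_of_subset interior_of_maximal openin_subset)
  then show ?thesis
    unfolding regular_closed_iff
    by (metis closedin_closure_of closure_of_minimal closure_of_mono interior_of_subset subset_antisym)
qed

lemma regular_closed_subset_iff:
  "\<lbrakk>F \<in> regular_closed X; closedin X G\<rbrakk> \<Longrightarrow> F \<subseteq> G \<longleftrightarrow> X interior_of F \<subseteq> G"
  by (metis closure_of_interior_regular_closed closure_of_minimal interior_of_subset order_trans)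

lemma regular_closed_Un:
  assumes "F \<in> regular_closed X" "G \<in> regular_closed X"
  shows "F \<union> G \<in> regular_closed X"
proof -
  have "F \<union> G = X closure_of (X interior_of F \<union> X interior_of G)"
    using assms by (simp add: closure_of_interior_regular_closed)
  then show ?thesis by (metis closure_of_open_regular_closed openin_Un openin_interior_of)
qed

lemma regular_closed_empty: "{} \<in> regular_closed X"
  and regular_closed_topspace: "topspace X \<in> regular_closed X"
  by (auto simp: regular_closed_iff)

lemma RCL_simps [simp]:
  "carrier (RCL X) = regular_closed X" "le (RCL X) = (\<subseteq>)" "eq (RCL X) = (=)"
  "contact (RCL X) F G \<longleftrightarrow> F \<inter> G \<noteq> {}"
  "bdd (RCL X) = {F \<in> regular_closed X. compactin X F}"
  by (auto simp: RCL_def)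

lemma partial_order_RCL: "partial_order (RCL X)"
  by unfold_locales auto

lemma RCL_least_upper_bound:
  assumes S: "S \<subseteq> regular_closed X"
  shows "least (RCL X) (X closure_of (\<Union>F\<in>S. X interior_of F)) (Upper (RCL X) S)"
proof (rule least_UpperI)
  show "X closure_of (\<Union>F\<in>S. X interior_of F) \<in> carrier (RCL X)"
    by (auto intro!: closure_of_open_regular_closed openin_Union)
  fix F assume "F \<in> S"
  then have "F = X closure_of (X interior_of F)" "X interior_of F \<subseteq> (\<Union>F\<in>S. X interior_of F)"
    using S by (auto simp: closure_of_interior_regular_closed)
  then show "F \<sqsubseteq>\<^bsub>RCL X\<^esub> X closure_of (\<Union>F\<in>S. X interior_of F)"
    by (metis RCL_simps(2) closure_of_mono)
next
  fix G assume "G \<in> Upper (RCL X) S"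
  then have G: "G \<in> regular_closed X" "\<And>F. F \<in> S \<Longrightarrow> F \<subseteq> G"
    using S by (auto simp: Upper_def)
  have "(\<Union>F\<in>S. X interior_of F) \<subseteq> G"
    using G(2) interior_of_subset[of X] by blast
  then show "X closure_of (\<Union>F\<in>S. X interior_of F) \<sqsubseteq>\<^bsub>RCL X\<^esub> G"
    using G(1) by (simp add: closure_of_minimal regular_closed_closedin)
qed (use S in auto)

lemma RCL_complete_lattice: "complete_lattice (RCL X)"
proof (rule partial_order.complete_latticeI[OF partial_order_RCL])
  fix S assume S: "S \<subseteq> carrier (RCL X)"
  then show "\<exists>s. least (RCL X) s (Upper (RCL X) S)"
    using RCL_least_upper_bound by (metis RCL_simps(1))
  show "\<exists>s. greatest (RCL X) s (Lower (RCL X) S)"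
  proof (intro exI[of _ "X closure_of (X interior_of (topspace X \<inter> \<Inter>S))"] greatest_LowerI)
    show "X closure_of (X interior_of (topspace X \<inter> \<Inter>S)) \<in> carrier (RCL X)"
      by (auto intro: closure_of_open_regular_closed)
    fix F assume F: "F \<in> S"
    have "X interior_of (topspace X \<inter> \<Inter>S) \<subseteq> F"
      using F interior_of_subset[of X "topspace X \<inter> \<Inter>S"] by blast
    then show "X closure_of (X interior_of (topspace X \<inter> \<Inter>S)) \<sqsubseteq>\<^bsub>RCL X\<^esub> F"
      using F S by (simp add: closure_of_minimal regular_closed_closedin subsetD)
  next
    fix G assume "G \<in> Lower (RCL X) S"
    then have G: "G \<in> regular_closed X" "\<And>F. F \<in> S \<Longrightarrow> G \<subseteq> F"
      using S by (auto simp: Lower_def)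
    then have "G \<subseteq> topspace X \<inter> \<Inter>S" using regular_closed_subset by blast
    then have "X closure_of (X interior_of G) \<subseteq> X closure_of (X interior_of (topspace X \<inter> \<Inter>S))"
      by (intro closure_of_mono interior_of_mono)
    then show "G \<sqsubseteq>\<^bsub>RCL X\<^esub> X closure_of (X interior_of (topspace X \<inter> \<Inter>S))"
      using G by (simp add: closure_of_interior_regular_closed)
  qed (use S in auto)
qed

lemma RCL_lattice: "lattice (RCL X)"
proof -
  interpret complete_lattice "RCL X" by (rule RCL_complete_lattice)
  show ?thesis by unfold_locales
qed

lemma RCL_sup:
  assumes "S \<subseteq> regular_closed X"
  shows "\<Squnion>\<^bsub>RCL X\<^esub> S = X closure_of (\<Union>F\<in>S. X interior_of F)"
  unfolding Lattice.sup_def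
  using RCL_least_upper_bound[OF assms]
  by (rule some_equality) (metis RCL_least_upper_bound assms partial_order.least_unique partial_order_RCL)

lemma RCL_join: "\<lbrakk>F \<in> regular_closed X; G \<in> regular_closed X\<rbrakk> \<Longrightarrow> F \<squnion>\<^bsub>RCL X\<^esub> G = F \<union> G"
  by (rule lattice.join_eqI[OF RCL_lattice]) (auto simp: regular_closed_Un)

lemma RCL_meet:
  assumes "F \<in> regular_closed X" "G \<in> regular_closed X"
  shows "F \<sqinter>\<^bsub>RCL X\<^esub> G = X closure_of (X interior_of F \<inter> X interior_of G)"
proof (rule lattice.meet_eqI[OF RCL_lattice])
  have sub: "X interior_of F \<inter> X interior_of G \<subseteq> F" "X interior_of F \<inter> X interior_of G \<subseteq> G"
    using interior_of_subset[of X F] interior_of_subset[of X G] by auto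
  then show "X closure_of (X interior_of F \<inter> X interior_of G) \<sqsubseteq>\<^bsub>RCL X\<^esub> F"
    "X closure_of (X interior_of F \<inter> X interior_of G) \<sqsubseteq>\<^bsub>RCL X\<^esub> G"
    using assms by (simp_all add: closure_of_minimal regular_closed_closedin)
  fix H assume H: "H \<in> carrier (RCL X)" "H \<sqsubseteq>\<^bsub>RCL X\<^esub> F" "H \<sqsubseteq>\<^bsub>RCL X\<^esub> G"
  then have "X interior_of H \<subseteq> X interior_of F \<inter> X interior_of G"
    by (simp add: interior_of_mono)
  then show "H \<sqsubseteq>\<^bsub>RCL X\<^esub> X closure_of (X interior_of F \<inter> X interior_of G)"
    using H by (metis RCL_simps(1,2) closure_of_interior_regular_closed closure_of_mono)
qed (use assms in \<open>auto intro!: closure_of_open_regular_closed\<close>)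

lemma RCL_bot: "\<bottom>\<^bsub>RCL X\<^esub> = {}" and RCL_top: "\<top>\<^bsub>RCL X\<^esub> = topspace X"
proof -
  interpret complete_lattice "RCL X" by (rule RCL_complete_lattice)
  show "\<bottom>\<^bsub>RCL X\<^esub> = {}"
    using regular_closed_empty bottom_lower[of "{}"] by auto
  show "\<top>\<^bsub>RCL X\<^esub> = topspace X"
    using regular_closed_topspace[of X] top_higher[of "topspace X"] top_closed regular_closed_subset[of _ X]
    by auto
qed

text \<open>
  An open set meets \<open>cl (int G) \<union> cl (int H)\<close> only inside the closure of its intersections with
  \<open>int G\<close> and \<open>int H\<close>.
\<close>

lemma RCL_distrib:
  assumes F: "F \<in> regular_closed X" and G: "G \<in> regular_closed X" and H: "H \<in> regular_closed X"
  shows "F \<sqinter>\<^bsub>RCL X\<^esub> (G \<squnion>\<^bsub>RCL X\<^esub> H) = (F \<sqinter>\<^bsub>RCL X\<^esub> G) \<squnion>\<^bsub>RCL X\<^esub> (F \<sqinter>\<^bsub>RCL X\<^esub> H)"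
proof -
  let ?c = "\<lambda>S. X closure_of S" and ?i = "\<lambda>S. X interior_of S"
  have "?i F \<inter> ?i (G \<union> H) \<subseteq> ?i F \<inter> (?c (?i G) \<union> ?c (?i H))"
    using G H interior_of_subset[of X "G \<union> H"] by (auto simp: closure_of_interior_regular_closed)
  also have "\<dots> \<subseteq> ?c (?i F \<inter> ?i G) \<union> ?c (?i F \<inter> ?i H)"
    using openin_Int_closure_of_subset[of X "?i F" "?i G"]
      openin_Int_closure_of_subset[of X "?i F" "?i H"] by auto
  finally have "?c (?i F \<inter> ?i (G \<union> H)) \<subseteq> ?c (?i F \<inter> ?i G) \<union> ?c (?i F \<inter> ?i H)"
    by (simp add: closure_of_minimal closedin_Un)
  moreover have "?c (?i F \<inter> ?i G) \<union> ?c (?i F \<inter> ?i H) \<subseteq> ?c (?i F \<inter> ?i (G \<union> H))"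
    by (intro Un_least closure_of_mono Int_mono interior_of_mono) auto
  ultimately show ?thesis
    using assms by (simp add: RCL_join RCL_meet regular_closed_Un closure_of_open_regular_closed openin_Int)
qed

lemma compl_interior_eq_closure:
  "topspace X - X interior_of F = X closure_of (topspace X - F)"
  by (simp add: closure_of_complement)

lemma regular_closed_compl:
  assumes "F \<in> regular_closed X"
  shows "topspace X - X interior_of F \<in> regular_closed X"
  using assms by (simp add: compl_interior_eq_closure closure_of_open_regular_closed
      openin_diff regular_closed_closedin)

lemma RCL_complements:
  assumes "F \<in> regular_closed X"
  shows "F \<squnion>\<^bsub>RCL X\<^esub> (topspace X - X interior_of F) = \<top>\<^bsub>RCL X\<^esub>"
    "F \<sqinter>\<^bsub>RCL X\<^esub> (topspace X - X interior_of F) = \<bottom>\<^bsub>RCL X\<^esub>"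
proof -
  show "F \<squnion>\<^bsub>RCL X\<^esub> (topspace X - X interior_of F) = \<top>\<^bsub>RCL X\<^esub>"
    using assms regular_closed_subset[OF assms] interior_of_subset[of X F]
    by (auto simp: RCL_join RCL_top regular_closed_compl)
  show "F \<sqinter>\<^bsub>RCL X\<^esub> (topspace X - X interior_of F) = \<bottom>\<^bsub>RCL X\<^esub>"
    using assms interior_of_subset[of X "topspace X - X interior_of F"]
    by (simp add: RCL_meet RCL_bot regular_closed_compl closure_of_eq_empty_gen disjnt_def) blast
qed

lemma RCL_boolean_lattice: "boolean_lattice (RCL X)"
proof -
  interpret bounded_lattice "RCL X"
    by (rule complete_lattice.complete_bounded_lattice[OF RCL_complete_lattice])
  show ?thesis
  proof
    fix F G H assume "F \<in> carrier (RCL X)" "G \<in> carrier (RCL X)" "H \<in> carrier (RCL X)"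
    then show "F \<sqinter>\<^bsub>RCL X\<^esub> (G \<squnion>\<^bsub>RCL X\<^esub> H) = (F \<sqinter>\<^bsub>RCL X\<^esub> G) \<squnion>\<^bsub>RCL X\<^esub> (F \<sqinter>\<^bsub>RCL X\<^esub> H)"
      by (simp only: RCL_distrib RCL_simps)
  next
    fix F assume "F \<in> carrier (RCL X)"
    then show "\<exists>G\<in>carrier (RCL X). F \<squnion>\<^bsub>RCL X\<^esub> G = \<top>\<^bsub>RCL X\<^esub> \<and> F \<sqinter>\<^bsub>RCL X\<^esub> G = \<bottom>\<^bsub>RCL X\<^esub>"
      using RCL_complements[of F X] regular_closed_compl[of F X] by (metis RCL_simps(1))
  qed
qed

lemma RCL_neg: "F \<in> regular_closed X \<Longrightarrow> bcompl (RCL X) F = topspace X - X interior_of F"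
  by (rule boolean_lattice.neg_eqI[OF RCL_boolean_lattice])
    (simp_all add: RCL_complements regular_closed_compl)

lemma RCL_well_inside:
  assumes "F \<in> regular_closed X" "G \<in> regular_closed X"
  shows "well_inside (RCL X) F G \<longleftrightarrow> F \<subseteq> X interior_of G"
  using assms regular_closed_subset[of F X] by (auto simp: well_inside_def RCL_neg)

lemma RCL_contact_algebra: "contact_algebra (RCL X)"
proof -
  interpret boolean_lattice "RCL X" by (rule RCL_boolean_lattice)
  show ?thesis
    by unfold_locales (auto simp: RCL_bot RCL_join)
qed

text \<open>
  Separate \<open>K\<close> from the complement of \<open>U\<close> by an open set, shrink it to an open set with compact
  closure, and take the closure.
\<close>

lemma regular_closed_nbhd:
  assumes X: "locally_compact_space X" "Hausdorff_space X"
    and K: "compactin X K" and U: "openin X U" "K \<subseteq> U"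
  obtains F where "F \<in> regular_closed X" "compactin X F" "K \<subseteq> X interior_of F" "F \<subseteq> U"
proof -
  have reg: "regular_space X"
    using X locally_compact_Hausdorff_imp_regular_space by blast
  have c: "closedin X (topspace X - U)" and d: "disjnt K (topspace X - U)"
    using U by (auto simp: disjnt_iff)
  obtain V W where VW: "openin X V" "openin X W" "K \<subseteq> V" "topspace X - U \<subseteq> W" "disjnt V W"
    using regular_space_compact_closed_separation[OF reg K c d] by metis
  have "\<exists>U L. openin X U \<and> compactin X L \<and> closedin X L \<and> K \<subseteq> U \<and> U \<subseteq> L"
    using locally_compact_space_compact_closed_compact[OF disjI1, OF X(2)] X(1) K by simp
  then obtain U' L where L: "openin X U'" "compactin X L" "closedin X L" "K \<subseteq> U'" "U' \<subseteq> L"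
    by metis
  define F where "F = X closure_of (V \<inter> U')"
  have o: "openin X (V \<inter> U')" using VW L by blast
  have FL: "F \<subseteq> L" unfolding F_def using L by (intro closure_of_minimal) auto
  have "F \<subseteq> topspace X - W"
    unfolding F_def using VW openin_subset[OF o] by (intro closure_of_minimal) (auto simp: disjnt_iff)
  then have "F \<subseteq> U" using VW(4) by blast
  moreover have "compactin X F"
    using closed_compactin[OF L(2) FL] by (simp add: F_def)
  moreover have "K \<subseteq> X interior_of F"
  proof -
    have "V \<inter> U' \<subseteq> X interior_of F"
      unfolding F_def using o by (simp add: closure_of_subset interior_of_maximal openin_subset)
    then show ?thesis using VW L by blast
  qed
  ultimately show thesis
    using that closure_of_open_regular_closed[OF o] unfolding F_def by blast
qed

lemma regular_closed_nbhd_point: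
  assumes X: "locally_compact_space X" "Hausdorff_space X"
    and U: "openin X U" "x \<in> U"
  obtains F where "F \<in> regular_closed X" "compactin X F" "x \<in> X interior_of F" "F \<subseteq> U"
  using regular_closed_nbhd[OF X, of "{x}" U] U openin_subset
  by (metis compactin_sing empty_subsetI insert_subset subsetD)

lemma RCL_local_contact_algebra:
  assumes X: "locally_compact_space X" "Hausdorff_space X"
  shows "local_contact_algebra (RCL X)"
proof -
  interpret contact_algebra "RCL X" by (rule RCL_contact_algebra)
  show ?thesis
  proof
    fix a c assume "a \<in> bdd (RCL X)" "c \<in> carrier (RCL X)" "well_inside (RCL X) a c"
    then have a: "a \<in> regular_closed X" "compactin X a" "c \<in> regular_closed X" "a \<subseteq> X interior_of c"
      by (auto simp: RCL_well_inside)
    obtain b where "b \<in> regular_closed X" "compactin X b" "a \<subseteq> X interior_of b" "b \<subseteq> X interior_of c"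
      using regular_closed_nbhd[OF X a(2) openin_interior_of a(4)] .
    then show "\<exists>b\<in>bdd (RCL X). well_inside (RCL X) a b \<and> well_inside (RCL X) b c"
      using a by (auto simp: RCL_well_inside intro!: bexI[of _ b])
  next
    fix a b assume "a \<in> carrier (RCL X)" "b \<in> carrier (RCL X)" "contact (RCL X) a b"
    then obtain x where x: "x \<in> a" "x \<in> b" and ab: "a \<in> regular_closed X" "b \<in> regular_closed X"
      by auto
    then have "x \<in> topspace X" using regular_closed_subset by blast
    then obtain c where c: "c \<in> regular_closed X" "compactin X c" "x \<in> X interior_of c"
      using regular_closed_nbhd_point[OF X openin_topspace] by blast
    have "x \<in> X interior_of c \<inter> X closure_of (X interior_of b)"
      using c x ab by (simp add: closure_of_interior_regular_closed)
    then have "x \<in> c \<sqinter>\<^bsub>RCL X\<^esub> b"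
      using openin_Int_closure_of_subset[of X "X interior_of c" "X interior_of b"] c ab
      by (auto simp: RCL_meet)
    then show "\<exists>c\<in>bdd (RCL X). contact (RCL X) a (c \<sqinter>\<^bsub>RCL X\<^esub> b)"
      using c x by auto
  next
    fix a assume a: "a \<in> carrier (RCL X)" "a \<noteq> \<bottom>\<^bsub>RCL X\<^esub>"
    then have "X interior_of a \<noteq> {}"
      by (metis RCL_bot RCL_simps(1) closure_of_empty closure_of_interior_regular_closed)
    then obtain x where x: "x \<in> X interior_of a" by blast
    obtain b where "b \<in> regular_closed X" "compactin X b" "x \<in> X interior_of b" "b \<subseteq> X interior_of a"
      using regular_closed_nbhd_point[OF X openin_interior_of x] .
    then show "\<exists>b\<in>bdd (RCL X). b \<noteq> \<bottom>\<^bsub>RCL X\<^esub> \<and> well_inside (RCL X) b a"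
      using a interior_of_subset[of X b] by (auto simp: RCL_well_inside RCL_bot intro!: bexI[of _ b])
  qed (auto simp: RCL_bot RCL_join regular_closed_empty regular_closed_Un compactin_Un
      intro: closed_compactin regular_closed_closedin)
qed

text \<open>
  If \<open>a\<close> does not meet its complement in the algebra, which is the complement of \<open>int a\<close>, then \<open>a\<close> is open.
\<close>

lemma RCL_connected:
  assumes "connected_space X" shows "connected_contact (RCL X)"
  unfolding connected_contact_def
proof (intro ballI impI)
  fix a assume a: "a \<in> carrier (RCL X)" "a \<noteq> \<bottom>\<^bsub>RCL X\<^esub> \<and> a \<noteq> \<top>\<^bsub>RCL X\<^esub>"
  show "contact (RCL X) a (bcompl (RCL X) a)"
  proof (rule ccontr)
    assume "\<not> ?thesis"
    then have "a \<subseteq> X interior_of a"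
      using a regular_closed_subset[of a X] by (auto simp: RCL_neg)
    then have "openin X a" by (simp add: subset_interior_of_eq)
    then show False
      using assms a regular_closed_closedin[of a X]
      unfolding connected_space_clopen_in by (auto simp: RCL_bot RCL_top)
  qed
qed

lemma DLCCon_local: "DLCCon_algebra A \<Longrightarrow> local_contact_algebra A"
  by (simp add: DLCCon_algebra_def)

lemma RCL_DLCCon_algebra: "LCCon_space X \<Longrightarrow> DLCCon_algebra (RCL X)"
  by (simp add: LCCon_space_def DLCCon_algebra_def RCL_local_contact_algebra RCL_connected
      RCL_complete_lattice)


section \<open>Complete Boolean homomorphisms\<close>

lemma complete_boolean_homD:
  assumes "complete_boolean_hom A B \<phi>"
  shows "complete_lattice A" "complete_lattice B"
    "\<phi> \<in> carrier A \<rightarrow>\<^sub>E carrier B" "\<And>a. a \<in> carrier A \<Longrightarrow> \<phi> a \<in> carrier B"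
    "\<And>S. S \<subseteq> carrier A \<Longrightarrow> \<phi> (\<Squnion>\<^bsub>A\<^esub> S) = \<Squnion>\<^bsub>B\<^esub> (\<phi> ` S)"
    "\<And>S. S \<subseteq> carrier A \<Longrightarrow> \<phi> (\<Sqinter>\<^bsub>A\<^esub> S) = \<Sqinter>\<^bsub>B\<^esub> (\<phi> ` S)"
  using assms unfolding complete_boolean_hom_def sup_pres_def inf_pres_def by auto

lemma complete_boolean_hom_join:
  assumes "complete_boolean_hom A B \<phi>" "a \<in> carrier A" "b \<in> carrier A"
  shows "\<phi> (a \<squnion>\<^bsub>A\<^esub> b) = \<phi> a \<squnion>\<^bsub>B\<^esub> \<phi> b"
  using complete_boolean_homD(5)[OF assms(1), of "{a, b}"] assms by (simp add: join_def)

lemma complete_boolean_hom_meet: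
  assumes "complete_boolean_hom A B \<phi>" "a \<in> carrier A" "b \<in> carrier A"
  shows "\<phi> (a \<sqinter>\<^bsub>A\<^esub> b) = \<phi> a \<sqinter>\<^bsub>B\<^esub> \<phi> b"
  using complete_boolean_homD(6)[OF assms(1), of "{a, b}"] assms by (simp add: meet_def)

lemma (in complete_lattice) sup_empty: "\<Squnion>{} = \<bottom>"
  by (rule sup_eqI) auto

lemma (in complete_lattice) inf_empty: "\<Sqinter>{} = \<top>"
  by (rule inf_eqI) auto

lemma complete_boolean_hom_bot:
  assumes "complete_boolean_hom A B \<phi>" shows "\<phi> \<bottom>\<^bsub>A\<^esub> = \<bottom>\<^bsub>B\<^esub>"
  using complete_boolean_homD(5)[OF assms, of "{}"] complete_boolean_homD(1,2)[OF assms]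
  by (simp add: complete_lattice.sup_empty)

lemma complete_boolean_hom_top:
  assumes "complete_boolean_hom A B \<phi>" shows "\<phi> \<top>\<^bsub>A\<^esub> = \<top>\<^bsub>B\<^esub>"
  using complete_boolean_homD(6)[OF assms, of "{}"] complete_boolean_homD(1,2)[OF assms]
  by (simp add: complete_lattice.inf_empty)

lemma complete_boolean_hom_mono:
  assumes \<phi>: "complete_boolean_hom A B \<phi>" and ab: "a \<in> carrier A" "b \<in> carrier A" "a \<sqsubseteq>\<^bsub>A\<^esub> b"
  shows "\<phi> a \<sqsubseteq>\<^bsub>B\<^esub> \<phi> b"
proof -
  interpret A: complete_lattice A by (rule complete_boolean_homD(1)[OF \<phi>])
  interpret B: complete_lattice B by (rule complete_boolean_homD(2)[OF \<phi>])
  have "a \<squnion>\<^bsub>A\<^esub> b = b" using ab A.join_eqI[of a b b] by simp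
  then have "\<phi> b = \<phi> a \<squnion>\<^bsub>B\<^esub> \<phi> b" using complete_boolean_hom_join[OF \<phi> ab(1,2)] by simp
  then show ?thesis using B.join_left[of "\<phi> a" "\<phi> b"] complete_boolean_homD(4)[OF \<phi>] ab by simp
qed

lemma complete_boolean_hom_neg:
  assumes \<phi>: "complete_boolean_hom A B \<phi>" and A: "boolean_lattice A" and B: "boolean_lattice B"
    and a: "a \<in> carrier A"
  shows "\<phi> (bcompl A a) = bcompl B (\<phi> a)"
proof -
  interpret A: boolean_lattice A by (rule A)
  interpret B: boolean_lattice B by (rule B)
  have "\<phi> a \<squnion>\<^bsub>B\<^esub> \<phi> (bcompl A a) = \<top>\<^bsub>B\<^esub>"
    using complete_boolean_hom_join[OF \<phi> a A.neg_closed[OF a]] a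
    by (simp add: complete_boolean_hom_top[OF \<phi>])
  moreover have "\<phi> a \<sqinter>\<^bsub>B\<^esub> \<phi> (bcompl A a) = \<bottom>\<^bsub>B\<^esub>"
    using complete_boolean_hom_meet[OF \<phi> a A.neg_closed[OF a]] a
    by (simp add: complete_boolean_hom_bot[OF \<phi>])
  ultimately show ?thesis
    using B.neg_eqI complete_boolean_homD(4)[OF \<phi>] a by (metis A.neg_closed)
qed

text \<open>
  De Morgan's law for arbitrary meets: it reduces the preservation of meets to that of joins and
  complements.
\<close>

lemma inf_eq_neg_sup:
  assumes "complete_lattice L" "boolean_lattice L" "S \<subseteq> carrier L"
  shows "\<Sqinter>\<^bsub>L\<^esub> S = bcompl L (\<Squnion>\<^bsub>L\<^esub> (bcompl L ` S))"
proof -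
  interpret complete_lattice L by fact
  interpret boolean_lattice L by fact
  have c: "neg ` S \<subseteq> carrier L" using assms(3) by auto
  show ?thesis
  proof (rule inf_eqI)
    fix x assume x: "x \<in> S"
    then have "neg x \<sqsubseteq>\<^bsub>L\<^esub> \<Squnion>\<^bsub>L\<^esub>(neg ` S)" using c sup_upper by blast
    then have "neg (\<Squnion>\<^bsub>L\<^esub>(neg ` S)) \<sqsubseteq>\<^bsub>L\<^esub> neg (neg x)"
      using neg_antimono[of "neg x" "\<Squnion>\<^bsub>L\<^esub>(neg ` S)"] x assms(3) sup_closed[OF c] neg_closed by blast
    then show "neg (\<Squnion>\<^bsub>L\<^esub>(neg ` S)) \<sqsubseteq>\<^bsub>L\<^esub> x" using x assms(3) by auto
  next
    fix z assume z: "z \<in> carrier L" "\<And>x. x \<in> S \<Longrightarrow> z \<sqsubseteq>\<^bsub>L\<^esub> x"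
    have "\<Squnion>\<^bsub>L\<^esub>(neg ` S) \<sqsubseteq>\<^bsub>L\<^esub> neg z"
      using z assms(3) c by (intro sup_least) (auto intro!: neg_antimono)
    then show "z \<sqsubseteq>\<^bsub>L\<^esub> neg (\<Squnion>\<^bsub>L\<^esub>(neg ` S))"
      using neg_antimono[of "\<Squnion>\<^bsub>L\<^esub>(neg ` S)" "neg z"] z sup_closed[OF c] by simp
  qed (use assms c in auto)
qed

lemma complete_boolean_homI:
  assumes A: "complete_lattice A" "boolean_lattice A" and B: "complete_lattice B" "boolean_lattice B"
    and \<phi>: "\<phi> \<in> carrier A \<rightarrow>\<^sub>E carrier B"
    and sup: "\<And>S. S \<subseteq> carrier A \<Longrightarrow> \<phi> (\<Squnion>\<^bsub>A\<^esub> S) = \<Squnion>\<^bsub>B\<^esub> (\<phi> ` S)"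
    and neg: "\<And>a. a \<in> carrier A \<Longrightarrow> \<phi> (bcompl A a) = bcompl B (\<phi> a)"
  shows "complete_boolean_hom A B \<phi>"
proof -
  interpret A: complete_lattice A by fact
  interpret A: boolean_lattice A by fact
  have "\<phi> (\<Sqinter>\<^bsub>A\<^esub> S) = \<Sqinter>\<^bsub>B\<^esub> (\<phi> ` S)" if S: "S \<subseteq> carrier A" for S
  proof -
    have c: "bcompl A ` S \<subseteq> carrier A" using S by auto
    have "\<phi> (\<Sqinter>\<^bsub>A\<^esub> S) = bcompl B (\<Squnion>\<^bsub>B\<^esub> (\<phi> ` bcompl A ` S))"
      using S c by (simp add: inf_eq_neg_sup[OF A] neg sup)
    also have "\<phi> ` bcompl A ` S = bcompl B ` \<phi> ` S"
      unfolding image_image using S neg by (intro image_cong) auto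
    also have "bcompl B (\<Squnion>\<^bsub>B\<^esub> (bcompl B ` \<phi> ` S)) = \<Sqinter>\<^bsub>B\<^esub> (\<phi> ` S)"
      using S \<phi> by (subst inf_eq_neg_sup[OF B]) auto
    finally show ?thesis .
  qed
  then show ?thesis
    using A B \<phi> sup by (simp add: complete_boolean_hom_def sup_pres_def inf_pres_def)
qed

text \<open>
  The left adjoint at \<open>b\<close> is the meet of all \<open>a\<close> with \<open>b \<sqsubseteq> \<phi> a\<close>; the adjunction holds because \<open>\<phi>\<close>
  preserves this meet.
\<close>

lemma left_adj_characterization:
  assumes \<phi>: "complete_boolean_hom A B \<phi>" and b: "b \<in> carrier B"
  shows "left_adj A B \<phi> b \<in> carrier A \<and>
    (\<forall>a\<in>carrier A. b \<sqsubseteq>\<^bsub>B\<^esub> \<phi> a \<longleftrightarrow> left_adj A B \<phi> b \<sqsubseteq>\<^bsub>A\<^esub> a)"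
proof -
  interpret A: complete_lattice A by (rule complete_boolean_homD(1)[OF \<phi>])
  interpret B: complete_lattice B by (rule complete_boolean_homD(2)[OF \<phi>])
  define S where "S = {a \<in> carrier A. b \<sqsubseteq>\<^bsub>B\<^esub> \<phi> a}"
  define c where "c = \<Sqinter>\<^bsub>A\<^esub> S"
  have S: "S \<subseteq> carrier A" by (auto simp: S_def)
  have c: "c \<in> carrier A" unfolding c_def using S by simp
  have "b \<sqsubseteq>\<^bsub>B\<^esub> \<phi> c"
    unfolding c_def complete_boolean_homD(6)[OF \<phi> S]
    using b complete_boolean_homD(4)[OF \<phi>] by (intro B.inf_greatest) (auto simp: S_def)
  note bc = this
  have adj: "b \<sqsubseteq>\<^bsub>B\<^esub> \<phi> a \<longleftrightarrow> c \<sqsubseteq>\<^bsub>A\<^esub> a" if a: "a \<in> carrier A" for a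
  proof
    assume "b \<sqsubseteq>\<^bsub>B\<^esub> \<phi> a"
    then have "a \<in> S" using a by (simp add: S_def)
    then show "c \<sqsubseteq>\<^bsub>A\<^esub> a" unfolding c_def by (rule A.inf_lower[OF S])
  next
    assume "c \<sqsubseteq>\<^bsub>A\<^esub> a"
    then show "b \<sqsubseteq>\<^bsub>B\<^esub> \<phi> a"
      using B.le_trans[OF \<open>b \<sqsubseteq>\<^bsub>B\<^esub> \<phi> c\<close> complete_boolean_hom_mono[OF \<phi> c a]]
        a b c complete_boolean_homD(4)[OF \<phi>] by blast
  qed
  have "left_adj A B \<phi> b = c"
    unfolding left_adj_def
  proof (rule the_equality)
    fix d assume d: "d \<in> carrier A \<and> (\<forall>a\<in>carrier A. b \<sqsubseteq>\<^bsub>B\<^esub> \<phi> a \<longleftrightarrow> d \<sqsubseteq>\<^bsub>A\<^esub> a)"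
    then show "d = c" using adj c by (meson A.le_antisym A.le_refl)
  qed (use adj c in auto)
  then show ?thesis using adj c by simp
qed

text \<open>
  The bounded elements form an ideal, so the left adjoint at \<open>b\<close> is bounded iff some bounded \<open>a\<close>
  lies above it.  In this form the condition needs no left adjoint to be computed.
\<close>

lemma DSkePer_hom_iff:
  assumes A: "local_contact_algebra A" and B: "local_contact_algebra B"
  shows "\<phi> \<in> DSkePer_hom A B \<longleftrightarrow> \<phi> \<in> DSke_hom A B \<and>
    (\<forall>b\<in>bdd B. \<exists>a\<in>bdd A. b \<sqsubseteq>\<^bsub>B\<^esub> \<phi> a) \<and> (\<forall>a\<in>bdd A. \<phi> a \<in> bdd B)"
proof (cases "\<phi> \<in> DSke_hom A B")
  case True
  then have \<phi>: "complete_boolean_hom A B \<phi>" by (simp add: DSke_hom_def)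
  interpret A: local_contact_algebra A by fact
  interpret B: local_contact_algebra B by fact
  have "left_adj A B \<phi> b \<in> bdd A \<longleftrightarrow> (\<exists>a\<in>bdd A. b \<sqsubseteq>\<^bsub>B\<^esub> \<phi> a)" if b: "b \<in> bdd B" for b
  proof -
    have bc: "b \<in> carrier B" using b B.bdd_sub by blast
    have c: "left_adj A B \<phi> b \<in> carrier A"
      and adj: "\<And>a. a \<in> carrier A \<Longrightarrow> b \<sqsubseteq>\<^bsub>B\<^esub> \<phi> a \<longleftrightarrow> left_adj A B \<phi> b \<sqsubseteq>\<^bsub>A\<^esub> a"
      using left_adj_characterization[OF \<phi> bc] by auto
    then have "b \<sqsubseteq>\<^bsub>B\<^esub> \<phi> (left_adj A B \<phi> b)" using A.le_refl[OF c] by simp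
    moreover have "left_adj A B \<phi> b \<in> bdd A" if "a \<in> bdd A" "b \<sqsubseteq>\<^bsub>B\<^esub> \<phi> a" for a
      using A.bdd_down[OF that(1) c] adj[of a] that A.bdd_sub by blast
    ultimately show ?thesis by blast
  qed
  then show ?thesis using True by (auto simp: DSkePer_hom_def)
qed (simp add: DSkePer_hom_def)


section \<open>The algebra homomorphism of a skeletal perfect map\<close>

text \<open>
  The form in which skeletality is used throughout: \<open>f\<^sup>-\<^sup>1 V\<close> is dense in the larger open set
  \<open>f\<^sup>-\<^sup>1 (int (cl V))\<close>.
\<close>

lemma skeletal_preimage_interior_closure:
  assumes "skeletal_map X Y f" "continuous_map X Y f" "openin Y V"
  shows "{x \<in> topspace X. f x \<in> Y interior_of (Y closure_of V)}
    \<subseteq> X closure_of {x \<in> topspace X. f x \<in> V}"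
proof -
  have "{x \<in> topspace X. f x \<in> Y interior_of (Y closure_of V)}
      \<subseteq> X interior_of {x \<in> topspace X. f x \<in> Y closure_of V}"
    using assms(2) interior_of_subset[of Y "Y closure_of V"]
    by (intro interior_of_maximal openin_continuous_map_preimage) auto
  then show ?thesis using assms(1,3) unfolding skeletal_map_def by blast
qed

lemma RC_map_apply:
  "G \<in> regular_closed Y \<Longrightarrow>
    RC_map X Y f G = X closure_of {x \<in> topspace X. f x \<in> Y interior_of G}"
  by (simp add: RC_map_def)

lemma RC_map_lower: "G \<in> regular_closed Y \<Longrightarrow>
    {x \<in> topspace X. f x \<in> Y interior_of G} \<subseteq> RC_map X Y f G"
  unfolding RC_map_apply by (rule closure_of_subset) auto

lemma RC_map_upper:
  assumes "continuous_map X Y f" "G \<in> regular_closed Y"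
  shows "RC_map X Y f G \<subseteq> {x \<in> topspace X. f x \<in> G}"
  unfolding RC_map_apply[OF assms(2)]
  using closedin_continuous_map_preimage[OF assms(1) regular_closed_closedin[OF assms(2)]]
    interior_of_subset[of Y G] by (intro closure_of_minimal) auto

lemma RC_map_regular_closed:
  "\<lbrakk>continuous_map X Y f; G \<in> regular_closed Y\<rbrakk> \<Longrightarrow> RC_map X Y f G \<in> regular_closed X"
  by (simp add: RC_map_apply closure_of_open_regular_closed openin_continuous_map_preimage)

lemma RC_map_extensional: "RC_map X Y f \<in> extensional (regular_closed Y)"
  by (simp add: RC_map_def)

text \<open>
  With \<open>V\<close> the union of the interiors of the members of \<open>S\<close>, the left side is the closure of
  \<open>f\<^sup>-\<^sup>1 (int (cl V))\<close> and the right side the closure of \<open>f\<^sup>-\<^sup>1 V\<close>.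
\<close>

lemma RC_map_sup:
  assumes f: "skeletal_map X Y f" "continuous_map X Y f" and S: "S \<subseteq> regular_closed Y"
  shows "RC_map X Y f (\<Squnion>\<^bsub>RCL Y\<^esub> S) = \<Squnion>\<^bsub>RCL X\<^esub> (RC_map X Y f ` S)"
proof -
  let ?V = "\<Union>G\<in>S. Y interior_of G"
  let ?p = "\<lambda>V. {x \<in> topspace X. f x \<in> V}"
  have V: "openin Y ?V" by (rule openin_Union) auto
  have RS: "RC_map X Y f ` S \<subseteq> regular_closed X"
    using S RC_map_regular_closed[OF f(2)] by blast
  have VV: "?V \<subseteq> Y interior_of (Y closure_of ?V)"
    using V by (simp add: closure_of_subset interior_of_maximal openin_subset)
  have "RC_map X Y f (\<Squnion>\<^bsub>RCL Y\<^esub> S) = X closure_of (?p (Y interior_of (Y closure_of ?V)))"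
    using S V by (simp add: RCL_sup RC_map_apply closure_of_open_regular_closed)
  also have "\<dots> = X closure_of (?p ?V)"
  proof
    show "X closure_of (?p (Y interior_of (Y closure_of ?V))) \<subseteq> X closure_of (?p ?V)"
      using skeletal_preimage_interior_closure[OF f V] by (simp add: closure_of_minimal)
    show "X closure_of (?p ?V) \<subseteq> X closure_of (?p (Y interior_of (Y closure_of ?V)))"
      using VV by (intro closure_of_mono) blast
  qed
  also have "\<dots> = X closure_of (\<Union>F\<in>RC_map X Y f ` S. X interior_of F)"
  proof
    have "?p (Y interior_of G) \<subseteq> X interior_of (RC_map X Y f G)" if "G \<in> S" for G
      using that S f RC_map_lower[of G Y X f]
      by (intro interior_of_maximal openin_continuous_map_preimage) auto
    then show "X closure_of (?p ?V) \<subseteq> X closure_of (\<Union>F\<in>RC_map X Y f ` S. X interior_of F)"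
      by (intro closure_of_mono) blast
    have "RC_map X Y f G \<subseteq> X closure_of (?p ?V)" if "G \<in> S" for G
    proof -
      have "RC_map X Y f G = X closure_of (?p (Y interior_of G))"
        using that S by (auto simp: RC_map_apply)
      moreover have "?p (Y interior_of G) \<subseteq> ?p ?V" using that by blast
      ultimately show ?thesis by (simp add: closure_of_mono)
    qed
    then show "X closure_of (\<Union>F\<in>RC_map X Y f ` S. X interior_of F) \<subseteq> X closure_of (?p ?V)"
      using interior_of_subset[of X] by (intro closure_of_minimal) fastforce+
  qed
  also have "\<dots> = \<Squnion>\<^bsub>RCL X\<^esub> (RC_map X Y f ` S)"
    using RS by (simp add: RCL_sup)
  finally show ?thesis .
qed

text \<open>
  Both sides are the complement of \<open>int (f\<^sup>-\<^sup>1 G)\<close>: for the right side, skeletality applied to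
  \<open>V = int G\<close> gives \<open>int (f\<^sup>-\<^sup>1 G) \<subseteq> RC_map X Y f G \<subseteq> f\<^sup>-\<^sup>1 G\<close>.
\<close>

lemma RC_map_neg:
  assumes f: "skeletal_map X Y f" "continuous_map X Y f" and G: "G \<in> regular_closed Y"
  shows "RC_map X Y f (topspace Y - Y interior_of G) = topspace X - X interior_of (RC_map X Y f G)"
proof -
  let ?p = "\<lambda>V. {x \<in> topspace X. f x \<in> V}"
  have fXY: "f x \<in> topspace Y" if "x \<in> topspace X" for x
    using f(2) that by (metis continuous_map_def Pi_iff)
  have 1: "Y interior_of (topspace Y - Y interior_of G) = topspace Y - G"
    using G by (simp add: interior_of_complement closure_of_interior_regular_closed)
  have "RC_map X Y f (topspace Y - Y interior_of G) = X closure_of (?p (topspace Y - G))"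
    using G by (simp add: RC_map_apply regular_closed_compl 1)
  also have "?p (topspace Y - G) = topspace X - ?p G" using fXY by auto
  also have "X closure_of (topspace X - ?p G) = topspace X - X interior_of (?p G)"
    by (rule closure_of_complement)
  also have "X interior_of (?p G) = X interior_of (RC_map X Y f G)"
  proof
    have "X interior_of (?p (Y closure_of (Y interior_of G))) \<subseteq> X closure_of (?p (Y interior_of G))"
      using f(1) openin_interior_of[of Y G] unfolding skeletal_map_def by simp
    then have "X interior_of (?p G) \<subseteq> RC_map X Y f G"
      using G by (simp add: closure_of_interior_regular_closed RC_map_apply)
    then show "X interior_of (?p G) \<subseteq> X interior_of (RC_map X Y f G)"
      by (simp add: interior_of_maximal)
    show "X interior_of (RC_map X Y f G) \<subseteq> X interior_of (?p G)"
      by (intro interior_of_mono RC_map_upper f G)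
  qed
  finally show ?thesis .
qed

lemma RC_map_in_DSkePer_hom:
  assumes X: "locally_compact_space X" "Hausdorff_space X"
    and Y: "locally_compact_space Y" "Hausdorff_space Y" and f: "f \<in> SkePer_hom X Y"
  shows "RC_map X Y f \<in> DSkePer_hom (RCL Y) (RCL X)"
proof -
  have sk: "skeletal_map X Y f" and cf: "continuous_map X Y f" and pf: "proper_map X Y f"
    using f by (auto simp: SkePer_hom_def)
  have hom: "complete_boolean_hom (RCL Y) (RCL X) (RC_map X Y f)"
  proof (rule complete_boolean_homI[OF RCL_complete_lattice RCL_boolean_lattice
        RCL_complete_lattice RCL_boolean_lattice])
    show "RC_map X Y f \<in> carrier (RCL Y) \<rightarrow>\<^sub>E carrier (RCL X)"
      using RC_map_regular_closed[OF cf] RC_map_extensional[of X Y f]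
      by (auto simp: PiE_def extensional_def)
    show "RC_map X Y f (\<Squnion>\<^bsub>RCL Y\<^esub> S) = \<Squnion>\<^bsub>RCL X\<^esub> (RC_map X Y f ` S)"
      if "S \<subseteq> carrier (RCL Y)" for S using RC_map_sup[OF sk cf] that by simp
    show "RC_map X Y f (bcompl (RCL Y) G) = bcompl (RCL X) (RC_map X Y f G)"
      if "G \<in> carrier (RCL Y)" for G
      using that by (simp add: RCL_neg RC_map_neg[OF sk cf] RC_map_regular_closed[OF cf])
  qed
  have L1: "contact (RCL Y) a b"
    if "a \<in> carrier (RCL Y)" "b \<in> carrier (RCL Y)"
      "contact (RCL X) (RC_map X Y f a) (RC_map X Y f b)" for a b
    using that RC_map_upper[OF cf, of a] RC_map_upper[OF cf, of b] by auto
  have L2: "\<exists>G\<in>bdd (RCL Y). F \<subseteq> RC_map X Y f G" if F: "F \<in> bdd (RCL X)" for F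
  proof -
    have F': "F \<subseteq> topspace X" using F regular_closed_subset by auto
    have "compactin Y (f ` F)" using F cf by (auto intro: image_compactin)
    then obtain G where G: "G \<in> regular_closed Y" "compactin Y G" "f ` F \<subseteq> Y interior_of G"
      using regular_closed_nbhd[OF Y _ openin_topspace] compactin_subset_topspace by metis
    then have "F \<subseteq> RC_map X Y f G" using RC_map_lower[OF G(1), of X f] F' by blast
    then show ?thesis using G by auto
  qed
  have L3: "RC_map X Y f G \<in> bdd (RCL X)" if G: "G \<in> bdd (RCL Y)" for G
  proof -
    have "compactin X {x \<in> topspace X. f x \<in> G}"
      using compactin_proper_map_preimage[OF pf] G by auto
    then have "compactin X (RC_map X Y f G)"
      using G RC_map_upper[OF cf] regular_closed_closedin[OF RC_map_regular_closed[OF cf]]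
      by (auto intro: closed_compactin)
    then show ?thesis using G RC_map_regular_closed[OF cf] by simp
  qed
  show ?thesis
    using hom L1 L2 L3
    by (auto simp: DSkePer_hom_iff[OF RCL_local_contact_algebra[OF Y] RCL_local_contact_algebra[OF X]]
        DSke_hom_def)
qed

text \<open>
  If \<open>G\<close> is a regular closed neighbourhood of \<open>f x\<close>, then \<open>x \<in> RC_map X Y f G\<close>; if also
  \<open>RC_map X Y f G = RC_map X Y g G\<close>, then \<open>g x \<in> G\<close>.
\<close>

lemma RC_map_inj:
  assumes Y: "locally_compact_space Y" "Hausdorff_space Y"
  shows "inj_on (RC_map X Y) (SkePer_hom X Y)"
proof (rule inj_onI)
  fix f g assume f: "f \<in> SkePer_hom X Y" and g: "g \<in> SkePer_hom X Y"
    and eq: "RC_map X Y f = RC_map X Y g"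
  have c: "continuous_map X Y f" "continuous_map X Y g"
    and e: "f \<in> topspace X \<rightarrow>\<^sub>E topspace Y" "g \<in> topspace X \<rightarrow>\<^sub>E topspace Y"
    using f g by (auto simp: SkePer_hom_def)
  show "f = g"
  proof (rule PiE_ext[OF e])
    fix x assume x: "x \<in> topspace X"
    show "f x = g x"
    proof (rule ccontr)
      assume ne: "f x \<noteq> g x"
      have fx: "f x \<in> topspace Y" "g x \<in> topspace Y" using e x by auto
      have "openin Y (topspace Y - {g x})"
        using Y(2) fx by (simp add: closedin_Hausdorff_singleton openin_diff)
      then obtain G where G: "G \<in> regular_closed Y" "f x \<in> Y interior_of G" "G \<subseteq> topspace Y - {g x}"
        using regular_closed_nbhd_point[OF Y] ne fx by (metis Diff_iff singletonD)
      then have "x \<in> RC_map X Y f G" using RC_map_lower[OF G(1), of X f] x by blast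
      then have "g x \<in> G" using RC_map_upper[OF c(2) G(1)] eq by auto
      then show False using G by blast
    qed
  qed
qed

text \<open>
  The point \<open>f x\<close> is chosen such that \<open>f\<^sup>-\<^sup>1 (int G) \<subseteq> \<phi> G\<close> for all \<open>G\<close>.  As \<open>\<phi>\<close> reflects contact, also
  \<open>\<phi> G \<subseteq> f\<^sup>-\<^sup>1 G\<close>, and complementation sharpens the first inclusion to
  \<open>f\<^sup>-\<^sup>1 (int G) \<subseteq> int (\<phi> G)\<close>, whence continuity.  Since \<open>\<phi>\<close> preserves joins,
  \<open>\<phi> (cl V) \<subseteq> cl (f\<^sup>-\<^sup>1 V)\<close> for open \<open>V\<close>; this gives both \<open>\<phi> = RC_map X Y f\<close> and skeletality.  Finally
  \<open>f\<close> is proper because a compact set lies in the interior of some compact \<open>G\<close>, and its preimage in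
  the compact set \<open>\<phi> G\<close>.
\<close>

lemma RC_map_surj:
  assumes X: "locally_compact_space X" "Hausdorff_space X"
    and Y: "locally_compact_space Y" "Hausdorff_space Y" and \<phi>: "\<phi> \<in> DSkePer_hom (RCL Y) (RCL X)"
  shows "\<exists>f\<in>SkePer_hom X Y. RC_map X Y f = \<phi>"
proof -
  let ?p = "\<lambda>f V. {x \<in> topspace X. f x \<in> V}"
  have hom: "complete_boolean_hom (RCL Y) (RCL X) \<phi>"
    and L1: "\<And>a b. \<lbrakk>a \<in> regular_closed Y; b \<in> regular_closed Y; \<phi> a \<inter> \<phi> b \<noteq> {}\<rbrakk> \<Longrightarrow> a \<inter> b \<noteq> {}"
    and L2: "\<And>F. \<lbrakk>F \<in> regular_closed X; compactin X F\<rbrakk>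
      \<Longrightarrow> \<exists>K\<in>regular_closed Y. compactin Y K \<and> F \<subseteq> \<phi> K"
    and L3: "\<And>G. \<lbrakk>G \<in> regular_closed Y; compactin Y G\<rbrakk> \<Longrightarrow> compactin X (\<phi> G)"
    using \<phi> unfolding DSkePer_hom_iff[OF RCL_local_contact_algebra[OF Y] RCL_local_contact_algebra[OF X]]
    by (auto simp: DSke_hom_def)
  have rc: "\<phi> G \<in> regular_closed X" if "G \<in> regular_closed Y" for G
    using complete_boolean_homD(4)[OF hom] that by simp
  have mono: "\<phi> G \<subseteq> \<phi> H" if "G \<in> regular_closed Y" "H \<in> regular_closed Y" "G \<subseteq> H" for G H
    using complete_boolean_hom_mono[OF hom] that by simp
  have un: "\<phi> (G \<union> H) = \<phi> G \<union> \<phi> H" if "G \<in> regular_closed Y" "H \<in> regular_closed Y" for G H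
    using complete_boolean_hom_join[OF hom, of G H] that rc by (simp add: RCL_join)
  have emp: "\<phi> {} = {}" using complete_boolean_hom_bot[OF hom] by (simp add: RCL_bot)
  have ng: "\<phi> (topspace Y - Y interior_of G) = topspace X - X interior_of (\<phi> G)"
    if "G \<in> regular_closed Y" for G
    using complete_boolean_hom_neg[OF hom RCL_boolean_lattice RCL_boolean_lattice, of G] that rc
    by (simp add: RCL_neg)
  have sup: "\<phi> (Y closure_of (\<Union>G\<in>S. Y interior_of G)) = X closure_of (\<Union>G\<in>S. X interior_of (\<phi> G))"
    if "S \<subseteq> regular_closed Y" for S
  proof -
    have "\<phi> ` S \<subseteq> regular_closed X" using that rc by blast
    then show ?thesis using complete_boolean_homD(5)[OF hom, of S] that by (simp add: RCL_sup)
  qed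
  have ex: "\<exists>y\<in>topspace Y. \<forall>G\<in>regular_closed Y. y \<in> Y interior_of G \<longrightarrow> x \<in> \<phi> G"
    if x: "x \<in> topspace X" for x
  proof -
    obtain F where F: "F \<in> regular_closed X" "compactin X F" "x \<in> X interior_of F"
      using regular_closed_nbhd_point[OF X openin_topspace x] by blast
    obtain K where K: "K \<in> regular_closed Y" "compactin Y K" "F \<subseteq> \<phi> K" using L2 F by blast
    have xK: "x \<in> \<phi> K" using F K interior_of_subset[of X F] by blast
    show ?thesis
    proof (rule ccontr)
      assume "\<not> ?thesis"
      then have "\<forall>y\<in>K. \<exists>G\<in>regular_closed Y. y \<in> Y interior_of G \<and> x \<notin> \<phi> G"
        using regular_closed_subset[OF K(1)] by blast
      then obtain g where g: "\<And>y. y \<in> K \<Longrightarrow> g y \<in> regular_closed Y"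
        "\<And>y. y \<in> K \<Longrightarrow> y \<in> Y interior_of (g y)" "\<And>y. y \<in> K \<Longrightarrow> x \<notin> \<phi> (g y)"
        by metis
      have "\<exists>\<F>. finite \<F> \<and> \<F> \<subseteq> (\<lambda>y. Y interior_of (g y)) ` K \<and> K \<subseteq> \<Union>\<F>"
        using K(2) g(2) unfolding compactin_def by (elim conjE allE[of _ "(\<lambda>y. Y interior_of (g y)) ` K"]) auto
      then obtain T where T: "finite T" "T \<subseteq> K" "K \<subseteq> (\<Union>y\<in>T. Y interior_of (g y))"
        by (metis finite_subset_image)
      have *: "(\<Union>y\<in>T. g y) \<in> regular_closed Y \<and> x \<notin> \<phi> (\<Union>y\<in>T. g y)"
        using T(1,2)
      proof (induction T)
        case empty then show ?case by (simp add: regular_closed_empty emp)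
      next
        case (insert y T)
        then show ?case using g by (simp add: regular_closed_Un un)
      qed
      have "K \<subseteq> (\<Union>y\<in>T. g y)" using T(3) interior_of_subset[of Y] by fastforce
      then show False using mono[OF K(1)] * xK by blast
    qed
  qed
  define f where "f = (\<lambda>x\<in>topspace X. SOME y. y \<in> topspace Y \<and>
    (\<forall>G\<in>regular_closed Y. y \<in> Y interior_of G \<longrightarrow> x \<in> \<phi> G))"
  have fs: "f x \<in> topspace Y \<and> (\<forall>G\<in>regular_closed Y. f x \<in> Y interior_of G \<longrightarrow> x \<in> \<phi> G)"
    if "x \<in> topspace X" for x
    using someI_ex[OF ex[OF that, unfolded Bex_def]] that by (simp add: f_def)
  have lower: "?p f (Y interior_of G) \<subseteq> \<phi> G" if "G \<in> regular_closed Y" for G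
    using fs that by blast
  have upper: "f x \<in> G" if G: "G \<in> regular_closed Y" and x: "x \<in> \<phi> G" for x G
  proof (rule ccontr)
    assume n: "f x \<notin> G"
    have xX: "x \<in> topspace X" using rc[OF G] x regular_closed_subset by blast
    obtain H where H: "H \<in> regular_closed Y" "f x \<in> Y interior_of H" "H \<subseteq> topspace Y - G"
      using regular_closed_nbhd_point[OF Y, of "topspace Y - G" "f x"] fs[OF xX] n
        regular_closed_closedin[OF G] by (metis Diff_iff openin_closedin_eq openin_diff openin_topspace)
    then have "x \<in> \<phi> H" using fs xX by blast
    then show False using L1[OF G H(1)] x H by blast
  qed
  have inner: "?p f (Y interior_of G) \<subseteq> X interior_of (\<phi> G)" if G: "G \<in> regular_closed Y" for G
    using upper[OF regular_closed_compl[OF G]] ng[OF G] by blast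
  have fPiE: "f \<in> topspace X \<rightarrow>\<^sub>E topspace Y" using fs by (auto simp: f_def)
  have cont: "continuous_map X Y f"
    unfolding continuous_map_def
  proof (intro conjI allI impI)
    show "f \<in> topspace X \<rightarrow> topspace Y" using fs by blast
    fix V assume V: "openin Y V"
    show "openin X (?p f V)"
    proof (subst openin_subopen, intro ballI)
      fix x assume x: "x \<in> ?p f V"
      obtain G where G: "G \<in> regular_closed Y" "f x \<in> Y interior_of G" "G \<subseteq> V"
        using regular_closed_nbhd_point[OF Y V] x by blast
      have "X interior_of (\<phi> G) \<subseteq> ?p f V"
        using upper[OF G(1)] G(3) interior_of_subset[of X "\<phi> G"] interior_of_subset_topspace[of X "\<phi> G"]
        by blast
      then show "\<exists>T. openin X T \<and> x \<in> T \<and> T \<subseteq> ?p f V"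
        using inner[OF G(1)] G x by (intro exI[of _ "X interior_of (\<phi> G)"]) auto
    qed
  qed
  \<comment> \<open>The closure of an open set \<open>V\<close> is the join of the regular closed sets inside \<open>V\<close>.\<close>
  have clV: "\<phi> (Y closure_of V) \<subseteq> X closure_of (?p f V)" if V: "openin Y V" for V
  proof -
    define S where "S = {G \<in> regular_closed Y. G \<subseteq> V}"
    have S: "S \<subseteq> regular_closed Y" by (auto simp: S_def)
    have "V \<subseteq> (\<Union>G\<in>S. Y interior_of G)"
    proof
      fix y assume "y \<in> V"
      then obtain G where "G \<in> regular_closed Y" "y \<in> Y interior_of G" "G \<subseteq> V"
        using regular_closed_nbhd_point[OF Y V] by blast
      then show "y \<in> (\<Union>G\<in>S. Y interior_of G)" by (auto simp: S_def)
    qed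
    moreover have "(\<Union>G\<in>S. Y interior_of G) \<subseteq> V"
      using interior_of_subset[of Y] by (fastforce simp: S_def)
    ultimately have "V = (\<Union>G\<in>S. Y interior_of G)" by blast
    then have "\<phi> (Y closure_of V) = X closure_of (\<Union>G\<in>S. X interior_of (\<phi> G))"
      using sup[OF S] by simp
    also have "\<dots> \<subseteq> X closure_of (?p f V)"
    proof (intro closure_of_mono UN_least)
      fix G assume "G \<in> S"
      then show "X interior_of (\<phi> G) \<subseteq> ?p f V"
        using upper[of G] interior_of_subset[of X "\<phi> G"] interior_of_subset_topspace[of X "\<phi> G"]
        unfolding S_def by blast
    qed
    finally show ?thesis .
  qed
  have eq: "RC_map X Y f G = \<phi> G" if G: "G \<in> regular_closed Y" for G
  proof
    show "RC_map X Y f G \<subseteq> \<phi> G"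
      unfolding RC_map_apply[OF G] using lower[OF G] regular_closed_closedin[OF rc[OF G]]
      by (rule closure_of_minimal)
    show "\<phi> G \<subseteq> RC_map X Y f G"
      using clV[of "Y interior_of G"] G by (simp add: RC_map_apply closure_of_interior_regular_closed)
  qed
  have RC_eq: "RC_map X Y f = \<phi>"
    using eq RC_map_extensional[of X Y f] complete_boolean_homD(3)[OF hom]
    by (auto intro!: extensionalityI[of _ "regular_closed Y"] simp: PiE_def)
  have skel: "skeletal_map X Y f"
    unfolding skeletal_map_def
  proof (intro conjI allI impI)
    show "f \<in> topspace X \<rightarrow> topspace Y" using fs by blast
    fix V assume V: "openin Y V"
    define G where "G = Y closure_of V"
    have G: "G \<in> regular_closed Y" unfolding G_def by (rule closure_of_open_regular_closed[OF V])
    \<comment> \<open>Applied to the complement of \<open>G\<close>, the inclusion for open sets bounds \<open>int (f\<^sup>-\<^sup>1 G)\<close> by \<open>int (\<phi> G)\<close>.\<close>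
    have "X closure_of (?p f (topspace Y - G)) \<supseteq> topspace X - X interior_of (\<phi> G)"
      using clV[of "topspace Y - G"] ng[OF G] G regular_closed_closedin[OF G]
      by (simp add: closure_of_complement openin_diff)
    moreover have "?p f (topspace Y - G) = topspace X - ?p f G" using fs by blast
    ultimately have "X interior_of (?p f G) \<subseteq> X interior_of (\<phi> G)"
      using interior_of_subset_topspace[of X "?p f G"] by (auto simp: closure_of_complement)
    also have "\<dots> \<subseteq> \<phi> G" by (rule interior_of_subset)
    also have "\<dots> \<subseteq> X closure_of (?p f V)" unfolding G_def by (rule clV[OF V])
    finally show "X interior_of (?p f (Y closure_of V)) \<subseteq> X closure_of (?p f V)"
      by (simp add: G_def)
  qed
  have propr: "proper_map X Y f"
  proof (rule compact_imp_proper_map)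
    fix K assume K: "compactin Y K"
    obtain G where G: "G \<in> regular_closed Y" "compactin Y G" "K \<subseteq> Y interior_of G" "G \<subseteq> topspace Y"
      using regular_closed_nbhd[OF Y K openin_topspace compactin_subset_topspace[OF K]] .
    have "closedin X (?p f K)"
      using closedin_continuous_map_preimage[OF cont] compactin_imp_closedin[OF Y(2) K] by blast
    moreover have "?p f K \<subseteq> \<phi> G" using lower[OF G(1)] G(3) by blast
    ultimately show "compactin X (?p f K)" using closed_compactin L3[OF G(1,2)] by blast
  qed (use Y fs cont in \<open>auto simp: locally_compact_imp_k_space Hausdorff_imp_kc_space\<close>)
  show ?thesis
    using RC_eq fPiE skel cont propr by (auto simp: SkePer_hom_def)
qed

lemma RC_map_bij_betw:
  assumes "LCCon_space X" "LCCon_space Y"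
  shows "bij_betw (RC_map X Y) (SkePer_hom X Y) (DSkePer_hom (RCL Y) (RCL X))"
  unfolding bij_betw_def
  using assms RC_map_inj[of Y X] RC_map_in_DSkePer_hom[of X Y] RC_map_surj[of X Y]
  unfolding LCCon_space_def by blast

lemma RC_map_ident: "RC_map X X (\<lambda>x\<in>topspace X. x) = (\<lambda>F\<in>carrier (RCL X). F)"
proof
  fix F
  have "{x \<in> topspace X. (\<lambda>x\<in>topspace X. x) x \<in> X interior_of F} = X interior_of F"
    using interior_of_subset_topspace[of X F] by auto
  then show "RC_map X X (\<lambda>x\<in>topspace X. x) F = (\<lambda>F\<in>carrier (RCL X). F) F"
    by (simp add: RC_map_def closure_of_interior_regular_closed cong: restrict_cong)
qed

text \<open>
  With \<open>W = g\<^sup>-\<^sup>1 (int G)\<close>, the two sides are the closures of \<open>f\<^sup>-\<^sup>1 W\<close> and \<open>f\<^sup>-\<^sup>1 (int (cl W))\<close>.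
\<close>

lemma RC_map_compose:
  assumes f: "skeletal_map X Y f" "continuous_map X Y f" and g: "continuous_map Y Z g"
  shows "RC_map X Z (compose (topspace X) g f) =
    compose (carrier (RCL Z)) (RC_map X Y f) (RC_map Y Z g)"
proof (rule extensionalityI[of _ "regular_closed Z"])
  fix G assume G: "G \<in> regular_closed Z"
  have fXY: "f x \<in> topspace Y" if "x \<in> topspace X" for x
    using f(2) that by (metis continuous_map_def Pi_iff)
  let ?W = "{y \<in> topspace Y. g y \<in> Z interior_of G}"
  have W: "openin Y ?W" using g by (simp add: openin_continuous_map_preimage)
  have "{x \<in> topspace X. compose (topspace X) g f x \<in> Z interior_of G} = {x \<in> topspace X. f x \<in> ?W}"
    using fXY by (auto simp: compose_def)
  then have l: "RC_map X Z (compose (topspace X) g f) G = X closure_of {x \<in> topspace X. f x \<in> ?W}"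
    using G by (simp add: RC_map_apply)
  have r: "compose (carrier (RCL Z)) (RC_map X Y f) (RC_map Y Z g) G =
      X closure_of {x \<in> topspace X. f x \<in> Y interior_of (Y closure_of ?W)}"
    using G RC_map_regular_closed[OF g G] by (simp add: compose_def RC_map_apply)
  have "?W \<subseteq> Y interior_of (Y closure_of ?W)"
    using W by (simp add: closure_of_subset interior_of_maximal openin_subset)
  then have "X closure_of {x \<in> topspace X. f x \<in> ?W}
      \<subseteq> X closure_of {x \<in> topspace X. f x \<in> Y interior_of (Y closure_of ?W)}"
    by (intro closure_of_mono) blast
  moreover have "X closure_of {x \<in> topspace X. f x \<in> Y interior_of (Y closure_of ?W)}
      \<subseteq> X closure_of {x \<in> topspace X. f x \<in> ?W}"
    using skeletal_preimage_interior_closure[OF f W] by (simp add: closure_of_minimal)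
  ultimately show "RC_map X Z (compose (topspace X) g f) G =
    compose (carrier (RCL Z)) (RC_map X Y f) (RC_map Y Z g) G"
    unfolding l r by blast
qed (auto simp: RC_map_def)


section \<open>The space of bounded clusters of a local contact algebra\<close>

context local_contact_algebra
begin

definition cluster :: "'a set \<Rightarrow> 'a set" where
  "cluster u = {a \<in> carrier B. \<forall>b\<in>u. contact B a b}"

text \<open>
  Only ultrafilters with a bounded member count: the others would converge to the point at infinity
  of the one-point compactification.
\<close>

definition points :: "'a set set" where
  "points = {cluster u |u. ultrafilter u \<and> u \<inter> bdd B \<noteq> {}}"

definition star :: "'a \<Rightarrow> 'a set set" where
  "star a = {\<sigma> \<in> points. a \<in> \<sigma>}"

text \<open>
  The sets \<open>star a\<close> form a base of the closed sets, since \<open>star (a \<squnion> b) = star a \<union> star b\<close>; the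
  complements of the sets \<open>star a\<close> are therefore a base of the topology.
\<close>

definition cluster_space :: "'a set topology" where
  "cluster_space =
     topology (\<lambda>U. U \<subseteq> points \<and> (\<forall>\<sigma>\<in>U. \<exists>a\<in>carrier B. a \<notin> \<sigma> \<and> points - star a \<subseteq> U))"

lemma bdd_carrier: "a \<in> bdd B \<Longrightarrow> a \<in> carrier B"
  using bdd_sub by blast

lemma ultrafilterD:
  assumes "ultrafilter u"
  shows "a \<in> u \<Longrightarrow> a \<in> carrier B" "\<bottom> \<notin> u" "\<lbrakk>a \<in> u; b \<in> u\<rbrakk> \<Longrightarrow> a \<sqinter> b \<in> u"
    "\<lbrakk>a \<in> u; b \<in> carrier B; a \<sqsubseteq> b\<rbrakk> \<Longrightarrow> b \<in> u" "a \<in> carrier B \<Longrightarrow> a \<in> u \<or> neg a \<in> u"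
  using assms unfolding ultrafilter_def by auto

lemma ultrafilter_subset_cluster:
  assumes "ultrafilter u" shows "u \<subseteq> cluster u"
proof
  fix a assume a: "a \<in> u"
  have "contact B a b" if b: "b \<in> u" for b
  proof (rule contact_meet)
    have "a \<sqinter> b \<in> u" using a b by (rule ultrafilterD(3)[OF assms])
    then show "a \<sqinter> b \<noteq> \<bottom>" using ultrafilterD(2)[OF assms] by metis
  qed (use a b ultrafilterD(1)[OF assms] in auto)
  then show "a \<in> cluster u" using a ultrafilterD(1)[OF assms] by (simp add: cluster_def)
qed

lemma not_contact_join:
  assumes "a \<in> carrier B" "b \<in> carrier B" "c \<in> carrier B" "\<not> contact B a c" "\<not> contact B b c"
  shows "\<not> contact B (a \<squnion> b) c"
  using assms C3 C4[of c a b] by (meson join_closed)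

text \<open>
  If \<open>a\<close> and \<open>b\<close> were apart, interpolation would yield \<open>d\<close> with \<open>d\<close> apart from \<open>b\<close> and \<open>neg d\<close> apart
  from \<open>a\<close>, at least near a bounded member \<open>c\<close> of \<open>u\<close>; but \<open>u\<close> contains \<open>d\<close> or \<open>neg d\<close>.  Interpolation
  is available below bounded elements only, so \<open>a\<close> is first cut down to \<open>c' \<sqinter> a\<close> where \<open>c'\<close> is bounded
  and \<open>c\<close> is well inside \<open>c'\<close>; the rest \<open>a \<sqinter> neg c'\<close> of \<open>a\<close> is apart from \<open>c\<close>.
\<close>

lemma cluster_contact:
  assumes u: "ultrafilter u" and c: "c \<in> u" "c \<in> bdd B" and a: "a \<in> cluster u" and b: "b \<in> cluster u"
  shows "contact B a b"
proof (rule ccontr)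
  assume n: "\<not> contact B a b"
  have ac: "a \<in> carrier B" and bc: "b \<in> carrier B" and cc: "c \<in> carrier B"
    using a b c bdd_carrier by (auto simp: cluster_def)
  have "well_inside B c \<top>" unfolding well_inside_def using not_contact_bot cc by simp
  then obtain c' where c': "c' \<in> bdd B" "well_inside B c c'" using BC1[OF c(2)] by auto
  have cc': "c' \<in> carrier B" using c' bdd_carrier by blast
  have "c' \<sqinter> a \<in> bdd B" using bdd_down[OF c'(1)] cc' ac by (simp add: meet_left)
  moreover have "well_inside B (c' \<sqinter> a) (neg b)"
    unfolding well_inside_def using n contact_mono[of "c' \<sqinter> a" b a b] ac bc cc'
    by (auto simp: meet_right)
  ultimately obtain d where d: "d \<in> bdd B" "well_inside B (c' \<sqinter> a) d" "well_inside B d (neg b)"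
    using BC1 bc neg_closed by blast
  have dc: "d \<in> carrier B" using d bdd_carrier by blast
  from ultrafilterD(5)[OF u dc] show False
  proof
    assume "d \<in> u"
    then have "contact B b d" using b by (auto simp: cluster_def)
    then show False using C3[OF bc dc] d(3) bc by (simp add: well_inside_def)
  next
    assume "neg d \<in> u"
    then have eu: "c \<sqinter> neg d \<in> u" using c ultrafilterD(3)[OF u] by blast
    define e where "e = c \<sqinter> neg d"
    have ec: "e \<in> carrier B" "e \<sqsubseteq> c" "e \<sqsubseteq> neg d"
      unfolding e_def using cc dc by (auto simp: meet_left meet_right)
    have "\<not> contact B (a \<sqinter> c') e"
      using d(2) contact_mono[of "a \<sqinter> c'" e "a \<sqinter> c'" "neg d"] ec ac cc' dc
      by (auto simp: well_inside_def meet_comm[of B a c'])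
    moreover have "\<not> contact B (a \<sqinter> neg c') e"
    proof
      assume "contact B (a \<sqinter> neg c') e"
      then have "contact B (neg c') c"
        using contact_mono[of "a \<sqinter> neg c'" e "neg c'" c] ec ac cc' cc by (auto simp: meet_right)
      then show False using c'(2) C3[of "neg c'" c] cc cc' by (simp add: well_inside_def)
    qed
    ultimately have "\<not> contact B ((a \<sqinter> c') \<squnion> (a \<sqinter> neg c')) e"
      using not_contact_join ac cc' ec by simp
    then have "\<not> contact B a e" using meet_split[OF ac cc'] by simp
    then show False using a eu by (auto simp: cluster_def e_def)
  qed
qed

lemma pointE:
  assumes "\<sigma> \<in> points"
  obtains u c where "ultrafilter u" "c \<in> u" "c \<in> bdd B" "\<sigma> = cluster u"
  using assms unfolding points_def by blast

lemma point_carrier: "\<lbrakk>\<sigma> \<in> points; a \<in> \<sigma>\<rbrakk> \<Longrightarrow> a \<in> carrier B"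
  by (auto simp: points_def cluster_def)

lemma point_up: "\<lbrakk>\<sigma> \<in> points; a \<in> \<sigma>; b \<in> carrier B; a \<sqsubseteq> b\<rbrakk> \<Longrightarrow> b \<in> \<sigma>"
  by (elim pointE) (auto simp: cluster_def intro: contact_mono ultrafilterD(1))

lemma point_contact: "\<lbrakk>\<sigma> \<in> points; a \<in> \<sigma>; b \<in> \<sigma>\<rbrakk> \<Longrightarrow> contact B a b"
  by (elim pointE) (auto intro: cluster_contact)

lemma point_join:
  assumes "\<sigma> \<in> points" "a \<in> carrier B" "b \<in> carrier B" "a \<squnion> b \<in> \<sigma>"
  shows "a \<in> \<sigma> \<or> b \<in> \<sigma>"
proof (rule ccontr)
  assume n: "\<not> ?thesis"
  obtain u where u: "ultrafilter u" "\<sigma> = cluster u" using pointE[OF assms(1)] by metis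
  obtain c d where cd: "c \<in> u" "d \<in> u" "\<not> contact B a c" "\<not> contact B b d"
    using n u(2) assms(2,3) by (auto simp: cluster_def)
  have cc: "c \<in> carrier B" "d \<in> carrier B" and m: "c \<sqinter> d \<in> u"
    using cd ultrafilterD(1,3)[OF u(1)] by blast+
  have "\<not> contact B a (c \<sqinter> d)" "\<not> contact B b (c \<sqinter> d)"
    using cd cc assms(2,3) contact_mono[of a "c \<sqinter> d" a c] contact_mono[of b "c \<sqinter> d" b d]
    by (auto simp: meet_left meet_right)
  then have "\<not> contact B (a \<squnion> b) (c \<sqinter> d)" using not_contact_join assms(2,3) cc by simp
  then show False using assms(4) u(2) m by (auto simp: cluster_def)
qed

lemma point_bot: "\<sigma> \<in> points \<Longrightarrow> \<bottom> \<notin> \<sigma>"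
  using point_contact not_contact_bot bottom_closed by blast

lemma point_top:
  assumes s: "\<sigma> \<in> points" shows "\<top> \<in> \<sigma>"
proof -
  obtain u c where u: "ultrafilter u" "c \<in> u" "\<sigma> = cluster u" using pointE[OF s] by metis
  then have c: "c \<in> \<sigma>" using ultrafilter_subset_cluster by blast
  show ?thesis by (rule point_up[OF s c top_closed top_higher[OF point_carrier[OF s c]]])
qed

lemma point_neg: "\<lbrakk>\<sigma> \<in> points; a \<in> carrier B\<rbrakk> \<Longrightarrow> a \<in> \<sigma> \<or> neg a \<in> \<sigma>"
  using point_join[of \<sigma> a "neg a"] point_top by simp

text \<open>
  The witness in the ultrafilter can be met with a bounded member.
\<close>

lemma point_apart:
  assumes "\<sigma> \<in> points" "a \<in> carrier B" "a \<notin> \<sigma>"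
  obtains b where "b \<in> bdd B" "b \<in> \<sigma>" "\<not> contact B b a"
proof -
  obtain u c where u: "ultrafilter u" "c \<in> u" "c \<in> bdd B" "\<sigma> = cluster u" using pointE[OF assms(1)] by metis
  obtain d where d: "d \<in> u" "\<not> contact B a d" using assms u(4) by (auto simp: cluster_def)
  have cc: "c \<in> carrier B" "d \<in> carrier B" and m: "c \<sqinter> d \<in> u"
    using u(2) d(1) ultrafilterD(1,3)[OF u(1)] by blast+
  have "\<not> contact B (c \<sqinter> d) a"
    using d(2) contact_mono[of "c \<sqinter> d" a d a] C3[of d a] cc assms(2) by (auto simp: meet_right)
  moreover have "c \<sqinter> d \<in> bdd B" using bdd_down[OF u(3)] cc by (simp add: meet_left)
  moreover have "c \<sqinter> d \<in> \<sigma>" using m u ultrafilter_subset_cluster by blast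
  ultimately show thesis using that by blast
qed

text \<open>
  As \<open>interior_star\<close> shows, this says that every point is interior to \<open>star c\<close> for a bounded \<open>c\<close>.
\<close>

lemma point_bounded_interior:
  assumes "\<sigma> \<in> points"
  obtains c where "c \<in> bdd B" "neg c \<notin> \<sigma>"
proof -
  obtain u c where u: "ultrafilter u" "c \<in> u" "c \<in> bdd B" "\<sigma> = cluster u" using pointE[OF assms(1)] by metis
  have cc: "c \<in> carrier B" using u bdd_carrier by blast
  have "well_inside B c \<top>" unfolding well_inside_def using not_contact_bot cc by simp
  then obtain c' where c': "c' \<in> bdd B" "well_inside B c c'" using BC1[OF u(3)] by auto
  have "neg c' \<notin> \<sigma>"
    using c' u(2,4) cc C3[of "neg c'" c] bdd_carrier by (auto simp: cluster_def well_inside_def)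
  then show thesis using that c' by blast
qed

lemma ideal_not_contact: "a \<in> carrier B \<Longrightarrow> ideal {d \<in> carrier B. \<not> contact B a d}"
  unfolding ideal_def by (auto simp: C4 not_contact_bot dest: contact_mono_right[rotated 3])

text \<open>
  The elements apart from \<open>a\<close> form an ideal.  A bounded part of \<open>b\<close> still touches \<open>a\<close>, so it lies in an
  ultrafilter that avoids this ideal, and the cluster of that ultrafilter contains \<open>a\<close>.
\<close>

lemma contact_point:
  assumes "a \<in> carrier B" "b \<in> carrier B" "contact B a b"
  obtains \<sigma> where "\<sigma> \<in> points" "a \<in> \<sigma>" "b \<in> \<sigma>"
proof -
  obtain c where c: "c \<in> bdd B" "contact B a (c \<sqinter> b)" using BC2[OF assms] by blast
  have cc: "c \<in> carrier B" using c bdd_carrier by blast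
  have cb: "c \<sqinter> b \<in> bdd B" "c \<sqinter> b \<in> carrier B" using bdd_down[OF c(1)] cc assms by (auto simp: meet_left)
  have "c \<sqinter> b \<notin> {d \<in> carrier B. \<not> contact B a d}" using c(2) by simp
  then obtain u where u: "ultrafilter u" "c \<sqinter> b \<in> u" "u \<inter> {d \<in> carrier B. \<not> contact B a d} = {}"
    by (rule ultrafilter_avoiding_ideal[OF ideal_not_contact[OF assms(1)] cb(2)])
  have "b \<in> u" using ultrafilterD(4)[OF u(1,2)] assms cc by (simp add: meet_right)
  then have "b \<in> cluster u" using ultrafilter_subset_cluster u by blast
  moreover have "a \<in> cluster u" using u ultrafilterD(1)[OF u(1)] assms by (auto simp: cluster_def)
  moreover have "cluster u \<in> points" unfolding points_def using u cb by blast
  ultimately show thesis using that by blast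
qed

lemma star_subset_points: "star a \<subseteq> points"
  by (auto simp: star_def)

lemma star_join: "\<lbrakk>a \<in> carrier B; b \<in> carrier B\<rbrakk> \<Longrightarrow> star (a \<squnion> b) = star a \<union> star b"
  unfolding star_def
  by (auto dest: point_join intro: point_up[OF _ _ join_closed join_left] point_up[OF _ _ join_closed join_right])

lemma star_bot: "star \<bottom> = {}" and star_top: "star \<top> = points"
  using point_bot point_top by (auto simp: star_def)

lemma star_neg: "a \<in> carrier B \<Longrightarrow> points - star (neg a) \<subseteq> star a"
  using point_neg by (auto simp: star_def)

lemma star_contact_iff:
  assumes "a \<in> carrier B" "b \<in> carrier B"
  shows "star a \<inter> star b \<noteq> {} \<longleftrightarrow> contact B a b"
proof
  assume "star a \<inter> star b \<noteq> {}"
  then obtain \<sigma> where "\<sigma> \<in> points" "a \<in> \<sigma>" "b \<in> \<sigma>" by (auto simp: star_def)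
  then show "contact B a b" by (rule point_contact)
next
  assume "contact B a b"
  then obtain \<sigma> where "\<sigma> \<in> points" "a \<in> \<sigma>" "b \<in> \<sigma>" using contact_point[OF assms] by metis
  then show "star a \<inter> star b \<noteq> {}" by (auto simp: star_def)
qed

text \<open>
  If \<open>a\<close> is not below \<open>b\<close>, then some nonzero \<open>d\<close> is well inside \<open>a \<sqinter> neg b\<close>; a point containing \<open>d\<close>
  contains \<open>a\<close> but not \<open>b\<close>.
\<close>

lemma star_subset_iff:
  assumes a: "a \<in> carrier B" and b: "b \<in> carrier B"
  shows "star a \<subseteq> star b \<longleftrightarrow> a \<sqsubseteq> b"
proof
  assume "a \<sqsubseteq> b" then show "star a \<subseteq> star b" using b point_up by (auto simp: star_def)
next
  assume sub: "star a \<subseteq> star b"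
  show "a \<sqsubseteq> b"
  proof (rule ccontr)
    assume "\<not> a \<sqsubseteq> b"
    then have "a \<sqinter> neg b \<noteq> \<bottom>" using le_iff_meet_neg a b by blast
    then obtain d where d: "d \<in> bdd B" "d \<noteq> \<bottom>" "well_inside B d (a \<sqinter> neg b)"
      using BC3[of "a \<sqinter> neg b"] a b by auto
    have dc: "d \<in> carrier B" using d bdd_carrier by blast
    have "d \<sqsubseteq> a \<sqinter> neg b" using well_inside_le[OF dc _ d(3)] a b by simp
    then have da: "d \<sqsubseteq> a" using a b dc by (simp add: le_meet_iff)
    have "a \<sqinter> neg b \<sqsubseteq> neg b" using a b by (simp add: meet_right)
    then have "b \<sqsubseteq> neg (a \<sqinter> neg b)" using neg_antimono[of "a \<sqinter> neg b" "neg b"] a b by simp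
    then have "\<not> contact B d b"
      using d(3) contact_mono_right[of d b "neg (a \<sqinter> neg b)"] a b dc by (auto simp: well_inside_def)
    moreover obtain \<sigma> where "\<sigma> \<in> points" "d \<in> \<sigma>"
      using contact_point[OF dc dc C1[OF dc d(2)]] by metis
    moreover from this have "a \<in> \<sigma>" using point_up a da by metis
    ultimately show False using sub point_contact by (auto simp: star_def)
  qed
qed

lemma star_inj: "\<lbrakk>a \<in> carrier B; b \<in> carrier B; star a = star b\<rbrakk> \<Longrightarrow> a = b"
  using star_subset_iff[of a b] star_subset_iff[of b a] le_antisym[of a b] by simp

lemma star_cover_iff:
  "\<lbrakk>a \<in> carrier B; b \<in> carrier B\<rbrakk> \<Longrightarrow> points - star a \<subseteq> star b \<longleftrightarrow> a \<squnion> b = \<top>"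
  using star_subset_iff[of \<top> "a \<squnion> b"] star_subset_points
  by (auto simp: star_join star_top top_le)

lemma openin_cluster_space:
  "openin cluster_space U \<longleftrightarrow>
    U \<subseteq> points \<and> (\<forall>\<sigma>\<in>U. \<exists>a\<in>carrier B. a \<notin> \<sigma> \<and> points - star a \<subseteq> U)"
proof -
  have "istopology (\<lambda>U. U \<subseteq> points \<and> (\<forall>\<sigma>\<in>U. \<exists>a\<in>carrier B. a \<notin> \<sigma> \<and> points - star a \<subseteq> U))"
    (is "istopology ?P")
    unfolding istopology_def
  proof (rule conjI; intro allI impI)
    fix U V
    assume "?P U" "?P V"
    then have UV: "U \<subseteq> points" "V \<subseteq> points"
      "\<forall>\<sigma>\<in>U. \<exists>a\<in>carrier B. a \<notin> \<sigma> \<and> points - star a \<subseteq> U"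
      "\<forall>\<sigma>\<in>V. \<exists>a\<in>carrier B. a \<notin> \<sigma> \<and> points - star a \<subseteq> V"
      by auto
    have "\<forall>\<sigma>\<in>U \<inter> V. \<exists>a\<in>carrier B. a \<notin> \<sigma> \<and> points - star a \<subseteq> U \<inter> V"
    proof
      fix \<sigma> assume s: "\<sigma> \<in> U \<inter> V"
      obtain a where a: "a \<in> carrier B" "a \<notin> \<sigma>" "points - star a \<subseteq> U"
        using bspec[OF UV(3), of \<sigma>] s by auto
      obtain b where b: "b \<in> carrier B" "b \<notin> \<sigma>" "points - star b \<subseteq> V"
        using bspec[OF UV(4), of \<sigma>] s by auto
      note ab = a b
      have "\<sigma> \<in> points" using s UV(1) by auto
      then have "a \<squnion> b \<notin> \<sigma>" using point_join[of \<sigma> a b] ab by auto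
      moreover have "points - star (a \<squnion> b) \<subseteq> U \<inter> V" using ab by (auto simp: star_join)
      ultimately show "\<exists>a\<in>carrier B. a \<notin> \<sigma> \<and> points - star a \<subseteq> U \<inter> V"
        using ab by (intro bexI[of _ "a \<squnion> b"]) auto
    qed
    then show "?P (U \<inter> V)" using UV(1) by auto
  next
    fix \<K> assume K: "\<forall>U\<in>\<K>. ?P U"
    show "?P (\<Union>\<K>)"
    proof (intro conjI ballI)
      fix \<sigma> assume "\<sigma> \<in> \<Union>\<K>"
      then obtain U where U: "U \<in> \<K>" "\<sigma> \<in> U" by blast
      then obtain a where "a \<in> carrier B" "a \<notin> \<sigma>" "points - star a \<subseteq> U" using K by blast
      then show "\<exists>a\<in>carrier B. a \<notin> \<sigma> \<and> points - star a \<subseteq> \<Union>\<K>" using U by blast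
    qed (use K in blast)
  qed
  then show ?thesis by (simp add: cluster_space_def topology_inverse')
qed

lemma openin_compl_star: "a \<in> carrier B \<Longrightarrow> openin cluster_space (points - star a)"
  unfolding openin_cluster_space by (auto simp: star_def)

lemma topspace_cluster_space [simp]: "topspace cluster_space = points"
proof
  show "topspace cluster_space \<subseteq> points"
    using openin_topspace[of cluster_space] unfolding openin_cluster_space by blast
  show "points \<subseteq> topspace cluster_space"
    using openin_subset[OF openin_compl_star[OF bottom_closed]] by (simp add: star_bot)
qed

lemma closedin_star: "a \<in> carrier B \<Longrightarrow> closedin cluster_space (star a)"
  using openin_compl_star star_subset_points by (simp add: closedin_def)

lemma open_nhdE:
  assumes "openin cluster_space U" "\<sigma> \<in> U"
  obtains a where "a \<in> carrier B" "a \<notin> \<sigma>" "points - star a \<subseteq> U"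
  using assms unfolding openin_cluster_space by blast

lemma interior_star:
  assumes a: "a \<in> carrier B"
  shows "cluster_space interior_of star a = points - star (neg a)"
proof (rule interior_of_unique)
  show "points - star (neg a) \<subseteq> star a" by (rule star_neg[OF a])
  show "openin cluster_space (points - star (neg a))" using a by (simp add: openin_compl_star)
  fix T assume T: "T \<subseteq> star a" "openin cluster_space T"
  show "T \<subseteq> points - star (neg a)"
  proof
    fix \<sigma> assume s: "\<sigma> \<in> T"
    then have sp: "\<sigma> \<in> points" using T star_subset_points by blast
    obtain b where b: "b \<in> carrier B" "b \<notin> \<sigma>" "points - star b \<subseteq> T" using open_nhdE[OF T(2) s] .
    then have "a \<squnion> b = \<top>" using star_cover_iff[of b a] a T(1) by (auto simp: join_comm[of B a b])
    then have "neg a \<sqsubseteq> b" using neg_le_iff[of a b] a b by simp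
    then have "neg a \<notin> \<sigma>" using point_up[OF sp _ b(1)] b(2) by auto
    then show "\<sigma> \<in> points - star (neg a)" using sp by (auto simp: star_def)
  qed
qed

lemma closure_interior_star:
  assumes a: "a \<in> carrier B"
  shows "cluster_space closure_of (points - star (neg a)) = star a"
proof
  show "cluster_space closure_of (points - star (neg a)) \<subseteq> star a"
    by (rule closure_of_minimal[OF star_neg[OF a] closedin_star[OF a]])
  show "star a \<subseteq> cluster_space closure_of (points - star (neg a))"
  proof
    fix \<sigma> assume s: "\<sigma> \<in> star a"
    then have sp: "\<sigma> \<in> points" "a \<in> \<sigma>" by (auto simp: star_def)
    have "\<exists>\<tau>. \<tau> \<in> points - star (neg a) \<and> \<tau> \<in> T" if T: "\<sigma> \<in> T" "openin cluster_space T" for T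
    proof (rule ccontr)
      assume n: "\<not> ?thesis"
      obtain b where b: "b \<in> carrier B" "b \<notin> \<sigma>" "points - star b \<subseteq> T" using open_nhdE[OF T(2,1)] .
      then have "points - star (neg a) \<subseteq> star b" using n by blast
      then have "neg a \<squnion> b = \<top>" using star_cover_iff[of "neg a" b] a b by simp
      then have "a \<sqsubseteq> b" using neg_le_iff[of "neg a" b] a b by simp
      then show False using point_up[OF sp b(1)] b(2) by simp
    qed
    then show "\<sigma> \<in> cluster_space closure_of (points - star (neg a))"
      using sp by (auto simp: in_closure_of)
  qed
qed

lemma star_regular_closed: "a \<in> carrier B \<Longrightarrow> star a \<in> regular_closed cluster_space"
  by (simp add: regular_closed_iff interior_star closure_interior_star)

text \<open>
  The element is the join of all \<open>b\<close> with \<open>star b \<subseteq> F\<close>.  A closed set is an intersection of sets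
  \<open>star c\<close>, and \<open>F \<subseteq> star c\<close> forces every such \<open>b\<close> below \<open>c\<close>, so \<open>star a \<subseteq> F\<close>.  Conversely \<open>int F\<close> is a
  union of complements of sets \<open>star b\<close>, whose closures \<open>star (neg b)\<close> lie in \<open>F\<close>.
\<close>

lemma star_surj:
  assumes B: "complete_lattice B" and F: "F \<in> regular_closed cluster_space"
  shows "\<exists>a\<in>carrier B. star a = F"
proof -
  interpret complete_lattice B by fact
  define S where "S = {b \<in> carrier B. star b \<subseteq> F}"
  define a where "a = \<Squnion>S"
  have S: "S \<subseteq> carrier B" by (auto simp: S_def)
  then have a: "a \<in> carrier B" by (simp add: a_def)
  have Fc: "closedin cluster_space F" using F by (rule regular_closed_closedin)
  have "star a \<subseteq> F"
  proof
    fix \<sigma> assume s: "\<sigma> \<in> star a"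
    then have sp: "\<sigma> \<in> points" "a \<in> \<sigma>" by (auto simp: star_def)
    show "\<sigma> \<in> F"
    proof (rule ccontr)
      assume "\<sigma> \<notin> F"
      moreover have "openin cluster_space (points - F)" using Fc by (simp add: closedin_def)
      ultimately obtain c where c: "c \<in> carrier B" "c \<notin> \<sigma>" "points - star c \<subseteq> points - F"
        using open_nhdE[of "points - F" \<sigma>] sp by (metis DiffI)
      have "F \<subseteq> star c" using c(3) closedin_subset[OF Fc] by auto
      then have "b \<sqsubseteq> c" if "b \<in> S" for b
        using that star_subset_iff[of b c] c(1) by (auto simp: S_def)
      then have "a \<sqsubseteq> c" unfolding a_def using S c(1) by (intro sup_least) auto
      then show False using point_up[OF sp c(1)] c(2) by simp
    qed
  qed
  moreover have "cluster_space interior_of F \<subseteq> star a"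
  proof
    fix \<sigma> assume s: "\<sigma> \<in> cluster_space interior_of F"
    obtain b where b: "b \<in> carrier B" "b \<notin> \<sigma>" "points - star b \<subseteq> cluster_space interior_of F"
      using open_nhdE[OF openin_interior_of s] .
    have sp: "\<sigma> \<in> points" using s interior_of_subset_topspace[of cluster_space F] by auto
    have "points - star (neg (neg b)) \<subseteq> F" using b interior_of_subset[of cluster_space F] by auto
    then have "cluster_space closure_of (points - star (neg (neg b))) \<subseteq> F"
      by (rule closure_of_minimal[OF _ Fc])
    then have "star (neg b) \<subseteq> F"
      using closure_interior_star[OF neg_closed[OF b(1)]] by simp
    then have "neg b \<sqsubseteq> a" unfolding a_def using b(1) S by (intro sup_upper) (auto simp: S_def)
    moreover have "neg b \<in> \<sigma>" using point_neg[OF sp b(1)] b(2) by blast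
    ultimately show "\<sigma> \<in> star a" using point_up[OF sp _ a] sp by (auto simp: star_def)
  qed
  then have "F \<subseteq> star a"
    using regular_closed_subset_iff[OF F closedin_star[OF a]] by simp
  ultimately show ?thesis using a by blast
qed

text \<open>
  For an open cover, the elements \<open>d\<close> such that \<open>star d\<close> is covered by finitely many members form an
  ideal.  If \<open>a\<close> were not in it, an ultrafilter \<open>u\<close> containing \<open>a\<close> would avoid it; but the
  basic neighbourhood of the point \<open>cluster u\<close> inside a member \<open>V\<close> of the cover is the complement of
  some \<open>star b\<close>, and \<open>b\<close> is apart from some \<open>c \<in> u\<close>, so \<open>star c \<subseteq> V\<close> and \<open>c\<close> is in the ideal.
\<close>

lemma compactin_star:
  assumes a: "a \<in> bdd B"
  shows "compactin cluster_space (star a)"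
  unfolding compactin_def
proof (intro conjI allI impI)
  show "star a \<subseteq> topspace cluster_space" by (simp add: star_subset_points)
  fix \<U> assume U: "Ball \<U> (openin cluster_space) \<and> star a \<subseteq> \<Union>\<U>"
  have ac: "a \<in> carrier B" using a bdd_carrier by blast
  define I where "I = {d \<in> carrier B. \<exists>\<F>. finite \<F> \<and> \<F> \<subseteq> \<U> \<and> star d \<subseteq> \<Union>\<F>}"
  have join: "x \<squnion> y \<in> I" if xy: "x \<in> I" "y \<in> I" for x y
  proof -
    obtain \<F> \<G> where "finite \<F>" "\<F> \<subseteq> \<U>" "star x \<subseteq> \<Union>\<F>" "finite \<G>" "\<G> \<subseteq> \<U>" "star y \<subseteq> \<Union>\<G>"
      and "x \<in> carrier B" "y \<in> carrier B"
      using xy unfolding I_def by blast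
    then show ?thesis unfolding I_def
      by (auto simp: star_join intro!: exI[of _ "\<F> \<union> \<G>"])
  qed
  have down: "y \<in> I" if "x \<in> I" "y \<in> carrier B" "y \<sqsubseteq> x" for x y
  proof -
    have "star y \<subseteq> star x" using that star_subset_iff[of y x] by (simp add: I_def)
    then show ?thesis using that(1,2) unfolding I_def by blast
  qed
  have bot: "\<bottom> \<in> I" unfolding I_def using star_bot by (auto intro: exI[of _ "{}"])
  have I: "ideal I" unfolding ideal_def using join down bot by (auto simp: I_def)
  have "a \<in> I"
  proof (rule ccontr)
    assume "a \<notin> I"
    then obtain u where u: "ultrafilter u" "a \<in> u" "u \<inter> I = {}"
      by (rule ultrafilter_avoiding_ideal[OF I ac])
    have sp: "cluster u \<in> points" unfolding points_def using u a by blast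
    moreover have "a \<in> cluster u" using u ultrafilter_subset_cluster by blast
    ultimately have "cluster u \<in> star a" by (simp add: star_def)
    then obtain V where V: "V \<in> \<U>" "cluster u \<in> V" "openin cluster_space V" using U by blast
    obtain b where b: "b \<in> carrier B" "b \<notin> cluster u" "points - star b \<subseteq> V" using open_nhdE[OF V(3,2)] .
    then obtain c where c: "c \<in> u" "\<not> contact B b c" by (auto simp: cluster_def)
    have cc: "c \<in> carrier B" using c ultrafilterD(1)[OF u(1)] by blast
    have "star b \<inter> star c = {}" using star_contact_iff[OF b(1) cc] c(2) by simp
    then have "star c \<subseteq> V" using b(3) star_subset_points by blast
    then have "c \<in> I" unfolding I_def using cc V(1) by (auto intro!: exI[of _ "{V}"])
    then show False using c(1) u(3) by blast
  qed
  then show "\<exists>\<F>. finite \<F> \<and> \<F> \<subseteq> \<U> \<and> star a \<subseteq> \<Union>\<F>" unfolding I_def by blast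
qed

text \<open>
  The sets \<open>star c\<close> with \<open>c\<close> bounded have interiors that cover the space, and they are closed under finite
  unions.
\<close>

lemma compactin_star_iff:
  assumes a: "a \<in> carrier B"
  shows "compactin cluster_space (star a) \<longleftrightarrow> a \<in> bdd B"
proof
  assume "a \<in> bdd B" then show "compactin cluster_space (star a)" by (rule compactin_star)
next
  assume c: "compactin cluster_space (star a)"
  let ?U = "(\<lambda>c. points - star (neg c)) ` bdd B"
  have 1: "\<forall>V\<in>?U. openin cluster_space V" using openin_compl_star bdd_carrier by auto
  have "star a \<subseteq> \<Union>?U"
  proof
    fix \<sigma> assume "\<sigma> \<in> star a"
    then have sp: "\<sigma> \<in> points" by (auto simp: star_def)
    obtain c where "c \<in> bdd B" "neg c \<notin> \<sigma>" using point_bounded_interior[OF sp] .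
    then show "\<sigma> \<in> \<Union>?U" using sp by (auto simp: star_def)
  qed
  with c 1 obtain \<F> where F: "finite \<F>" "\<F> \<subseteq> ?U" "star a \<subseteq> \<Union>\<F>"
    unfolding compactin_def by meson
  have "\<exists>c\<in>bdd B. \<Union>\<F> \<subseteq> star c" using F(1,2)
  proof (induction \<F>)
    case empty then show ?case using bdd_bot by auto
  next
    case (insert V \<F>)
    then obtain c d where cd: "c \<in> bdd B" "\<Union>\<F> \<subseteq> star c" "d \<in> bdd B" "V = points - star (neg d)" by auto
    then have "V \<subseteq> star d" using star_neg bdd_carrier by blast
    then show ?case using cd bdd_join bdd_carrier
      by (intro bexI[of _ "c \<squnion> d"]) (auto simp: star_join)
  qed
  then obtain c where c: "c \<in> bdd B" "star a \<subseteq> star c" using F(3) by (meson order_trans)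
  then show "a \<in> bdd B" using bdd_down[OF c(1) a] star_subset_iff[OF a bdd_carrier[OF c(1)]] by simp
qed

lemma locally_compact_cluster_space: "locally_compact_space cluster_space"
  unfolding locally_compact_space_def
proof
  fix \<sigma> assume "\<sigma> \<in> topspace cluster_space"
  then have sp: "\<sigma> \<in> points" by simp
  obtain c where c: "c \<in> bdd B" "neg c \<notin> \<sigma>" using point_bounded_interior[OF sp] .
  have cc: "c \<in> carrier B" using c bdd_carrier by blast
  show "\<exists>U K. openin cluster_space U \<and> compactin cluster_space K \<and> \<sigma> \<in> U \<and> U \<subseteq> K"
  proof (intro exI conjI)
    show "openin cluster_space (points - star (neg c))" using cc by (simp add: openin_compl_star)
    show "compactin cluster_space (star c)" using c(1) by (rule compactin_star)
    show "\<sigma> \<in> points - star (neg c)" using sp c(2) by (simp add: star_def)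
    show "points - star (neg c) \<subseteq> star c" using cc by (rule star_neg)
  qed
qed

text \<open>
  Some bounded \<open>b \<in> \<tau>\<close> is apart from \<open>a\<close>, and \<open>d\<close> interpolates between \<open>b\<close> and \<open>neg a\<close>.
\<close>

lemma separate_points:
  assumes s: "\<sigma> \<in> points" and t: "\<tau> \<in> points" and a: "a \<in> \<sigma>" "a \<notin> \<tau>"
  shows "\<exists>d\<in>carrier B. d \<notin> \<sigma> \<and> neg d \<notin> \<tau>"
proof -
  have ac: "a \<in> carrier B" using point_carrier[OF s a(1)] .
  obtain b where b: "b \<in> bdd B" "b \<in> \<tau>" "\<not> contact B b a" using point_apart[OF t ac a(2)] .
  have bc: "b \<in> carrier B" using b bdd_carrier by blast
  have "well_inside B b (neg a)" using b(3) ac by (simp add: well_inside_def)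
  then obtain d where d: "d \<in> bdd B" "well_inside B b d" "well_inside B d (neg a)"
    using BC1[OF b(1) neg_closed[OF ac]] by metis
  have dc: "d \<in> carrier B" using d bdd_carrier by blast
  have "\<not> contact B d a" using d(3) ac by (simp add: well_inside_def)
  then have "d \<notin> \<sigma>" using point_contact[OF s _ a(1)] by metis
  moreover have "neg d \<notin> \<tau>" using d(2) point_contact[OF t b(2)] unfolding well_inside_def by metis
  ultimately show ?thesis using dc by blast
qed

lemma Hausdorff_cluster_space: "Hausdorff_space cluster_space"
  unfolding Hausdorff_space_def
proof (intro allI impI)
  fix \<sigma> \<tau> assume "\<sigma> \<in> topspace cluster_space \<and> \<tau> \<in> topspace cluster_space \<and> \<sigma> \<noteq> \<tau>"
  then have st: "\<sigma> \<in> points" "\<tau> \<in> points" "\<sigma> \<noteq> \<tau>" by auto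
  obtain d where d: "d \<in> carrier B" "d \<notin> \<sigma>" "neg d \<notin> \<tau>"
  proof -
    consider a where "a \<in> \<sigma>" "a \<notin> \<tau>" | a where "a \<in> \<tau>" "a \<notin> \<sigma>" using st(3) by blast
    then show thesis
    proof cases
      case 1 then show thesis using separate_points[OF st(1,2)] that by blast
    next
      case 2 then show thesis using separate_points[OF st(2,1)] that by (metis neg_closed neg_neg)
    qed
  qed
  show "\<exists>U V. openin cluster_space U \<and> openin cluster_space V \<and> \<sigma> \<in> U \<and> \<tau> \<in> V \<and> disjnt U V"
  proof (intro exI conjI)
    show "openin cluster_space (points - star d)" "openin cluster_space (points - star (neg d))"
      using d(1) by (simp_all add: openin_compl_star)
    show "\<sigma> \<in> points - star d" "\<tau> \<in> points - star (neg d)"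
      using st d by (simp_all add: star_def)
    show "disjnt (points - star d) (points - star (neg d))"
      using star_neg[OF d(1)] by (auto simp: disjnt_def)
  qed
qed

text \<open>
  A clopen set is regular closed, hence some \<open>star a\<close>; it is disjoint from \<open>star (neg a)\<close> because
  the interior of \<open>star a\<close> is the complement of \<open>star (neg a)\<close>.
\<close>

lemma connected_cluster_space:
  assumes B: "complete_lattice B" and conn: "connected_contact B"
  shows "connected_space cluster_space"
  unfolding connected_space_clopen_in
proof (intro allI impI)
  fix T assume T: "openin cluster_space T \<and> closedin cluster_space T"
  then have "T \<in> regular_closed cluster_space"
    by (simp add: regular_closed_iff interior_of_openin closure_of_closedin)
  then obtain a where a: "a \<in> carrier B" "star a = T" using star_surj[OF B] by blast
  have "star a = points - star (neg a)"
    using interior_star[OF a(1)] T a(2) by (simp add: interior_of_openin)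
  then have "star a \<inter> star (neg a) = {}" by blast
  then have "\<not> contact B a (neg a)" using star_contact_iff[of a "neg a"] a(1) by simp
  then have "a = \<bottom> \<or> a = \<top>" using conn a(1) unfolding connected_contact_def by blast
  then show "T = {} \<or> T = topspace cluster_space" using a(2) star_bot star_top by auto
qed

end


section \<open>Isomorphisms of contact algebras\<close>

text \<open>
  The record schemes differ so that the locale also relates an algebra to its extension by, or its
  restriction without, a set of bounded elements.  The field \<open>eq B\<close> must be equality on the whole type,
  about which a bijection of carriers says nothing.
\<close>

locale contact_iso =
  fixes A :: "('a, 'm) contact_algebra_scheme" and B :: "('b, 'n) contact_algebra_scheme"
    and h :: "'a \<Rightarrow> 'b"
  assumes complete: "complete_lattice A" and contact: "contact_algebra A"
    and bij: "bij_betw h (carrier A) (carrier B)" and eqB: "eq B = (=)"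
    and le_iff: "\<lbrakk>a \<in> carrier A; b \<in> carrier A\<rbrakk> \<Longrightarrow> h a \<sqsubseteq>\<^bsub>B\<^esub> h b \<longleftrightarrow> a \<sqsubseteq>\<^bsub>A\<^esub> b"
    and contact_iff: "\<lbrakk>a \<in> carrier A; b \<in> carrier A\<rbrakk> \<Longrightarrow> contact B (h a) (h b) \<longleftrightarrow> contact A a b"
begin

interpretation A: complete_lattice A by (rule complete)
interpretation A: contact_algebra A by (rule contact)

lemma iso_closed [simp]: "a \<in> carrier A \<Longrightarrow> h a \<in> carrier B"
  using bij by (auto simp: bij_betw_def)

lemma iso_ex: "b \<in> carrier B \<Longrightarrow> \<exists>a\<in>carrier A. b = h a"
  using bij by (auto simp: bij_betw_def)

lemma iso_eq_iff: "\<lbrakk>a \<in> carrier A; b \<in> carrier A\<rbrakk> \<Longrightarrow> h a = h b \<longleftrightarrow> a = b"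
  using bij by (auto simp: bij_betw_def inj_on_def)

lemma partial_order_iso: "partial_order B"
proof
  fix x y z assume "x \<sqsubseteq>\<^bsub>B\<^esub> y" "y \<sqsubseteq>\<^bsub>B\<^esub> z" "x \<in> carrier B" "y \<in> carrier B" "z \<in> carrier B"
  then show "x \<sqsubseteq>\<^bsub>B\<^esub> z" using iso_ex[of x] iso_ex[of y] iso_ex[of z] A.le_trans le_iff by metis
next
  fix x y assume "x \<sqsubseteq>\<^bsub>B\<^esub> y" "y \<sqsubseteq>\<^bsub>B\<^esub> x" "x \<in> carrier B" "y \<in> carrier B"
  then show "x .=\<^bsub>B\<^esub> y" using iso_ex[of x] iso_ex[of y] A.le_antisym le_iff eqB by metis
next
  fix x assume "x \<in> carrier B"
  then show "x \<sqsubseteq>\<^bsub>B\<^esub> x" using iso_ex[of x] le_iff A.le_refl by metis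
qed (auto simp: eqB)

lemma iso_preimage:
  assumes "S \<subseteq> carrier B"
  obtains T where "T \<subseteq> carrier A" "S = h ` T"
proof -
  have "S \<subseteq> h ` carrier A" using assms bij by (simp add: bij_betw_def)
  then show thesis using that by (meson subset_imageE)
qed

lemma least_iso:
  assumes T: "T \<subseteq> carrier A"
  shows "least B (h (\<Squnion>\<^bsub>A\<^esub> T)) (Upper B (h ` T))"
proof (rule least_UpperI)
  have s: "\<Squnion>\<^bsub>A\<^esub> T \<in> carrier A" using T by simp
  then show "h (\<Squnion>\<^bsub>A\<^esub> T) \<in> carrier B" by simp
  show "x \<sqsubseteq>\<^bsub>B\<^esub> h (\<Squnion>\<^bsub>A\<^esub> T)" if "x \<in> h ` T" for x
    using that T s A.sup_upper[OF T] by (auto simp: le_iff subset_iff)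
  show "h (\<Squnion>\<^bsub>A\<^esub> T) \<sqsubseteq>\<^bsub>B\<^esub> y" if y: "y \<in> Upper B (h ` T)" for y
  proof -
    obtain z where z: "z \<in> carrier A" "y = h z" using y iso_ex[of y] by (auto simp: Upper_def)
    have "x \<sqsubseteq>\<^bsub>A\<^esub> z" if x: "x \<in> T" for x
    proof -
      have "h x \<sqsubseteq>\<^bsub>B\<^esub> h z" using x y z T by (auto simp: Upper_def)
      then show ?thesis using x z T by (simp add: le_iff subset_iff)
    qed
    then show ?thesis using z s T by (simp add: le_iff A.sup_least)
  qed
qed (use T in auto)

lemma greatest_iso:
  assumes T: "T \<subseteq> carrier A"
  shows "greatest B (h (\<Sqinter>\<^bsub>A\<^esub> T)) (Lower B (h ` T))"
proof (rule greatest_LowerI)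
  have s: "\<Sqinter>\<^bsub>A\<^esub> T \<in> carrier A" using T by simp
  then show "h (\<Sqinter>\<^bsub>A\<^esub> T) \<in> carrier B" by simp
  show "h (\<Sqinter>\<^bsub>A\<^esub> T) \<sqsubseteq>\<^bsub>B\<^esub> x" if "x \<in> h ` T" for x
    using that T s A.inf_lower[OF T] by (auto simp: le_iff subset_iff)
  show "y \<sqsubseteq>\<^bsub>B\<^esub> h (\<Sqinter>\<^bsub>A\<^esub> T)" if y: "y \<in> Lower B (h ` T)" for y
  proof -
    obtain z where z: "z \<in> carrier A" "y = h z" using y iso_ex[of y] by (auto simp: Lower_def)
    have "z \<sqsubseteq>\<^bsub>A\<^esub> x" if x: "x \<in> T" for x
    proof -
      have "h z \<sqsubseteq>\<^bsub>B\<^esub> h x" using x y z T by (auto simp: Lower_def)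
      then show ?thesis using x z T by (simp add: le_iff subset_iff)
    qed
    then show ?thesis using z s T by (simp add: le_iff A.inf_greatest)
  qed
qed (use T in auto)

lemma complete_lattice_iso: "complete_lattice B"
proof (rule partial_order.complete_latticeI[OF partial_order_iso])
  fix S assume "S \<subseteq> carrier B"
  then obtain T where T: "T \<subseteq> carrier A" "S = h ` T" by (rule iso_preimage)
  show "\<exists>s. least B s (Upper B S)" "\<exists>i. greatest B i (Lower B S)"
    using least_iso[OF T(1)] greatest_iso[OF T(1)] T(2) by auto
qed

interpretation B: complete_lattice B by (rule complete_lattice_iso)

lemma iso_sup: "T \<subseteq> carrier A \<Longrightarrow> h (\<Squnion>\<^bsub>A\<^esub> T) = \<Squnion>\<^bsub>B\<^esub> (h ` T)"
  using B.least_unique[OF least_iso B.sup_lub, of T] iso_closed by blast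

lemma iso_inf: "T \<subseteq> carrier A \<Longrightarrow> h (\<Sqinter>\<^bsub>A\<^esub> T) = \<Sqinter>\<^bsub>B\<^esub> (h ` T)"
  using B.greatest_unique[OF greatest_iso B.inf_glb, of T] iso_closed by blast

lemma iso_join: "\<lbrakk>a \<in> carrier A; b \<in> carrier A\<rbrakk> \<Longrightarrow> h a \<squnion>\<^bsub>B\<^esub> h b = h (a \<squnion>\<^bsub>A\<^esub> b)"
  using iso_sup[of "{a, b}"] by (simp add: join_def)

lemma iso_meet: "\<lbrakk>a \<in> carrier A; b \<in> carrier A\<rbrakk> \<Longrightarrow> h a \<sqinter>\<^bsub>B\<^esub> h b = h (a \<sqinter>\<^bsub>A\<^esub> b)"
  using iso_inf[of "{a, b}"] by (simp add: meet_def)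

lemma iso_bot: "\<bottom>\<^bsub>B\<^esub> = h \<bottom>\<^bsub>A\<^esub>"
  using iso_sup[of "{}"] by (simp add: A.sup_empty B.sup_empty)

lemma iso_top: "\<top>\<^bsub>B\<^esub> = h \<top>\<^bsub>A\<^esub>"
  using iso_inf[of "{}"] by (simp add: A.inf_empty B.inf_empty)

lemma boolean_lattice_iso: "boolean_lattice B"
proof -
  interpret bounded_lattice B by (rule B.complete_bounded_lattice)
  show ?thesis
  proof
    fix x y z assume "x \<in> carrier B" "y \<in> carrier B" "z \<in> carrier B"
    then obtain a b c where "a \<in> carrier A" "b \<in> carrier A" "c \<in> carrier A"
      "x = h a" "y = h b" "z = h c" using iso_ex by metis
    then show "x \<sqinter>\<^bsub>B\<^esub> (y \<squnion>\<^bsub>B\<^esub> z) = (x \<sqinter>\<^bsub>B\<^esub> y) \<squnion>\<^bsub>B\<^esub> (x \<sqinter>\<^bsub>B\<^esub> z)"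
      by (simp add: iso_join iso_meet A.distrib)
  next
    fix x assume "x \<in> carrier B"
    then obtain a where a: "a \<in> carrier A" "x = h a" using iso_ex by metis
    then have "x \<squnion>\<^bsub>B\<^esub> h (bcompl A a) = \<top>\<^bsub>B\<^esub>" "x \<sqinter>\<^bsub>B\<^esub> h (bcompl A a) = \<bottom>\<^bsub>B\<^esub>"
      by (simp_all add: iso_join iso_meet iso_top iso_bot)
    then show "\<exists>y\<in>carrier B. x \<squnion>\<^bsub>B\<^esub> y = \<top>\<^bsub>B\<^esub> \<and> x \<sqinter>\<^bsub>B\<^esub> y = \<bottom>\<^bsub>B\<^esub>"
      using a by (intro bexI[of _ "h (bcompl A a)"]) simp_all
  qed
qed

lemma iso_neg: "a \<in> carrier A \<Longrightarrow> bcompl B (h a) = h (bcompl A a)"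
  by (rule boolean_lattice.neg_eqI[OF boolean_lattice_iso])
    (simp_all add: iso_join iso_meet iso_top iso_bot)

lemma iso_well_inside:
  "\<lbrakk>a \<in> carrier A; b \<in> carrier A\<rbrakk> \<Longrightarrow> well_inside B (h a) (h b) \<longleftrightarrow> well_inside A a b"
  by (simp add: well_inside_def iso_neg contact_iff)

lemma contact_algebra_iso: "contact_algebra B"
proof -
  interpret boolean_lattice B by (rule boolean_lattice_iso)
  show ?thesis
  proof
    fix x assume "x \<in> carrier B" "x \<noteq> \<bottom>\<^bsub>B\<^esub>"
    then show "contact B x x" using iso_ex[of x] A.C1 contact_iff iso_bot by metis
  next
    fix x y assume x: "x \<in> carrier B" and y: "y \<in> carrier B" and c: "contact B x y"
    obtain a b where ab: "a \<in> carrier A" "b \<in> carrier A" "x = h a" "y = h b"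
      using iso_ex[OF x] iso_ex[OF y] by blast
    then have "contact A a b" using c contact_iff by simp
    then show "x \<noteq> \<bottom>\<^bsub>B\<^esub> \<and> y \<noteq> \<bottom>\<^bsub>B\<^esub>" "contact B y x"
      using ab A.C2[of a b] A.C3[of a b] by (auto simp: iso_bot contact_iff iso_eq_iff)
  next
    fix x y z assume x: "x \<in> carrier B" and y: "y \<in> carrier B" and z: "z \<in> carrier B"
    obtain a b c where "a \<in> carrier A" "b \<in> carrier A" "c \<in> carrier A" "x = h a" "y = h b" "z = h c"
      using iso_ex[OF x] iso_ex[OF y] iso_ex[OF z] by blast
    then show "contact B x (y \<squnion>\<^bsub>B\<^esub> z) \<longleftrightarrow> contact B x y \<or> contact B x z"
      by (simp add: iso_join contact_iff A.C4)
  qed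
qed

lemma connected_contact_iso: "connected_contact A \<Longrightarrow> connected_contact B"
  unfolding connected_contact_def using iso_ex
  by (metis A.neg_closed contact_iff iso_bot iso_top iso_neg)

lemma iso_in_DSke_hom: "(\<lambda>a\<in>carrier A. h a) \<in> DSke_hom A B"
proof -
  have "restrict h (carrier A) ` T = h ` T" if "T \<subseteq> carrier A" for T
    using that by auto
  then show ?thesis
    using A.complete_lattice_axioms B.complete_lattice_axioms
    by (auto simp: DSke_hom_def complete_boolean_hom_def sup_pres_def inf_pres_def
        iso_sup iso_inf contact_iff)
qed

end

lemma local_contact_algebra_iso:
  assumes iso: "contact_iso A B h" and A: "local_contact_algebra A"
    and sub: "bdd B \<subseteq> carrier B" and bdd: "\<And>a. a \<in> carrier A \<Longrightarrow> h a \<in> bdd B \<longleftrightarrow> a \<in> bdd A"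
  shows "local_contact_algebra B"
proof -
  interpret contact_iso A B h by fact
  interpret A: local_contact_algebra A by fact
  interpret B: contact_algebra B by (rule contact_algebra_iso)
  have ex: "\<exists>a\<in>bdd A. y = h a" if "y \<in> bdd B" for y
    using that sub iso_ex bdd by blast
  have c: "a \<in> carrier A" if "a \<in> bdd A" for a using that A.bdd_sub by blast
  show ?thesis
  proof
    show "bdd B \<subseteq> carrier B" by (rule sub)
    show "\<bottom>\<^bsub>B\<^esub> \<in> bdd B" using A.bdd_bot bdd by (simp add: iso_bot)
    fix x y assume x: "x \<in> bdd B"
    then obtain a where a: "a \<in> bdd A" "x = h a" using ex by blast
    show "x \<squnion>\<^bsub>B\<^esub> y \<in> bdd B" if y: "y \<in> bdd B"
    proof -
      obtain b where b: "b \<in> bdd A" "y = h b" using ex[OF y] by blast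
      then show ?thesis using a c A.bdd_join by (simp add: iso_join bdd)
    qed
    show "y \<in> bdd B" if y: "y \<in> carrier B" "y \<sqsubseteq>\<^bsub>B\<^esub> x"
    proof -
      obtain b where b: "b \<in> carrier A" "y = h b" using iso_ex[OF y(1)] by blast
      then have "b \<sqsubseteq>\<^bsub>A\<^esub> a" using y(2) a c le_iff by simp
      then show ?thesis using A.bdd_down[OF a(1) b(1)] b bdd by simp
    qed
    show "\<exists>b\<in>bdd B. well_inside B x b \<and> well_inside B b y" if y: "y \<in> carrier B" "well_inside B x y"
    proof -
      obtain b where b: "b \<in> carrier A" "y = h b" using iso_ex[OF y(1)] by blast
      then have "well_inside A a b" using y(2) a c iso_well_inside by simp
      then obtain d where "d \<in> bdd A" "well_inside A a d" "well_inside A d b"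
        using A.BC1[OF a(1) b(1)] by blast
      then show ?thesis using a b c by (intro bexI[of _ "h d"]) (simp_all add: iso_well_inside bdd)
    qed
  next
    fix x y assume x: "x \<in> carrier B" and y: "y \<in> carrier B" and xy: "contact B x y"
    obtain a b where ab: "a \<in> carrier A" "b \<in> carrier A" "x = h a" "y = h b"
      using iso_ex[OF x] iso_ex[OF y] by blast
    then have "contact A a b" using xy contact_iff by simp
    then obtain d where "d \<in> bdd A" "contact A a (d \<sqinter>\<^bsub>A\<^esub> b)"
      using A.BC2[OF ab(1,2)] by blast
    then show "\<exists>c\<in>bdd B. contact B x (c \<sqinter>\<^bsub>B\<^esub> y)"
      using ab c by (intro bexI[of _ "h d"]) (simp_all add: iso_meet contact_iff bdd)
  next
    fix x assume x: "x \<in> carrier B" and nb: "x \<noteq> \<bottom>\<^bsub>B\<^esub>"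
    obtain a where a: "a \<in> carrier A" "x = h a" using iso_ex[OF x] by blast
    then have "a \<noteq> \<bottom>\<^bsub>A\<^esub>" using nb iso_bot by metis
    then obtain d where "d \<in> bdd A" "d \<noteq> \<bottom>\<^bsub>A\<^esub>" "well_inside A d a" using A.BC3[OF a(1)] by blast
    then show "\<exists>b\<in>bdd B. b \<noteq> \<bottom>\<^bsub>B\<^esub> \<and> well_inside B b x"
      using a c by (intro bexI[of _ "h d"]) (simp_all add: iso_well_inside bdd iso_bot iso_eq_iff)
  qed
qed

lemma contact_iso_inverse:
  assumes iso: "contact_iso A B h" and eqA: "eq A = (=)"
  shows "contact_iso B A (inv_into (carrier A) h)"
proof -
  interpret contact_iso A B h by fact
  let ?g = "inv_into (carrier A) h"
  have g: "?g y \<in> carrier A \<and> h (?g y) = y" if "y \<in> carrier B" for y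
    using that bij by (metis bij_betw_imp_surj_on f_inv_into_f inv_into_into)
  show ?thesis
  proof (rule contact_iso.intro)
    fix a b assume "a \<in> carrier B" "b \<in> carrier B"
    then show "?g a \<sqsubseteq>\<^bsub>A\<^esub> ?g b \<longleftrightarrow> a \<sqsubseteq>\<^bsub>B\<^esub> b" "contact A (?g a) (?g b) \<longleftrightarrow> contact B a b"
      using g le_iff contact_iff by metis+
  qed (use complete_lattice_iso contact_algebra_iso bij bij_betw_inv_into eqA in auto)
qed

lemma contact_iso_inverses:
  assumes "contact_iso A B h"
  defines "\<phi> \<equiv> \<lambda>a\<in>carrier A. h a" and "\<psi> \<equiv> \<lambda>b\<in>carrier B. inv_into (carrier A) h b"
  shows "compose (carrier A) \<psi> \<phi> = (\<lambda>a\<in>carrier A. a)" "compose (carrier B) \<phi> \<psi> = (\<lambda>b\<in>carrier B. b)"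
proof -
  interpret contact_iso A B h by fact
  show "compose (carrier A) \<psi> \<phi> = (\<lambda>a\<in>carrier A. a)"
    using bij by (auto simp: compose_def \<phi>_def \<psi>_def bij_betw_def intro!: restrict_ext)
  show "compose (carrier B) \<phi> \<psi> = (\<lambda>b\<in>carrier B. b)"
    using bij unfolding compose_def \<phi>_def \<psi>_def bij_betw_def
    by (intro restrict_ext) (auto simp: f_inv_into_f inv_into_into)
qed

lemma contact_iso_in_DSkePer_hom:
  assumes iso: "contact_iso A B h" and A: "local_contact_algebra A" and B: "local_contact_algebra B"
    and bdd: "\<And>a. a \<in> carrier A \<Longrightarrow> h a \<in> bdd B \<longleftrightarrow> a \<in> bdd A"
  shows "(\<lambda>a\<in>carrier A. h a) \<in> DSkePer_hom A B"
proof -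
  interpret contact_iso A B h by fact
  interpret A: local_contact_algebra A by fact
  interpret B: local_contact_algebra B by fact
  have "\<exists>a\<in>bdd A. b \<sqsubseteq>\<^bsub>B\<^esub> (\<lambda>a\<in>carrier A. h a) a" if b: "b \<in> bdd B" for b
  proof -
    obtain a where a: "a \<in> carrier A" "b = h a" using b B.bdd_sub iso_ex by blast
    then show ?thesis using bdd b by (intro bexI[of _ a]) auto
  qed
  moreover have "(\<lambda>a\<in>carrier A. h a) a \<in> bdd B" if "a \<in> bdd A" for a
    using that bdd A.bdd_sub by auto
  ultimately show ?thesis
    using iso_in_DSke_hom by (simp add: DSkePer_hom_iff[OF A B])
qed

lemma contact_iso_identity:
  assumes "complete_lattice A" "contact_algebra A"
    "carrier B = carrier A" "eq B = eq A" "le B = le A" "contact B = contact A"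
  shows "contact_iso A B (\<lambda>a. a)"
proof -
  interpret complete_lattice A by fact
  show ?thesis
    by (rule contact_iso.intro) (use assms in \<open>simp_all add: eq_is_equal bij_betw_def\<close>)
qed

lemma contact_iso_imp_DSkePer_iso:
  assumes iso: "contact_iso A B h" and A: "local_contact_algebra A" and B: "local_contact_algebra B"
    and bdd: "\<And>a. a \<in> carrier A \<Longrightarrow> h a \<in> bdd B \<longleftrightarrow> a \<in> bdd A"
  shows "DSkePer_iso A B"
proof -
  interpret contact_iso A B h by fact
  have eqA: "eq A = (=)"
    using complete by (simp add: complete_lattice_def partial_order_def partial_order_axioms_def)
  have "inv_into (carrier A) h b \<in> bdd A \<longleftrightarrow> b \<in> bdd B" if b: "b \<in> carrier B" for b
  proof -
    obtain a where "a \<in> carrier A" "b = h a" using iso_ex[OF b] by blast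
    then show ?thesis using bdd bij by (simp add: bij_betw_def)
  qed
  then have "(\<lambda>b\<in>carrier B. inv_into (carrier A) h b) \<in> DSkePer_hom B A"
    using contact_iso_in_DSkePer_hom[OF contact_iso_inverse[OF iso eqA] B A] by blast
  then show ?thesis
    unfolding DSkePer_iso_def
    using contact_iso_in_DSkePer_hom[OF iso A B bdd] contact_iso_inverses[OF iso] by blast
qed


section \<open>Representation of complete local contact algebras\<close>

lemma star_contact_iso:
  assumes B: "local_contact_algebra B" "complete_lattice B"
  shows "contact_iso B (RCL (local_contact_algebra.cluster_space B)) (local_contact_algebra.star B)"
proof -
  interpret local_contact_algebra B by fact
  show ?thesis
  proof (rule contact_iso.intro)
    show "bij_betw star (carrier B) (carrier (RCL cluster_space))"
      unfolding bij_betw_def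
    proof
      show "inj_on star (carrier B)" by (rule inj_onI) (rule star_inj)
      show "star ` carrier B = carrier (RCL cluster_space)"
        using star_regular_closed star_surj[OF B(2)] by force
    qed
  qed (use B contact_algebra_axioms star_subset_iff star_contact_iff in auto)
qed

theorem representation:
  fixes B :: "'d local_contact_algebra"
  assumes B: "DLCCon_algebra B"
  shows "\<exists>X :: 'd set topology. LCCon_space X \<and> topspace X \<subseteq> Pow (carrier B) \<and> DSkePer_iso B (RCL X)"
proof -
  have l: "local_contact_algebra B" and c: "complete_lattice B" and conn: "connected_contact B"
    using B by (auto simp: DLCCon_algebra_def)
  interpret local_contact_algebra B by (rule l)
  have X: "LCCon_space cluster_space"
    using connected_cluster_space[OF c conn] locally_compact_cluster_space Hausdorff_cluster_space
    by (simp add: LCCon_space_def)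
  have "DSkePer_iso B (RCL cluster_space)"
    using contact_iso_imp_DSkePer_iso[OF star_contact_iso[OF l c] l DLCCon_local[OF RCL_DLCCon_algebra[OF X]]]
      star_regular_closed compactin_star_iff by simp
  moreover have "topspace cluster_space \<subseteq> Pow (carrier B)" using point_carrier by auto
  ultimately show ?thesis using X by blast
qed


section \<open>The two categories\<close>

lemma DSkePer_hom_ident: "DLCCon_algebra A \<Longrightarrow> (\<lambda>a\<in>carrier A. a) \<in> DSkePer_hom A A"
  using contact_iso_in_DSkePer_hom[OF contact_iso_identity, of A A]
  by (simp add: DLCCon_algebra_def local_contact_algebra_def)

lemma DSke_hom_compose:
  assumes \<phi>: "\<phi> \<in> DSke_hom A B" and \<psi>: "\<psi> \<in> DSke_hom B C"
  shows "compose (carrier A) \<psi> \<phi> \<in> DSke_hom A C"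
proof -
  have h: "complete_boolean_hom A B \<phi>" "complete_boolean_hom B C \<psi>"
    using \<phi> \<psi> by (auto simp: DSke_hom_def)
  note p = complete_boolean_homD[OF h(1)] and q = complete_boolean_homD[OF h(2)]
  interpret A: complete_lattice A by (rule p(1))
  have im: "compose (carrier A) \<psi> \<phi> ` S = \<psi> ` \<phi> ` S" if "S \<subseteq> carrier A" for S
    using that by (auto simp: compose_def)
  have "complete_boolean_hom A C (compose (carrier A) \<psi> \<phi>)"
    unfolding complete_boolean_hom_def sup_pres_def inf_pres_def
  proof (intro conjI allI impI)
    show "compose (carrier A) \<psi> \<phi> \<in> carrier A \<rightarrow>\<^sub>E carrier C"
      using p(4) q(4) by (auto simp: compose_def)
    fix S assume S: "S \<subseteq> carrier A"
    then have S': "\<phi> ` S \<subseteq> carrier B" using p(4) by blast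
    show "compose (carrier A) \<psi> \<phi> (\<Squnion>\<^bsub>A\<^esub> S) = \<Squnion>\<^bsub>C\<^esub> (compose (carrier A) \<psi> \<phi> ` S)"
      using S S' by (simp add: im compose_eq p(5) q(5))
    show "compose (carrier A) \<psi> \<phi> (\<Sqinter>\<^bsub>A\<^esub> S) = \<Sqinter>\<^bsub>C\<^esub> (compose (carrier A) \<psi> \<phi> ` S)"
      using S S' by (simp add: im compose_eq p(6) q(6))
  qed (use p q in auto)
  then show ?thesis using \<phi> \<psi> p(4) by (auto simp: DSke_hom_def compose_def)
qed

lemma DSkePer_hom_compose:
  assumes A: "local_contact_algebra A" and B: "local_contact_algebra B" and C: "local_contact_algebra C"
    and \<phi>: "\<phi> \<in> DSkePer_hom A B" and \<psi>: "\<psi> \<in> DSkePer_hom B C"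
  shows "compose (carrier A) \<psi> \<phi> \<in> DSkePer_hom A C"
proof -
  interpret A: local_contact_algebra A by fact
  interpret B: local_contact_algebra B by fact
  interpret C: local_contact_algebra C by fact
  have p: "\<phi> \<in> DSke_hom A B" "\<And>b. b \<in> bdd B \<Longrightarrow> \<exists>a\<in>bdd A. b \<sqsubseteq>\<^bsub>B\<^esub> \<phi> a" "\<And>a. a \<in> bdd A \<Longrightarrow> \<phi> a \<in> bdd B"
    using \<phi> by (auto simp: DSkePer_hom_iff[OF A B])
  have q: "\<psi> \<in> DSke_hom B C" "\<And>b. b \<in> bdd C \<Longrightarrow> \<exists>a\<in>bdd B. b \<sqsubseteq>\<^bsub>C\<^esub> \<psi> a" "\<And>a. a \<in> bdd B \<Longrightarrow> \<psi> a \<in> bdd C"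
    using \<psi> by (auto simp: DSkePer_hom_iff[OF B C])
  have h: "complete_boolean_hom A B \<phi>" "complete_boolean_hom B C \<psi>"
    using p(1) q(1) by (auto simp: DSke_hom_def)
  have "\<exists>a\<in>bdd A. c \<sqsubseteq>\<^bsub>C\<^esub> compose (carrier A) \<psi> \<phi> a" if c: "c \<in> bdd C" for c
  proof -
    obtain b where b: "b \<in> bdd B" "c \<sqsubseteq>\<^bsub>C\<^esub> \<psi> b" using q(2)[OF c] by blast
    obtain a where a: "a \<in> bdd A" "b \<sqsubseteq>\<^bsub>B\<^esub> \<phi> a" using p(2)[OF b(1)] by blast
    have car: "a \<in> carrier A" "b \<in> carrier B" "c \<in> carrier C" "\<phi> a \<in> carrier B"
      "\<psi> b \<in> carrier C" "\<psi> (\<phi> a) \<in> carrier C"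
      using a b c A.bdd_sub B.bdd_sub C.bdd_sub complete_boolean_homD(4)[OF h(1)]
        complete_boolean_homD(4)[OF h(2)] by blast+
    have "\<psi> b \<sqsubseteq>\<^bsub>C\<^esub> \<psi> (\<phi> a)" using complete_boolean_hom_mono[OF h(2)] a car by blast
    then have "c \<sqsubseteq>\<^bsub>C\<^esub> \<psi> (\<phi> a)" using C.le_trans[OF b(2)] car by blast
    then show ?thesis using a(1) car by (intro bexI[of _ a]) (simp_all add: compose_def)
  qed
  moreover have "compose (carrier A) \<psi> \<phi> a \<in> bdd C" if "a \<in> bdd A" for a
    using that p(3) q(3) A.bdd_sub by (auto simp: compose_def)
  ultimately show ?thesis
    using DSke_hom_compose[OF p(1) q(1)] by (simp add: DSkePer_hom_iff[OF A C])
qed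

text \<open>
  The set \<open>D - int D\<close> is nowhere dense, that is, \<open>V = (topspace Y - D) \<union> int D\<close> is dense; so
  \<open>f\<^sup>-\<^sup>1 V\<close> is dense, and inside \<open>int (f\<^sup>-\<^sup>1 D)\<close> only its part \<open>f\<^sup>-\<^sup>1 (int D)\<close> counts.
\<close>

lemma skeletal_preimage_closed:
  assumes f: "skeletal_map X Y f" and D: "closedin Y D"
  shows "X interior_of {x \<in> topspace X. f x \<in> D} \<subseteq> X closure_of {x \<in> topspace X. f x \<in> Y interior_of D}"
proof
  let ?p = "\<lambda>V. {x \<in> topspace X. f x \<in> V}"
  fix x assume x: "x \<in> X interior_of ?p D"
  define V where "V = (topspace Y - D) \<union> Y interior_of D"
  have V: "openin Y V" unfolding V_def using D by (intro openin_Un) auto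
  have "Y closure_of V = topspace Y"
    using interior_of_subset_topspace[of Y D] closure_of_subset[OF interior_of_subset_topspace[of Y D]]
      closure_of_subset_topspace[of Y V]
    by (auto simp: V_def closure_of_complement)
  moreover have fXY: "f \<in> topspace X \<rightarrow> topspace Y" using f by (simp add: skeletal_map_def)
  ultimately have "?p (Y closure_of V) = topspace X" by auto
  moreover have "X interior_of (?p (Y closure_of V)) \<subseteq> X closure_of (?p V)"
    using f V by (simp add: skeletal_map_def)
  ultimately have "topspace X \<subseteq> X closure_of (?p V)" by simp
  also have "?p V = ?p (topspace Y - D) \<union> ?p (Y interior_of D)" by (auto simp: V_def)
  also have "X closure_of \<dots> = X closure_of ?p (topspace Y - D) \<union> X closure_of ?p (Y interior_of D)"
    by simp
  finally have "x \<in> X closure_of ?p (topspace Y - D) \<or> x \<in> X closure_of ?p (Y interior_of D)"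
    using x interior_of_subset_topspace[of X "?p D"] by blast
  moreover have "X interior_of ?p D \<inter> X closure_of ?p (topspace Y - D) = {}"
    using interior_of_subset[of X "?p D"]
    by (subst openin_Int_closure_of_eq_empty) auto
  ultimately show "x \<in> X closure_of ?p (Y interior_of D)" using x by blast
qed

text \<open>
  With \<open>W = g\<^sup>-\<^sup>1 V\<close> and \<open>D = g\<^sup>-\<^sup>1 (cl V)\<close>, skeletality of \<open>g\<close> gives \<open>int D \<subseteq> int (cl W)\<close>, and that
  of \<open>f\<close> gives \<open>int (f\<^sup>-\<^sup>1 D) \<subseteq> cl (f\<^sup>-\<^sup>1 (int D)) \<subseteq> cl (f\<^sup>-\<^sup>1 W)\<close>.
\<close>

lemma skeletal_compose:
  assumes f: "skeletal_map X Y f" "continuous_map X Y f" and g: "skeletal_map Y Z g" "continuous_map Y Z g"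
  shows "skeletal_map X Z (compose (topspace X) g f)"
  unfolding skeletal_map_def
proof (intro conjI allI impI)
  have fXY: "f \<in> topspace X \<rightarrow> topspace Y" and "g \<in> topspace Y \<rightarrow> topspace Z"
    using f g by (auto simp: skeletal_map_def)
  then show "compose (topspace X) g f \<in> topspace X \<rightarrow> topspace Z" by (auto simp: compose_def)
  fix V assume V: "openin Z V"
  have pre: "{x \<in> topspace X. compose (topspace X) g f x \<in> V}
      = {x \<in> topspace X. f x \<in> {y \<in> topspace Y. g y \<in> V}}" for V
    using fXY by (auto simp: compose_def)
  let ?D = "{y \<in> topspace Y. g y \<in> Z closure_of V}" and ?W = "{y \<in> topspace Y. g y \<in> V}"
  have D: "closedin Y ?D" using g(2) by (intro closedin_continuous_map_preimage) auto
  have W: "openin Y ?W" using g(2) V by (rule openin_continuous_map_preimage)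
  have "Y interior_of ?D \<subseteq> Y interior_of (Y closure_of ?W)"
    using g(1) V by (intro interior_of_maximal) (auto simp: skeletal_map_def)
  then have "{x \<in> topspace X. f x \<in> Y interior_of ?D} \<subseteq> X closure_of {x \<in> topspace X. f x \<in> ?W}"
    using skeletal_preimage_interior_closure[OF f W] by blast
  then have "X closure_of {x \<in> topspace X. f x \<in> Y interior_of ?D} \<subseteq> X closure_of {x \<in> topspace X. f x \<in> ?W}"
    by (rule closure_of_minimal) simp
  then show "X interior_of {x \<in> topspace X. compose (topspace X) g f x \<in> Z closure_of V}
      \<subseteq> X closure_of {x \<in> topspace X. compose (topspace X) g f x \<in> V}"
    unfolding pre using skeletal_preimage_closed[OF f(1) D] by blast
qed

lemma proper_map_cong:
  assumes "proper_map X Y f" "\<And>x. x \<in> topspace X \<Longrightarrow> f x = g x"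
  shows "proper_map X Y g"
proof -
  have "g ` U = f ` U" if "closedin X U" for U
    using closedin_subset[OF that] assms(2) by (intro image_cong) auto
  moreover have "{x \<in> topspace X. g x = y} = {x \<in> topspace X. f x = y}" for y
    using assms(2) by auto
  ultimately show ?thesis using assms(1) by (simp add: proper_map_def closed_map_def)
qed

lemma SkePer_hom_compose:
  assumes f: "f \<in> SkePer_hom X Y" and g: "g \<in> SkePer_hom Y Z"
  shows "compose (topspace X) g f \<in> SkePer_hom X Z"
proof -
  have "proper_map X Z (g \<circ> f)" "continuous_map X Z (g \<circ> f)"
    using f g by (auto simp: SkePer_hom_def intro: proper_map_compose continuous_map_compose)
  then have "proper_map X Z (compose (topspace X) g f)" "continuous_map X Z (compose (topspace X) g f)"
    by (auto simp: compose_def elim: proper_map_cong continuous_map_eq)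
  moreover have "compose (topspace X) g f \<in> topspace X \<rightarrow>\<^sub>E topspace Z"
    using f g by (auto simp: SkePer_hom_def compose_def)
  ultimately show ?thesis
    using f g by (auto simp: SkePer_hom_def intro: skeletal_compose)
qed

lemma SkePer_hom_ident: "(\<lambda>x\<in>topspace X. x) \<in> SkePer_hom X X"
proof -
  have "{x \<in> topspace X. (\<lambda>x\<in>topspace X. x) x \<in> V} = topspace X \<inter> V" for V by auto
  then have "skeletal_map X X (\<lambda>x\<in>topspace X. x)"
    unfolding skeletal_map_def
    by (auto simp: closure_of_restrict[symmetric] interior_of_restrict[symmetric]
        dest: subsetD[OF interior_of_subset])
  moreover have "continuous_map X X (\<lambda>x\<in>topspace X. x)"
    by (rule continuous_map_eq[OF continuous_map_id]) simp
  moreover have "proper_map X X (\<lambda>x\<in>topspace X. x)"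
    by (rule proper_map_cong[OF proper_map_id]) simp
  ultimately show ?thesis by (simp add: SkePer_hom_def)
qed

lemma SkePer_hom_Id:
  assumes "f \<in> SkePer_hom X Y"
  shows "compose (topspace X) f (\<lambda>x\<in>topspace X. x) = f" "compose (topspace X) (\<lambda>y\<in>topspace Y. y) f = f"
  using assms unfolding SkePer_hom_def by (auto simp: compose_Id Id_compose PiE_iff Pi_iff)

lemma is_category_SkePerLCCon: "is_category (SkePerLCCon S)"
  unfolding is_category_def SkePerLCCon_def
  by (auto simp: SkePer_hom_ident SkePer_hom_compose SkePer_hom_Id)
    (auto simp: SkePer_hom_def compose_assoc PiE_iff Pi_iff)

lemma DSkePer_hom_Id:
  assumes "f \<in> DSkePer_hom A B"
  shows "compose (carrier A) f (\<lambda>x\<in>carrier A. x) = f" "compose (carrier A) (\<lambda>y\<in>carrier B. y) f = f"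
  using assms unfolding DSkePer_hom_def DSke_hom_def complete_boolean_hom_def
  by (auto simp: compose_Id Id_compose PiE_iff Pi_iff)

lemma DSkePer_hom_PiE: "f \<in> DSkePer_hom A B \<Longrightarrow> f \<in> carrier A \<rightarrow>\<^sub>E carrier B"
  by (auto simp: DSkePer_hom_def DSke_hom_def complete_boolean_hom_def)

lemma is_category_DSkePerLCCon: "is_category (DSkePerLCCon S)"
  unfolding is_category_def DSkePerLCCon_def
  by (auto simp: DSkePer_hom_ident DSkePer_hom_Id intro: DSkePer_hom_compose DLCCon_local)
    (auto simp: compose_assoc PiE_iff Pi_iff dest!: DSkePer_hom_PiE)

lemma is_category_opposite: "is_category C \<Longrightarrow> is_category (opposite C)"
  unfolding is_category_def opposite_def by simp


section \<open>Compact spaces and normal contact algebras\<close>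

definition all_bounded :: "'a contact_algebra \<Rightarrow> 'a local_contact_algebra" where
  "all_bounded B = \<lparr> carrier = carrier B, eq = eq B, le = le B, contact = contact B, bdd = carrier B \<rparr>"

definition forget_bdd :: "'a local_contact_algebra \<Rightarrow> 'a contact_algebra" where
  "forget_bdd A = \<lparr> carrier = carrier A, eq = eq A, le = le A, contact = contact A \<rparr>"

lemma all_bounded_simps [simp]:
  "carrier (all_bounded B) = carrier B" "le (all_bounded B) = le B" "eq (all_bounded B) = eq B"
  "contact (all_bounded B) = contact B" "bdd (all_bounded B) = carrier B"
  by (simp_all add: all_bounded_def)

lemma forget_bdd_simps [simp]:
  "carrier (forget_bdd A) = carrier A" "le (forget_bdd A) = le A" "eq (forget_bdd A) = eq A"
  "contact (forget_bdd A) = contact A"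
  by (simp_all add: forget_bdd_def)

lemma forget_all_bounded [simp]: "forget_bdd (all_bounded B) = B"
  by (simp add: forget_bdd_def)

lemma all_bounded_forget: "bdd A = carrier A \<Longrightarrow> all_bounded (forget_bdd A) = A"
  by (simp add: all_bounded_def)

lemma forget_RCL: "forget_bdd (RCL X) = RC X"
  by (simp add: forget_bdd_def RCL_def RC_def)

text \<open>
  Interpolation in \<open>C5\<close> is that in \<open>BC1\<close> for the complementary element, \<open>C6\<close> is \<open>BC3\<close> for the
  complement of \<open>a\<close>, and \<open>BC2\<close> holds with \<open>c = \<top>\<close>.
\<close>

lemma all_bounded_DLCCon_algebra:
  assumes B: "DCCon_algebra B"
  shows "DLCCon_algebra (all_bounded B)"
proof -
  interpret B: normal_contact_algebra B using B by (simp add: DCCon_algebra_def)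
  have c: "complete_lattice B" and conn: "connected_contact B" using B by (auto simp: DCCon_algebra_def)
  interpret iso: contact_iso B "all_bounded B" "\<lambda>a. a"
    by (rule contact_iso_identity) (use c B.contact_algebra_axioms in auto)
  interpret L: contact_algebra "all_bounded B" by (rule iso.contact_algebra_iso)
  have wi: "well_inside (all_bounded B) a b \<longleftrightarrow> \<not> contact B a (bcompl B b)"
    if "a \<in> carrier B" "b \<in> carrier B" for a b
    using iso.iso_well_inside that by (simp add: well_inside_def)
  have "local_contact_algebra (all_bounded B)"
  proof
    fix a c assume "a \<in> bdd (all_bounded B)" "c \<in> carrier (all_bounded B)" "well_inside (all_bounded B) a c"
    then have ac: "a \<in> carrier B" "c \<in> carrier B" and "\<not> contact B a (bcompl B c)" by (auto simp: wi)
    then obtain d where d: "d \<in> carrier B" "\<not> contact B a d" "\<not> contact B (bcompl B c) (bcompl B d)"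
      using B.C5[of a "bcompl B c"] B.neg_closed[of c] by blast
    then have "\<not> contact B (bcompl B d) (bcompl B c)"
      using B.C3[of "bcompl B d" "bcompl B c"] ac by auto
    then show "\<exists>b\<in>bdd (all_bounded B). well_inside (all_bounded B) a b \<and> well_inside (all_bounded B) b c"
      using d ac by (intro bexI[of _ "bcompl B d"]) (simp_all add: wi)
  next
    fix a b assume "a \<in> carrier (all_bounded B)" "b \<in> carrier (all_bounded B)" "contact (all_bounded B) a b"
    then show "\<exists>c\<in>bdd (all_bounded B). contact (all_bounded B) a (c \<sqinter>\<^bsub>all_bounded B\<^esub> b)"
      by (intro bexI[of _ "\<top>\<^bsub>B\<^esub>"]) (simp_all add: iso.iso_meet)
  next
    fix a assume a: "a \<in> carrier (all_bounded B)" "a \<noteq> \<bottom>\<^bsub>all_bounded B\<^esub>"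
    then have "bcompl B a \<noteq> \<top>\<^bsub>B\<^esub>" using B.neg_eq_bot[of "bcompl B a"] by (simp add: iso.iso_bot)
    then obtain b where "b \<in> carrier B" "b \<noteq> \<bottom>\<^bsub>B\<^esub>" "\<not> contact B b (bcompl B a)"
      using B.C6[of "bcompl B a"] B.neg_closed[of a] a(1) by auto
    then show "\<exists>b\<in>bdd (all_bounded B). b \<noteq> \<bottom>\<^bsub>all_bounded B\<^esub> \<and> well_inside (all_bounded B) b a"
      using a by (intro bexI[of _ b]) (simp_all add: wi iso.iso_bot)
  qed (auto simp: iso.iso_bot iso.iso_join)
  then show ?thesis
    using iso.complete_lattice_iso iso.connected_contact_iso[OF conn] by (simp add: DLCCon_algebra_def)
qed

lemma forget_bdd_DCCon_algebra:
  assumes A: "DLCCon_algebra A" and bdd: "bdd A = carrier A"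
  shows "DCCon_algebra (forget_bdd A)"
proof -
  interpret A: local_contact_algebra A using A by (simp add: DLCCon_algebra_def)
  have c: "complete_lattice A" and conn: "connected_contact A" using A by (auto simp: DLCCon_algebra_def)
  interpret iso: contact_iso A "forget_bdd A" "\<lambda>a. a"
    by (rule contact_iso_identity) (use c A.contact_algebra_axioms in auto)
  interpret L: contact_algebra "forget_bdd A" by (rule iso.contact_algebra_iso)
  have "normal_contact_algebra (forget_bdd A)"
  proof
    fix a b assume "a \<in> carrier (forget_bdd A)" "b \<in> carrier (forget_bdd A)" "\<not> contact (forget_bdd A) a b"
    then have ab: "a \<in> carrier A" "b \<in> carrier A" "well_inside A a (bcompl A b)"
      by (auto simp: well_inside_def)
    then obtain d where d: "d \<in> carrier A" "well_inside A a d" "well_inside A d (bcompl A b)"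
      using A.BC1[of a "bcompl A b"] A.neg_closed[of b] unfolding bdd by blast
    then have "\<not> contact A b d" using A.C3[of b d] ab by (auto simp: well_inside_def)
    then show "\<exists>c\<in>carrier (forget_bdd A). \<not> contact (forget_bdd A) a c \<and>
        \<not> contact (forget_bdd A) b (bcompl (forget_bdd A) c)"
      using d ab by (intro bexI[of _ "bcompl A d"]) (simp_all add: iso.iso_neg well_inside_def)
  next
    fix a assume a: "a \<in> carrier (forget_bdd A)" "a \<noteq> \<top>\<^bsub>forget_bdd A\<^esub>"
    then have "bcompl A a \<noteq> \<bottom>\<^bsub>A\<^esub>" by (simp add: iso.iso_top A.neg_eq_bot)
    then obtain b where "b \<in> carrier A" "b \<noteq> \<bottom>\<^bsub>A\<^esub>" "well_inside A b (bcompl A a)"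
      using A.BC3[of "bcompl A a"] A.neg_closed[of a] a(1) bdd by auto
    then show "\<exists>b\<in>carrier (forget_bdd A). b \<noteq> \<bottom>\<^bsub>forget_bdd A\<^esub> \<and> \<not> contact (forget_bdd A) b a"
      using a by (intro bexI[of _ b]) (simp_all add: iso.iso_bot well_inside_def)
  qed
  then show ?thesis
    using iso.complete_lattice_iso iso.connected_contact_iso[OF conn] by (simp add: DCCon_algebra_def)
qed

lemma DSke_hom_cong:
  assumes A: "contact_iso A A' (\<lambda>a. a)" "carrier A' = carrier A"
    and B: "contact_iso B B' (\<lambda>b. b)" "carrier B' = carrier B"
  shows "DSke_hom A' B' = DSke_hom A B"
proof -
  interpret A: contact_iso A A' "\<lambda>a. a" by (rule A(1))
  interpret B: contact_iso B B' "\<lambda>b. b" by (rule B(1))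
  have A': "\<Squnion>\<^bsub>A'\<^esub> S = \<Squnion>\<^bsub>A\<^esub> S" "\<Sqinter>\<^bsub>A'\<^esub> S = \<Sqinter>\<^bsub>A\<^esub> S" if "S \<subseteq> carrier A" for S
    using A.iso_sup[OF that] A.iso_inf[OF that] by simp_all
  have B': "\<Squnion>\<^bsub>B'\<^esub> (\<phi> ` S) = \<Squnion>\<^bsub>B\<^esub> (\<phi> ` S)" "\<Sqinter>\<^bsub>B'\<^esub> (\<phi> ` S) = \<Sqinter>\<^bsub>B\<^esub> (\<phi> ` S)"
    if "S \<subseteq> carrier A" "\<phi> \<in> carrier A \<rightarrow>\<^sub>E carrier B" for \<phi> S
  proof -
    have *: "\<phi> ` S \<subseteq> carrier B" using that by blast
    show "\<Squnion>\<^bsub>B'\<^esub> (\<phi> ` S) = \<Squnion>\<^bsub>B\<^esub> (\<phi> ` S)" "\<Sqinter>\<^bsub>B'\<^esub> (\<phi> ` S) = \<Sqinter>\<^bsub>B\<^esub> (\<phi> ` S)"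
      using B.iso_sup[OF *] B.iso_inf[OF *] by simp_all
  qed
  have "complete_boolean_hom A' B' \<phi> \<longleftrightarrow> complete_boolean_hom A B \<phi>" for \<phi>
    unfolding complete_boolean_hom_def sup_pres_def inf_pres_def
    using A.complete B.complete A.complete_lattice_iso B.complete_lattice_iso A(2) B(2) A' B'
    by (simp cong: conj_cong)
  moreover have "(contact B' (\<phi> a) (\<phi> b) \<longrightarrow> contact A' a b) \<longleftrightarrow> (contact B (\<phi> a) (\<phi> b) \<longrightarrow> contact A a b)"
    if "complete_boolean_hom A B \<phi>" "a \<in> carrier A" "b \<in> carrier A" for \<phi> a b
    using complete_boolean_homD(4)[OF that(1)] that A.contact_iff B.contact_iff by simp
  ultimately show ?thesis unfolding DSke_hom_def A(2) by (intro Collect_cong conj_cong ball_cong refl) auto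
qed

lemma DSkePer_hom_eq_DSke_hom:
  assumes A: "local_contact_algebra A" "bdd A = carrier A" and B: "local_contact_algebra B" "bdd B = carrier B"
  shows "DSkePer_hom A B = DSke_hom A B"
proof -
  interpret A: local_contact_algebra A by (rule A)
  interpret B: local_contact_algebra B by (rule B)
  have "\<exists>a\<in>bdd A. b \<sqsubseteq>\<^bsub>B\<^esub> \<phi> a" "a \<in> bdd A \<Longrightarrow> \<phi> a \<in> bdd B"
    if "\<phi> \<in> DSke_hom A B" "b \<in> bdd B" for \<phi> a b
  proof -
    have h: "complete_boolean_hom A B \<phi>" using that by (simp add: DSke_hom_def)
    show "\<exists>a\<in>bdd A. b \<sqsubseteq>\<^bsub>B\<^esub> \<phi> a"
      using that complete_boolean_hom_top[OF h] A B by (intro bexI[of _ "\<top>\<^bsub>A\<^esub>"]) auto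
    show "a \<in> bdd A \<Longrightarrow> \<phi> a \<in> bdd B" using complete_boolean_homD(4)[OF h] A B by simp
  qed
  then show ?thesis
    using A.bdd_bot B.bdd_bot by (auto simp: DSkePer_hom_iff[OF A(1) B(1)])
qed

lemma contact_iso_all_bounded: "DCCon_algebra B \<Longrightarrow> contact_iso B (all_bounded B) (\<lambda>b. b)"
  by (rule contact_iso_identity)
    (auto simp: DCCon_algebra_def normal_contact_algebra_def)

lemma DSke_hom_all_bounded:
  assumes A: "DCCon_algebra A" and B: "DCCon_algebra B"
  shows "DSkePer_hom (all_bounded A) (all_bounded B) = DSke_hom A B"
  using DSkePer_hom_eq_DSke_hom[of "all_bounded A" "all_bounded B"]
    DSke_hom_cong[OF contact_iso_all_bounded[OF A] _ contact_iso_all_bounded[OF B]]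
    DLCCon_local[OF all_bounded_DLCCon_algebra[OF A]] DLCCon_local[OF all_bounded_DLCCon_algebra[OF B]]
  by simp

lemma DSke_hom_forget_bdd:
  assumes "DLCCon_algebra A" "bdd A = carrier A" "DLCCon_algebra B" "bdd B = carrier B"
  shows "DSke_hom (forget_bdd A) (forget_bdd B) = DSkePer_hom A B"
  using DSke_hom_all_bounded[OF forget_bdd_DCCon_algebra[OF assms(1,2)] forget_bdd_DCCon_algebra[OF assms(3,4)]]
  by (simp add: all_bounded_forget assms)

lemma CCon_iff: "CCon_space X \<longleftrightarrow> LCCon_space X \<and> compact_space X"
  by (auto simp: CCon_space_def LCCon_space_def compact_imp_locally_compact_space)

lemma bdd_RCL_eq_carrier_iff: "bdd (RCL X) = carrier (RCL X) \<longleftrightarrow> compact_space X"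
proof
  assume "bdd (RCL X) = carrier (RCL X)"
  then show "compact_space X"
    using regular_closed_topspace[of X] by (auto simp: compact_space_def)
next
  assume "compact_space X"
  then show "bdd (RCL X) = carrier (RCL X)"
    by (auto intro: closedin_compact_space regular_closed_closedin)
qed

text \<open>
  If \<open>f\<close> is quasi-open and an open \<open>U \<subseteq> f\<^sup>-\<^sup>1 (cl V)\<close> is nonempty, then \<open>int (f ` U)\<close> meets \<open>cl V\<close>, hence
  \<open>V\<close>, so \<open>U\<close> meets \<open>f\<^sup>-\<^sup>1 V\<close>.  If \<open>f\<close> is skeletal, choose a nonempty regular closed \<open>F \<subseteq> U\<close>: its image
  is closed with a preimage of nonempty interior, so the image has nonempty interior too.
\<close>

lemma compact_QOpen_hom_eq:
  assumes X: "compact_space X" "Hausdorff_space X" and Y: "compact_space Y" "Hausdorff_space Y"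
  shows "QOpen_hom X Y = SkePer_hom X Y"
proof -
  let ?p = "\<lambda>f V. {x \<in> topspace X. f x \<in> V}"
  have "skeletal_map X Y f" if q: "quasi_open_map X Y f" for f
    unfolding skeletal_map_def
  proof (intro conjI allI impI)
    have c: "continuous_map X Y f" using q by (simp add: quasi_open_map_def)
    then show fXY: "f \<in> topspace X \<rightarrow> topspace Y" by (simp add: continuous_map_def)
    fix V assume V: "openin Y V"
    show "X interior_of ?p f (Y closure_of V) \<subseteq> X closure_of ?p f V"
    proof
      fix x assume x: "x \<in> X interior_of ?p f (Y closure_of V)"
      have "\<exists>y. y \<in> ?p f V \<and> y \<in> T" if T: "x \<in> T" "openin X T" for T
      proof -
        define U where "U = T \<inter> X interior_of ?p f (Y closure_of V)"
        have U: "openin X U" "U \<noteq> {}" using T x by (auto simp: U_def)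
        then have ne: "Y interior_of (f ` U) \<noteq> {}" using q by (simp add: quasi_open_map_def)
        have "f ` U \<subseteq> Y closure_of V"
          using interior_of_subset[of X "?p f (Y closure_of V)"] by (auto simp: U_def)
        then have "Y interior_of (f ` U) \<inter> Y closure_of V \<noteq> {}"
          using ne interior_of_subset[of Y "f ` U"] by blast
        then have "Y interior_of (f ` U) \<inter> V \<noteq> {}"
          using openin_Int_closure_of_eq_empty[OF openin_interior_of, of Y "f ` U" V] by simp
        then obtain u where "u \<in> U" "f u \<in> V" using interior_of_subset[of Y "f ` U"] by blast
        then show ?thesis using openin_subset[OF T(2)] by (auto simp: U_def)
      qed
      then show "x \<in> X closure_of ?p f V"
        using x interior_of_subset_topspace[of X "?p f (Y closure_of V)"] by (auto simp: in_closure_of)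
    qed
  qed
  moreover have "proper_map X Y f" if "continuous_map X Y f" for f
    using that X(1) Y(2) by (simp add: continuous_imp_proper_map Hausdorff_imp_kc_space)
  moreover have "quasi_open_map X Y f" if sk: "skeletal_map X Y f" and c: "continuous_map X Y f" for f
    unfolding quasi_open_map_def
  proof (intro conjI allI impI c; elim conjE)
    fix U assume U: "openin X U" "U \<noteq> {}"
    then obtain x where x: "x \<in> U" by blast
    obtain F where F: "F \<in> regular_closed X" "compactin X F" "x \<in> X interior_of F" "F \<subseteq> U"
      using regular_closed_nbhd_point[OF compact_imp_locally_compact_space[OF X(1)] X(2) U(1) x] .
    have D: "closedin Y (f ` F)"
      using image_compactin[OF F(2) c] Y(2) by (rule compactin_imp_closedin[rotated])
    have "F \<subseteq> ?p f (f ` F)" using regular_closed_subset[OF F(1)] by auto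
    then have "x \<in> X interior_of ?p f (f ` F)" using F(3) interior_of_mono by blast
    then have "X closure_of ?p f (Y interior_of (f ` F)) \<noteq> {}"
      using skeletal_preimage_closed[OF sk D] by blast
    then have "Y interior_of (f ` F) \<noteq> {}" by (metis (no_types, lifting) closure_of_empty empty_Collect_eq empty_iff)
    then show "Y interior_of (f ` U) \<noteq> {}"
      using interior_of_mono[OF image_mono[OF F(4)], of Y f] by blast
  qed
  moreover have "continuous_map X Y f" if "quasi_open_map X Y f" for f
    using that by (simp add: quasi_open_map_def)
  ultimately show ?thesis
    unfolding QOpen_hom_def SkePer_hom_def by blast
qed


section \<open>Equivalences of categories\<close>

definition fully_faithful where
  "fully_faithful C D F \<longleftrightarrow> (\<forall>X\<in>Obj C. \<forall>Y\<in>Obj C.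
     bij_betw (fmor F X Y) (Hom C X Y) (Hom D (fobj F X) (fobj F Y)))"

definition essentially_surjective where
  "essentially_surjective C D F \<longleftrightarrow> (\<forall>Z\<in>Obj D. \<exists>X\<in>Obj C. \<exists>e. is_iso D (fobj F X) Z e)"

lemma is_categoryD:
  assumes "is_category C"
  shows "X \<in> Obj C \<Longrightarrow> Ident C X \<in> Hom C X X"
    "\<lbrakk>X \<in> Obj C; Y \<in> Obj C; Z \<in> Obj C; f \<in> Hom C X Y; g \<in> Hom C Y Z\<rbrakk> \<Longrightarrow> Comp C X Y Z g f \<in> Hom C X Z"
    "\<lbrakk>X \<in> Obj C; Y \<in> Obj C; f \<in> Hom C X Y\<rbrakk> \<Longrightarrow> Comp C X X Y f (Ident C X) = f"
    "\<lbrakk>X \<in> Obj C; Y \<in> Obj C; f \<in> Hom C X Y\<rbrakk> \<Longrightarrow> Comp C X Y Y (Ident C Y) f = f"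
    "\<lbrakk>W \<in> Obj C; X \<in> Obj C; Y \<in> Obj C; Z \<in> Obj C; f \<in> Hom C W X; g \<in> Hom C X Y; h \<in> Hom C Y Z\<rbrakk>
      \<Longrightarrow> Comp C W X Z (Comp C X Y Z h g) f = Comp C W Y Z h (Comp C W X Y g f)"
  using assms unfolding is_category_def by blast+

lemma is_functorD:
  assumes "is_functor C D F"
  shows "X \<in> Obj C \<Longrightarrow> fobj F X \<in> Obj D"
    "\<lbrakk>X \<in> Obj C; Y \<in> Obj C; f \<in> Hom C X Y\<rbrakk> \<Longrightarrow> fmor F X Y f \<in> Hom D (fobj F X) (fobj F Y)"
    "X \<in> Obj C \<Longrightarrow> fmor F X X (Ident C X) = Ident D (fobj F X)"
    "\<lbrakk>X \<in> Obj C; Y \<in> Obj C; Z \<in> Obj C; f \<in> Hom C X Y; g \<in> Hom C Y Z\<rbrakk> \<Longrightarrow>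
       fmor F X Z (Comp C X Y Z g f) =
          Comp D (fobj F X) (fobj F Y) (fobj F Z) (fmor F Y Z g) (fmor F X Y f)"
  using assms unfolding is_functor_def by blast+

text \<open>
  The inverse functor sends \<open>Z\<close> to a chosen \<open>g Z\<close> with an isomorphism \<open>e Z\<close> from \<open>F (g Z)\<close> to \<open>Z\<close>, and
  \<open>m\<close> to the unique morphism that \<open>F\<close> sends to the conjugate \<open>K Z W m\<close> of \<open>m\<close> by these isomorphisms.
  All equations between morphisms of \<open>C\<close> are checked after applying \<open>F\<close>.
\<close>

theorem equivalent_categoriesI:
  assumes C: "is_category C" and D: "is_category D" and F: "is_functor C D F"
    and ff: "fully_faithful C D F" and es: "essentially_surjective C D F"
  shows "equivalent_categories C D"
proof -
  note cC = is_categoryD[OF C] and cD = is_categoryD[OF D] and cF = is_functorD[OF F]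
  have "\<forall>Z\<in>Obj D. \<exists>X e e'. X \<in> Obj C \<and> e \<in> Hom D (fobj F X) Z \<and> e' \<in> Hom D Z (fobj F X) \<and>
      Comp D (fobj F X) Z (fobj F X) e' e = Ident D (fobj F X) \<and>
      Comp D Z (fobj F X) Z e e' = Ident D Z"
    using es unfolding essentially_surjective_def is_iso_def by blast
  then obtain g e e' where g: "\<And>Z. Z \<in> Obj D \<Longrightarrow> g Z \<in> Obj C"
    and e: "\<And>Z. Z \<in> Obj D \<Longrightarrow> e Z \<in> Hom D (fobj F (g Z)) Z"
    and e': "\<And>Z. Z \<in> Obj D \<Longrightarrow> e' Z \<in> Hom D Z (fobj F (g Z))"
    and e'e: "\<And>Z. Z \<in> Obj D \<Longrightarrow> Comp D (fobj F (g Z)) Z (fobj F (g Z)) (e' Z) (e Z) = Ident D (fobj F (g Z))"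
    and ee': "\<And>Z. Z \<in> Obj D \<Longrightarrow> Comp D Z (fobj F (g Z)) Z (e Z) (e' Z) = Ident D Z"
    by metis
  define lift where "lift X Y m = inv_into (Hom C X Y) (fmor F X Y) m" for X Y m
  have lift: "lift X Y m \<in> Hom C X Y" "fmor F X Y (lift X Y m) = m"
    if "X \<in> Obj C" "Y \<in> Obj C" "m \<in> Hom D (fobj F X) (fobj F Y)" for X Y m
  proof -
    have "m \<in> fmor F X Y ` Hom C X Y"
      using ff that unfolding fully_faithful_def bij_betw_def by blast
    then show "lift X Y m \<in> Hom C X Y" "fmor F X Y (lift X Y m) = m"
      unfolding lift_def by (auto intro: inv_into_into f_inv_into_f)
  qed
  have faithful: "f = f'" if "X \<in> Obj C" "Y \<in> Obj C" "f \<in> Hom C X Y" "f' \<in> Hom C X Y"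
    "fmor F X Y f = fmor F X Y f'" for X Y f f'
    using ff that unfolding fully_faithful_def bij_betw_def inj_on_def by blast
  have ee'x: "Comp D Y (fobj F (g W)) W (e W) (Comp D Y W (fobj F (g W)) (e' W) x) = x"
    if "Y \<in> Obj D" "W \<in> Obj D" "x \<in> Hom D Y W" for Y W x
  proof -
    have "Comp D Y (fobj F (g W)) W (e W) (Comp D Y W (fobj F (g W)) (e' W) x)
        = Comp D Y W W (Comp D W (fobj F (g W)) W (e W) (e' W)) x"
      using that g e e' cF(1) by (intro cD(5)[symmetric]) auto
    then show ?thesis using that ee' cD(4) by simp
  qed
  define K where "K Z W m = Comp D (fobj F (g Z)) W (fobj F (g W)) (e' W) (Comp D (fobj F (g Z)) Z W m (e Z))" for Z W m
  have K: "K Z W m \<in> Hom D (fobj F (g Z)) (fobj F (g W))"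
    if "Z \<in> Obj D" "W \<in> Obj D" "m \<in> Hom D Z W" for Z W m
    unfolding K_def using that g e e' cF(1) by (intro cD(2)) auto
  have K_id: "K Z Z (Ident D Z) = Ident D (fobj F (g Z))" if "Z \<in> Obj D" for Z
    unfolding K_def using that g e e' cF(1) e'e cD(4) by simp
  have K_comp: "K Z V (Comp D Z W V n m) = Comp D (fobj F (g Z)) (fobj F (g W)) (fobj F (g V)) (K W V n) (K Z W m)"
    if "Z \<in> Obj D" "W \<in> Obj D" "V \<in> Obj D" "m \<in> Hom D Z W" "n \<in> Hom D W V" for Z W V m n
    unfolding K_def using that g e e' cF(1) by (simp add: cD(2,5) ee'x)
  have eK: "Comp D (fobj F (g Z)) (fobj F (g W)) W (e W) (K Z W m) = Comp D (fobj F (g Z)) Z W m (e Z)"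
    if "Z \<in> Obj D" "W \<in> Obj D" "m \<in> Hom D Z W" for Z W m
    unfolding K_def using that g e cF(1) by (intro ee'x cD(2)) auto
  have Ke': "Comp D Z (fobj F (g Z)) (fobj F (g W)) (K Z W m) (e' Z) = Comp D Z W (fobj F (g W)) (e' W) m"
    if "Z \<in> Obj D" "W \<in> Obj D" "m \<in> Hom D Z W" for Z W m
    unfolding K_def using that g e e' cF(1) by (simp add: cD(2,3,5) ee')
  define G where "G = \<lparr> fobj = g, fmor = (\<lambda>Z W m. lift (g Z) (g W) (K Z W m)) \<rparr>"
  have G: "is_functor D C G"
    unfolding is_functor_def G_def functr.simps
  proof (intro conjI ballI)
    show "lift (g Z) (g Z) (K Z Z (Ident D Z)) = Ident C (g Z)" if "Z \<in> Obj D" for Z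
      using that g cC(1) cF lift by (intro faithful[of "g Z" "g Z"]) (simp_all add: K_id cD(1))
    fix Z W V m n assume a: "Z \<in> Obj D" "W \<in> Obj D" "V \<in> Obj D" "m \<in> Hom D Z W" "n \<in> Hom D W V"
    show "lift (g Z) (g V) (K Z V (Comp D Z W V n m)) =
       Comp C (g Z) (g W) (g V) (lift (g W) (g V) (K W V n)) (lift (g Z) (g W) (K Z W m))"
      using a g K lift cD(2) cC(2) cF(1) by (intro faithful[of "g Z" "g V"]) (simp_all add: K_comp cF(4))
  qed (use g K lift in auto)
  have "naturally_isomorphic C C id_functor (comp_functor G F)"
    unfolding naturally_isomorphic_def
  proof (intro exI[of _ "\<lambda>X. lift X (g (fobj F X)) (e' (fobj F X))"] conjI ballI)
    fix X assume X: "X \<in> Obj C"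
    let ?Y = "g (fobj F X)"
    have Y: "?Y \<in> Obj C" "fobj F X \<in> Obj D" using X g cF(1) by auto
    note t = lift[OF X Y(1) e'[OF Y(2)]] and s = lift[OF Y(1) X e[OF Y(2)]]
    have "Comp C X ?Y X (lift ?Y X (e (fobj F X))) (lift X ?Y (e' (fobj F X))) = Ident C X"
      using X Y t s cC(1,2) by (intro faithful[of X X]) (simp_all add: cF(3,4) ee')
    moreover have "Comp C ?Y X ?Y (lift X ?Y (e' (fobj F X))) (lift ?Y X (e (fobj F X))) = Ident C ?Y"
      using X Y t s cC(1,2) by (intro faithful[of ?Y ?Y]) (simp_all add: cF(3,4) e'e)
    ultimately show "is_iso C (fobj id_functor X) (fobj (comp_functor G F) X) (lift X ?Y (e' (fobj F X)))"
      using t s unfolding is_iso_def id_functor_def comp_functor_def G_def by auto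
  next
    fix X Y f assume a: "X \<in> Obj C" "Y \<in> Obj C" "f \<in> Hom C X Y"
    let ?gX = "g (fobj F X)" and ?gY = "g (fobj F Y)"
    have o: "fobj F X \<in> Obj D" "fobj F Y \<in> Obj D" "?gX \<in> Obj C" "?gY \<in> Obj C" using a g cF(1) by auto
    have Ff: "fmor F X Y f \<in> Hom D (fobj F X) (fobj F Y)" using a cF(2) by blast
    note t = lift[OF a(1) o(3) e'[OF o(1)]] and s = lift[OF a(2) o(4) e'[OF o(2)]]
      and k = lift[OF o(3,4) K[OF o(1,2) Ff]]
    have "Comp C X Y ?gY (lift Y ?gY (e' (fobj F Y))) f =
        Comp C X ?gX ?gY (lift ?gX ?gY (K (fobj F X) (fobj F Y) (fmor F X Y f))) (lift X ?gX (e' (fobj F X)))"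
      using a o t s k Ff cC(2) by (intro faithful[of X ?gY]) (simp_all add: cF(4) Ke')
    then show "Comp C (fobj id_functor X) (fobj id_functor Y) (fobj (comp_functor G F) Y)
        (lift Y ?gY (e' (fobj F Y))) (fmor id_functor X Y f) =
      Comp C (fobj id_functor X) (fobj (comp_functor G F) X) (fobj (comp_functor G F) Y)
        (fmor (comp_functor G F) X Y f) (lift X ?gX (e' (fobj F X)))"
      by (simp add: id_functor_def comp_functor_def G_def)
  qed
  moreover have "naturally_isomorphic D D (comp_functor F G) id_functor"
    unfolding naturally_isomorphic_def
  proof (intro exI[of _ e] conjI ballI)
    fix Z assume Z: "Z \<in> Obj D"
    then show "is_iso D (fobj (comp_functor F G) Z) (fobj id_functor Z) (e Z)"
      using e e' e'e ee' unfolding is_iso_def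
      by (auto simp: id_functor_def comp_functor_def G_def intro!: bexI[of _ "e' Z"])
  next
    fix Z W m assume a: "Z \<in> Obj D" "W \<in> Obj D" "m \<in> Hom D Z W"
    then show "Comp D (fobj (comp_functor F G) Z) (fobj (comp_functor F G) W) (fobj id_functor W) (e W)
        (fmor (comp_functor F G) Z W m) =
      Comp D (fobj (comp_functor F G) Z) (fobj id_functor Z) (fobj id_functor W) (fmor id_functor Z W m) (e Z)"
      using lift(2)[OF g[OF a(1)] g[OF a(2)] K[OF a]] eK[OF a]
      by (simp add: id_functor_def comp_functor_def G_def)
  qed
  ultimately show ?thesis unfolding equivalent_categories_def using C D F G by blast
qed


section \<open>Copies inside a universe\<close>

text \<open>
  Unlike \<open>DSkePer_iso\<close>, this names the two homomorphisms and states their equations pointwise.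
\<close>

definition inverse_homs where
  "inverse_homs A B i j \<longleftrightarrow> i \<in> DSkePer_hom A B \<and> j \<in> DSkePer_hom B A \<and>
     (\<forall>a\<in>carrier A. j (i a) = a) \<and> (\<forall>b\<in>carrier B. i (j b) = b)"

lemma DSkePer_hom_closed: "\<lbrakk>\<phi> \<in> DSkePer_hom A B; a \<in> carrier A\<rbrakk> \<Longrightarrow> \<phi> a \<in> carrier B"
  using DSkePer_hom_PiE by blast

lemma compose_eq_ident_iff:
  "compose A g f = (\<lambda>a\<in>A. a) \<longleftrightarrow> (\<forall>a\<in>A. g (f a) = a)"
  by (auto simp: compose_def fun_eq_iff restrict_def)

lemma DSkePer_iso_iff: "DSkePer_iso A B \<longleftrightarrow> (\<exists>i j. inverse_homs A B i j)"
  unfolding DSkePer_iso_def inverse_homs_def compose_eq_ident_iff by blast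

lemma inverse_homs_trans:
  assumes "local_contact_algebra A" "local_contact_algebra B" "local_contact_algebra C"
    and ij: "inverse_homs A B i j" and kl: "inverse_homs B C k l"
  shows "inverse_homs A C (compose (carrier A) k i) (compose (carrier C) j l)"
  using assms DSkePer_hom_compose[of A B C i k] DSkePer_hom_compose[of C B A l j]
    DSkePer_hom_closed[of i A B] DSkePer_hom_closed[of l C B] DSkePer_hom_closed[of j B A]
    DSkePer_hom_closed[of k B C]
  unfolding inverse_homs_def by (auto simp: compose_def)

lemma DSkePer_iso_trans:
  "\<lbrakk>local_contact_algebra A; local_contact_algebra B; local_contact_algebra C;
    DSkePer_iso A B; DSkePer_iso B C\<rbrakk> \<Longrightarrow> DSkePer_iso A C"
  unfolding DSkePer_iso_iff using inverse_homs_trans by blast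

lemma conjugation_in_DSkePer_hom:
  assumes "local_contact_algebra A" "local_contact_algebra B" "local_contact_algebra A'" "local_contact_algebra B'"
    and "j \<in> DSkePer_hom A' A" "\<phi> \<in> DSkePer_hom A B" "k \<in> DSkePer_hom B B'"
  shows "(\<lambda>a\<in>carrier A'. k (\<phi> (j a))) \<in> DSkePer_hom A' B'"
proof -
  have "compose (carrier A') (compose (carrier A) k \<phi>) j \<in> DSkePer_hom A' B'"
    using assms by (meson DSkePer_hom_compose)
  also have "compose (carrier A') (compose (carrier A) k \<phi>) j = (\<lambda>a\<in>carrier A'. k (\<phi> (j a)))"
    using DSkePer_hom_closed[OF assms(5)] by (auto simp: compose_def restrict_def)
  finally show ?thesis .
qed

lemma conjugation_bij_betw:
  assumes l: "local_contact_algebra A" "local_contact_algebra B" "local_contact_algebra A'" "local_contact_algebra B'"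
    and A: "inverse_homs A A' i j" and B: "inverse_homs B B' k l"
  shows "bij_betw (\<lambda>\<phi>. \<lambda>a\<in>carrier A'. k (\<phi> (j a))) (DSkePer_hom A B) (DSkePer_hom A' B')"
proof (rule bij_betw_byWitness[where f' = "\<lambda>\<psi>. \<lambda>a\<in>carrier A. l (\<psi> (i a))"])
  have i: "i \<in> DSkePer_hom A A'" "j \<in> DSkePer_hom A' A" and ij: "\<And>a. a \<in> carrier A \<Longrightarrow> j (i a) = a"
    "\<And>a. a \<in> carrier A' \<Longrightarrow> i (j a) = a" using A by (auto simp: inverse_homs_def)
  have k: "k \<in> DSkePer_hom B B'" "l \<in> DSkePer_hom B' B" and kl: "\<And>b. b \<in> carrier B \<Longrightarrow> l (k b) = b"
    "\<And>b. b \<in> carrier B' \<Longrightarrow> k (l b) = b" using B by (auto simp: inverse_homs_def)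
  note cl = DSkePer_hom_closed[OF i(1)] DSkePer_hom_closed[OF i(2)]
  show "\<forall>\<phi>\<in>DSkePer_hom A B. (\<lambda>a\<in>carrier A. l ((\<lambda>a\<in>carrier A'. k (\<phi> (j a))) (i a))) = \<phi>"
  proof
    fix \<phi> assume p: "\<phi> \<in> DSkePer_hom A B"
    then have "\<phi> \<in> carrier A \<rightarrow>\<^sub>E carrier B" by (rule DSkePer_hom_PiE)
    then show "(\<lambda>a\<in>carrier A. l ((\<lambda>a\<in>carrier A'. k (\<phi> (j a))) (i a))) = \<phi>"
      using cl ij kl by (intro extensionalityI[of _ "carrier A"]) (auto simp: PiE_iff)
  qed
  show "\<forall>\<psi>\<in>DSkePer_hom A' B'. (\<lambda>a\<in>carrier A'. k ((\<lambda>a\<in>carrier A. l (\<psi> (i a))) (j a))) = \<psi>"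
  proof
    fix \<psi> assume p: "\<psi> \<in> DSkePer_hom A' B'"
    then have "\<psi> \<in> carrier A' \<rightarrow>\<^sub>E carrier B'" by (rule DSkePer_hom_PiE)
    then show "(\<lambda>a\<in>carrier A'. k ((\<lambda>a\<in>carrier A. l (\<psi> (i a))) (j a))) = \<psi>"
      using cl ij kl by (intro extensionalityI[of _ "carrier A'"]) (auto simp: PiE_iff)
  qed
  show "(\<lambda>\<phi>. \<lambda>a\<in>carrier A'. k (\<phi> (j a))) ` DSkePer_hom A B \<subseteq> DSkePer_hom A' B'"
    using conjugation_in_DSkePer_hom[OF l i(2) _ k(1)] by blast
  show "(\<lambda>\<psi>. \<lambda>a\<in>carrier A. l (\<psi> (i a))) ` DSkePer_hom A' B' \<subseteq> DSkePer_hom A B"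
    using conjugation_in_DSkePer_hom[OF l(3,4,1,2) i(1) _ k(2)] by blast
qed

definition transport_algebra :: "('a \<Rightarrow> 'b) \<Rightarrow> 'a local_contact_algebra \<Rightarrow> 'b local_contact_algebra" where
  "transport_algebra h A =
     \<lparr> carrier = h ` carrier A, eq = (=),
       le = (\<lambda>x y. inv_into (carrier A) h x \<sqsubseteq>\<^bsub>A\<^esub> inv_into (carrier A) h y),
       contact = (\<lambda>x y. contact A (inv_into (carrier A) h x) (inv_into (carrier A) h y)),
       bdd = h ` bdd A \<rparr>"

lemma
  assumes A: "DLCCon_algebra A" and h: "inj_on h (carrier A)"
  shows transport_DLCCon_algebra: "DLCCon_algebra (transport_algebra h A)"
    and transport_DSkePer_iso: "DSkePer_iso A (transport_algebra h A)"
    and transport_bdd: "bdd (transport_algebra h A) = carrier (transport_algebra h A) \<longleftrightarrow> bdd A = carrier A"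
proof -
  have l: "local_contact_algebra A" using A by (rule DLCCon_local)
  interpret local_contact_algebra A by (rule l)
  have iso: "contact_iso A (transport_algebra h A) h"
    by (rule contact_iso.intro)
      (use A h contact_algebra_axioms in \<open>auto simp: transport_algebra_def DLCCon_algebra_def bij_betw_def\<close>)
  have bdd: "h a \<in> bdd (transport_algebra h A) \<longleftrightarrow> a \<in> bdd A" if "a \<in> carrier A" for a
    using that h bdd_sub by (simp add: transport_algebra_def inj_on_image_mem_iff)
  have l': "local_contact_algebra (transport_algebra h A)"
    by (rule local_contact_algebra_iso[OF iso l _ bdd])
      (use bdd_sub in \<open>auto simp: transport_algebra_def\<close>)
  show "DLCCon_algebra (transport_algebra h A)"
    using A l' contact_iso.complete_lattice_iso[OF iso] contact_iso.connected_contact_iso[OF iso]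
    by (simp add: DLCCon_algebra_def)
  show "DSkePer_iso A (transport_algebra h A)"
    by (rule contact_iso_imp_DSkePer_iso[OF iso l l' bdd])
  show "bdd (transport_algebra h A) = carrier (transport_algebra h A) \<longleftrightarrow> bdd A = carrier A"
    using inj_on_image_eq_iff[OF h bdd_sub] by (simp add: transport_algebra_def)
qed

text \<open>
  If \<open>f x \<in> cl V\<close>, then the open image of any neighbourhood of \<open>x\<close> meets \<open>V\<close>.
\<close>

lemma continuous_open_map_skeletal:
  assumes f: "continuous_map X Y f" "open_map X Y f"
  shows "skeletal_map X Y f"
  unfolding skeletal_map_def
proof (intro conjI allI impI)
  show "f \<in> topspace X \<rightarrow> topspace Y" using f(1) by (simp add: continuous_map_def)
  fix V assume V: "openin Y V"
  let ?p = "\<lambda>V. {x \<in> topspace X. f x \<in> V}"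
  show "X interior_of ?p (Y closure_of V) \<subseteq> X closure_of ?p V"
  proof
    fix x assume x: "x \<in> X interior_of ?p (Y closure_of V)"
    then have xX: "x \<in> topspace X" and fx: "f x \<in> Y closure_of V"
      using interior_of_subset[of X "?p (Y closure_of V)"] by auto
    have "\<exists>y. y \<in> ?p V \<and> y \<in> T" if T: "x \<in> T" "openin X T" for T
    proof -
      have "openin Y (f ` T)" using f(2) T(2) by (simp add: open_map_def)
      then obtain y where "y \<in> V" "y \<in> f ` T" using fx T(1) unfolding in_closure_of by blast
      then show ?thesis using openin_subset[OF T(2)] by auto
    qed
    then show "x \<in> X closure_of ?p V" using xX by (auto simp: in_closure_of)
  qed
qed

lemma homeomorphic_in_SkePer_hom:
  assumes "homeomorphic_map X Y f"
  shows "(\<lambda>x\<in>topspace X. f x) \<in> SkePer_hom X Y"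
proof -
  let ?f = "\<lambda>x\<in>topspace X. f x"
  have "homeomorphic_map X Y ?f" by (rule homeomorphic_map_eq[OF assms]) simp
  then have f: "continuous_map X Y ?f" "open_map X Y ?f" "proper_map X Y ?f"
    by (simp_all add: homeomorphic_imp_continuous_map homeomorphic_imp_open_map homeomorphic_imp_proper_map)
  then show ?thesis
    using continuous_open_map_skeletal[OF f(1,2)]
    by (simp add: SkePer_hom_def PiE_def continuous_map_def)
qed

text \<open>
  Functoriality of \<open>RC_map\<close> turns the equations between the homeomorphisms into equations between
  the homomorphisms.
\<close>

lemma homeomorphic_DSkePer_iso:
  assumes X: "LCCon_space X" and Y: "LCCon_space Y" and fg: "homeomorphic_maps X Y f g"
  shows "DSkePer_iso (RCL X) (RCL Y)"
proof -
  let ?f = "\<lambda>x\<in>topspace X. f x" and ?g = "\<lambda>y\<in>topspace Y. g y"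
  have f: "?f \<in> SkePer_hom X Y" and g: "?g \<in> SkePer_hom Y X"
    using fg homeomorphic_in_SkePer_hom homeomorphic_maps_map by blast+
  have cf: "skeletal_map X Y ?f" "continuous_map X Y ?f" and cg: "skeletal_map Y X ?g" "continuous_map Y X ?g"
    using f g by (auto simp: SkePer_hom_def)
  have "f x \<in> topspace Y" "g (f x) = x" if "x \<in> topspace X" for x
    using fg that by (auto simp: homeomorphic_maps_def continuous_map_def Pi_iff)
  then have gf: "compose (topspace X) ?g ?f = (\<lambda>x\<in>topspace X. x)"
    by (simp add: compose_eq_ident_iff)
  have "g y \<in> topspace X" "f (g y) = y" if "y \<in> topspace Y" for y
    using fg that by (auto simp: homeomorphic_maps_def continuous_map_def Pi_iff)
  then have fg': "compose (topspace Y) ?f ?g = (\<lambda>y\<in>topspace Y. y)"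
    by (simp add: compose_eq_ident_iff)
  have h: "RC_map X Y ?f \<in> DSkePer_hom (RCL Y) (RCL X)" "RC_map Y X ?g \<in> DSkePer_hom (RCL X) (RCL Y)"
    using f g X Y by (auto simp: LCCon_space_def intro!: RC_map_in_DSkePer_hom)
  have "compose (carrier (RCL X)) (RC_map X Y ?f) (RC_map Y X ?g) = (\<lambda>F\<in>carrier (RCL X). F)"
    using RC_map_compose[OF cf cg(2)] RC_map_ident[of X] by (simp add: gf)
  moreover have "compose (carrier (RCL Y)) (RC_map Y X ?g) (RC_map X Y ?f) = (\<lambda>F\<in>carrier (RCL Y). F)"
    using RC_map_compose[OF cg cf(2)] RC_map_ident[of Y] by (simp add: fg')
  ultimately show ?thesis unfolding DSkePer_iso_def using h by blast
qed

lemma homeomorphic_copy: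
  assumes h: "inj_on h (topspace X)"
  obtains Y g where "topspace Y = h ` topspace X" "homeomorphic_maps X Y h g"
proof -
  define g where "g = inv_into (topspace X) h"
  define Y where "Y = pullback_topology (h ` topspace X) g X"
  have gh: "g (h x) = x" if "x \<in> topspace X" for x using h that by (simp add: g_def)
  have top: "topspace Y = h ` topspace X"
    by (auto simp: Y_def topspace_pullback_topology gh)
  have "continuous_map Y X g"
    unfolding continuous_map_def
  proof (intro conjI allI impI)
    show "g \<in> topspace Y \<rightarrow> topspace X" by (auto simp: top gh)
    fix U assume "openin X U"
    moreover have "{y \<in> topspace Y. g y \<in> U} = g -` U \<inter> h ` topspace X" by (auto simp: top)
    ultimately show "openin Y {y \<in> topspace Y. g y \<in> U}"
      unfolding Y_def openin_pullback_topology by blast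
  qed
  moreover have "continuous_map X Y h"
    unfolding continuous_map_def
  proof (intro conjI allI impI)
    show "h \<in> topspace X \<rightarrow> topspace Y" by (auto simp: top)
    fix V assume "openin Y V"
    then obtain U where U: "openin X U" "V = g -` U \<inter> h ` topspace X"
      unfolding Y_def openin_pullback_topology by blast
    have "{x \<in> topspace X. h x \<in> V} = U" using openin_subset[OF U(1)] by (auto simp: U(2) gh dest: inj_onD[OF h])
    then show "openin X {x \<in> topspace X. h x \<in> V}" using U(1) by simp
  qed
  ultimately have "homeomorphic_maps X Y h g" by (auto simp: homeomorphic_maps_def top gh)
  with top that show thesis by blast
qed

lemma universe_subset: "\<lbrakk>universe S; S X; Y \<subseteq> X\<rbrakk> \<Longrightarrow> S Y"
  by (auto simp: universe_def)

text \<open>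
  One injection works for all sets of subsets of \<open>X\<close>, since it can be taken into a copy of the power set.
\<close>

lemma universe_encoding:
  assumes S: "universe S" "S X"
  shows "\<exists>h. inj_on h (Pow X) \<and> (\<forall>R. R \<subseteq> Pow X \<longrightarrow> S (h ` R))"
proof -
  obtain Y where Y: "S Y" "Y \<approx> Pow X" using S by (auto simp: universe_def)
  then obtain h where h: "bij_betw h (Pow X) Y" using eqpoll_sym unfolding eqpoll_def by metis
  have "S (h ` R)" if "R \<subseteq> Pow X" for R
  proof -
    have "h ` R \<subseteq> Y" using h that unfolding bij_betw_def by blast
    then show ?thesis by (rule universe_subset[OF S(1) Y(1)])
  qed
  then show ?thesis using bij_betw_imp_inj_on[OF h] by blast
qed


section \<open>The duality\<close>

text \<open>
  The functor sends \<open>X\<close> to a copy \<open>A X\<close> of \<open>RCL X\<close> in the universe, and \<open>f\<close> to the conjugate of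
  \<open>RC_map X Y f\<close> by the isomorphisms onto the copies.  It is fully faithful because \<open>RC_map\<close> is bijective on
  hom-sets.  It hits every algebra up to isomorphism because the space of clusters is a set of
  subsets of the algebra, and so has a copy in the universe.  The last clause lets the same functor
  serve for compact spaces.
\<close>

lemma duality_functor:
  assumes S: "universe S"
  obtains F where "is_functor (SkePerLCCon S) (opposite (DSkePerLCCon S)) F"
    "fully_faithful (SkePerLCCon S) (opposite (DSkePerLCCon S)) F"
    "essentially_surjective (SkePerLCCon S) (opposite (DSkePerLCCon S)) F"
    "\<And>X. X \<in> Obj (SkePerLCCon S) \<Longrightarrow> bdd (fobj F X) = carrier (fobj F X) \<longleftrightarrow> compact_space X"
proof -
  define P where "P X \<longleftrightarrow> LCCon_space X \<and> S (topspace X)" for X :: "'a topology"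
  have "\<exists>h. inj_on h (regular_closed X) \<and> S (h ` regular_closed X)" if X: "P X" for X
  proof -
    have "S (topspace X)" using X by (simp add: P_def)
    then obtain h where h: "inj_on h (Pow (topspace X))" "\<And>R. R \<subseteq> Pow (topspace X) \<Longrightarrow> S (h ` R)"
      using universe_encoding[OF S] by metis
    have "regular_closed X \<subseteq> Pow (topspace X)" using regular_closed_subset by blast
    then show ?thesis using h(2) inj_on_subset[OF h(1)] by blast
  qed
  then obtain h where h: "\<And>X. P X \<Longrightarrow> inj_on (h X) (regular_closed X)"
    "\<And>X. P X \<Longrightarrow> S (h X ` regular_closed X)" by metis
  define A where "A X = transport_algebra (h X) (RCL X)" for X
  have R: "DLCCon_algebra (RCL X)" if "P X" for X
    using that by (intro RCL_DLCCon_algebra) (simp add: P_def)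
  have A: "DLCCon_algebra (A X)" "S (carrier (A X))" "DSkePer_iso (RCL X) (A X)"
    "bdd (A X) = carrier (A X) \<longleftrightarrow> bdd (RCL X) = carrier (RCL X)" if X: "P X" for X
  proof -
    have inj: "inj_on (h X) (carrier (RCL X))" using h(1)[OF X] by simp
    show "DLCCon_algebra (A X)" "DSkePer_iso (RCL X) (A X)"
      "bdd (A X) = carrier (A X) \<longleftrightarrow> bdd (RCL X) = carrier (RCL X)"
      unfolding A_def using transport_DLCCon_algebra[OF R[OF X] inj] transport_DSkePer_iso[OF R[OF X] inj]
        transport_bdd[OF R[OF X] inj] by blast+
    show "S (carrier (A X))" using h(2)[OF X] by (simp add: A_def transport_algebra_def)
  qed
  have RL: "local_contact_algebra (RCL X)" and AL: "local_contact_algebra (A X)" if "P X" for X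
    using R[OF that] A(1)[OF that] by (auto intro: DLCCon_local)
  have "\<forall>X. P X \<longrightarrow> (\<exists>i j. inverse_homs (RCL X) (A X) i j)"
    using A(3) unfolding DSkePer_iso_iff by blast
  then obtain i j where ij: "\<And>X. P X \<Longrightarrow> inverse_homs (RCL X) (A X) (i X) (j X)"
    by metis
  define F where "F = \<lparr> fobj = A, fmor = (\<lambda>X Y f. \<lambda>a\<in>carrier (A Y). i X (RC_map X Y f (j Y a))) \<rparr>"
  have F [simp]: "fobj F = A" "fmor F = (\<lambda>X Y f. \<lambda>a\<in>carrier (A Y). i X (RC_map X Y f (j Y a)))"
    by (simp_all add: F_def)
  have C [simp]: "Obj (SkePerLCCon S) = {X. P X}" "Hom (SkePerLCCon S) = SkePer_hom"
    "Ident (SkePerLCCon S) X = (\<lambda>x\<in>topspace X. x)" "Comp (SkePerLCCon S) X Y Z g f = compose (topspace X) g f"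
    for X Y Z :: "'a topology" and g f
    by (simp_all add: SkePerLCCon_def P_def)
  have D [simp]: "Obj (opposite (DSkePerLCCon S)) = {B. DLCCon_algebra B \<and> S (carrier B)}"
    "Hom (opposite (DSkePerLCCon S)) B B' = DSkePer_hom B' B"
    "Ident (opposite (DSkePerLCCon S)) B = (\<lambda>a\<in>carrier B. a)"
    "Comp (opposite (DSkePerLCCon S)) B B' B'' g f = compose (carrier B'') f g"
    for B B' B'' :: "'a local_contact_algebra" and g f
    by (simp_all add: opposite_def DSkePerLCCon_def)
  have ff: "bij_betw (fmor F X Y) (SkePer_hom X Y) (DSkePer_hom (A Y) (A X))" if "P X" "P Y" for X Y
  proof -
    have "bij_betw (RC_map X Y) (SkePer_hom X Y) (DSkePer_hom (RCL Y) (RCL X))"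
      using that by (intro RC_map_bij_betw) (simp_all add: P_def)
    from bij_betw_trans[OF this conjugation_bij_betw[OF RL RL AL AL ij ij]] that
    show ?thesis by (simp add: comp_def)
  qed
  have iji: "j X (i X a) = a" if "P X" "a \<in> carrier (RCL X)" for X a
    using ij[OF that(1)] that(2) by (simp add: inverse_homs_def)
  have jij: "i X (j X a) = a" if "P X" "a \<in> carrier (A X)" for X a
    using ij[OF that(1)] that(2) by (simp add: inverse_homs_def)
  have j: "j X a \<in> regular_closed X" if "P X" "a \<in> carrier (A X)" for X a
    using ij[OF that(1)] that(2) DSkePer_hom_closed[of "j X" "A X" "RCL X" a] by (simp add: inverse_homs_def)
  have i: "i X a \<in> carrier (A X)" if "P X" "a \<in> regular_closed X" for X a
    using ij[OF that(1)] that(2) DSkePer_hom_closed[of "i X" "RCL X" "A X" a] by (simp add: inverse_homs_def)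
  have "is_functor (SkePerLCCon S) (opposite (DSkePerLCCon S)) F"
    unfolding is_functor_def
  proof (intro conjI ballI)
    fix X Y f assume "X \<in> Obj (SkePerLCCon S)" "Y \<in> Obj (SkePerLCCon S)" "f \<in> Hom (SkePerLCCon S) X Y"
    then show "fmor F X Y f \<in> Hom (opposite (DSkePerLCCon S)) (fobj F X) (fobj F Y)"
      using ff[of X Y] by (auto simp: bij_betw_def)
  next
    fix X assume X: "X \<in> Obj (SkePerLCCon S)"
    then show "fobj F X \<in> Obj (opposite (DSkePerLCCon S))" using A by simp
    show "fmor F X X (Ident (SkePerLCCon S) X) = Ident (opposite (DSkePerLCCon S)) (fobj F X)"
      using X j jij by (simp add: RC_map_ident cong: restrict_cong)
  next
    fix X Y Z f g assume a: "X \<in> Obj (SkePerLCCon S)" "Y \<in> Obj (SkePerLCCon S)" "Z \<in> Obj (SkePerLCCon S)"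
      "f \<in> Hom (SkePerLCCon S) X Y" "g \<in> Hom (SkePerLCCon S) Y Z"
    then have f: "skeletal_map X Y f" "continuous_map X Y f" and g: "continuous_map Y Z g"
      by (auto simp: SkePer_hom_def)
    have "i X (RC_map X Z (compose (topspace X) g f) (j Z b)) =
        i X (RC_map X Y f (j Y (i Y (RC_map Y Z g (j Z b)))))" if b: "b \<in> carrier (A Z)" for b
      using a b j[of Z b] RC_map_regular_closed[OF g, of "j Z b"] iji[of Y]
      by (simp add: RC_map_compose[OF f g] compose_eq)
    moreover have "i Y (RC_map Y Z g (j Z b)) \<in> carrier (A Y)" if b: "b \<in> carrier (A Z)" for b
      using a b j[of Z b] RC_map_regular_closed[OF g, of "j Z b"] i[of Y] by simp
    ultimately show "fmor F X Z (Comp (SkePerLCCon S) X Y Z g f) =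
        Comp (opposite (DSkePerLCCon S)) (fobj F X) (fobj F Y) (fobj F Z) (fmor F Y Z g) (fmor F X Y f)"
      by (auto simp: compose_def intro!: restrict_ext)
  qed
  moreover have "fully_faithful (SkePerLCCon S) (opposite (DSkePerLCCon S)) F"
    using ff unfolding fully_faithful_def by auto
  moreover have "essentially_surjective (SkePerLCCon S) (opposite (DSkePerLCCon S)) F"
    unfolding essentially_surjective_def
  proof
    fix B assume "B \<in> Obj (opposite (DSkePerLCCon S))"
    then have B: "DLCCon_algebra B" "S (carrier B)" by auto
    obtain X0 :: "'a set topology" where X0: "LCCon_space X0" "topspace X0 \<subseteq> Pow (carrier B)" "DSkePer_iso B (RCL X0)"
      using representation[OF B(1)] by blast
    obtain e where e: "inj_on e (Pow (carrier B))" "\<And>R. R \<subseteq> Pow (carrier B) \<Longrightarrow> S (e ` R)"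
      using universe_encoding[OF S B(2)] by metis
    obtain X d where X: "topspace X = e ` topspace X0" and d: "homeomorphic_maps X0 X e d"
      by (rule homeomorphic_copy[OF inj_on_subset[OF e(1) X0(2)]])
    have hs: "X0 homeomorphic_space X" using d by (auto simp: homeomorphic_space_def)
    have LX: "LCCon_space X"
      using X0(1) homeomorphic_connected_space[OF hs] homeomorphic_Hausdorff_space[OF hs]
        homeomorphic_locally_compact_space[OF hs] by (simp add: LCCon_space_def)
    have PX: "P X" using LX e(2)[OF X0(2)] X by (simp add: P_def)
    have L0: "local_contact_algebra (RCL X0)" using RCL_DLCCon_algebra[OF X0(1)] by (rule DLCCon_local)
    have "DSkePer_iso B (RCL X)"
      using DSkePer_iso_trans[OF DLCCon_local[OF B(1)] L0 RL[OF PX] X0(3) homeomorphic_DSkePer_iso[OF X0(1) LX d]] .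
    then have "DSkePer_iso B (A X)"
      using DSkePer_iso_trans[OF DLCCon_local[OF B(1)] RL[OF PX] AL[OF PX] _ A(3)[OF PX]] by blast
    then obtain k l where "inverse_homs B (A X) k l" by (auto simp: DSkePer_iso_iff)
    then have "is_iso (opposite (DSkePerLCCon S)) (fobj F X) B k"
      unfolding is_iso_def by (auto simp: inverse_homs_def compose_eq_ident_iff intro!: bexI[of _ l])
    then show "\<exists>X\<in>Obj (SkePerLCCon S). \<exists>e. is_iso (opposite (DSkePerLCCon S)) (fobj F X) B e"
      using PX by auto
  qed
  moreover have "bdd (fobj F X) = carrier (fobj F X) \<longleftrightarrow> compact_space X" if "X \<in> Obj (SkePerLCCon S)" for X
    using A(4)[of X] that bdd_RCL_eq_carrier_iff[of X] by simp
  ultimately show thesis by (rule that)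
qed


lemma duality_LCCon:
  assumes S: "universe S"
  shows "dually_equivalent (SkePerLCCon S) (DSkePerLCCon S)"
  using duality_functor[OF S]
    equivalent_categoriesI[OF is_category_SkePerLCCon is_category_opposite[OF is_category_DSkePerLCCon]]
  unfolding dually_equivalent_def by metis

lemma SkeCCon_sub:
  shows "Obj (SkeCCon S) = {X \<in> Obj (SkePerLCCon S). compact_space X}"
    "Ident (SkeCCon S) = Ident (SkePerLCCon S)" "Comp (SkeCCon S) = Comp (SkePerLCCon S)"
    "\<lbrakk>X \<in> Obj (SkeCCon S); Y \<in> Obj (SkeCCon S)\<rbrakk> \<Longrightarrow> Hom (SkeCCon S) X Y = Hom (SkePerLCCon S) X Y"
  by (auto simp: SkeCCon_def SkePerLCCon_def CCon_iff) (auto simp: compact_QOpen_hom_eq LCCon_space_def)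

lemma is_category_SkeCCon: "is_category (SkeCCon S)"
proof -
  have "X \<in> Obj (SkeCCon S) \<Longrightarrow> X \<in> Obj (SkePerLCCon S)" for X by (simp add: SkeCCon_sub)
  note sub = this
  show ?thesis
    using is_category_SkePerLCCon[of S] sub unfolding is_category_def
    by (simp add: SkeCCon_sub(2-4))
qed

text \<open>
  Through \<open>all_bounded\<close>, the normal contact algebras are a full subcategory of the local contact
  algebras.
\<close>

lemma DSkeCCon_sub:
  shows "B \<in> Obj (DSkeCCon S) \<longleftrightarrow> DCCon_algebra B \<and> S (carrier B)"
    "B \<in> Obj (DSkeCCon S) \<Longrightarrow> all_bounded B \<in> Obj (DSkePerLCCon S)"
    "Ident (DSkeCCon S) B = Ident (DSkePerLCCon S) (all_bounded B)"
    "Comp (DSkeCCon S) A B C = Comp (DSkePerLCCon S) (all_bounded A) (all_bounded B) (all_bounded C)"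
    "\<lbrakk>A \<in> Obj (DSkeCCon S); B \<in> Obj (DSkeCCon S)\<rbrakk>
      \<Longrightarrow> Hom (DSkeCCon S) A B = Hom (DSkePerLCCon S) (all_bounded A) (all_bounded B)"
  by (auto simp: DSkeCCon_def DSkePerLCCon_def all_bounded_DLCCon_algebra DSke_hom_all_bounded)

lemma is_category_DSkeCCon: "is_category (DSkeCCon S)"
  using is_category_DSkePerLCCon[of S] DSkeCCon_sub(2)[of _ S] unfolding is_category_def
  by (simp add: DSkeCCon_sub(3-5))

text \<open>
  The functor of the locally compact case restricts to compact spaces, where every element of the
  algebra is bounded.  Conversely a space whose algebra is isomorphic to \<open>all_bounded B\<close> is
  compact, since the isomorphism preserves boundedness and \<open>\<top>\<close> is bounded.
\<close>

lemma duality_CCon: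
  assumes S: "universe S"
  shows "dually_equivalent (SkeCCon S) (DSkeCCon S)"
proof -
  let ?C = "SkePerLCCon S" and ?D = "opposite (DSkePerLCCon S)"
  let ?C' = "SkeCCon S" and ?D' = "opposite (DSkeCCon S)"
  obtain F where F: "is_functor ?C ?D F" and ff: "fully_faithful ?C ?D F"
    and es: "essentially_surjective ?C ?D F"
    and cp: "\<And>X. X \<in> Obj ?C \<Longrightarrow> bdd (fobj F X) = carrier (fobj F X) \<longleftrightarrow> compact_space X"
    using duality_functor[OF S] by metis
  define F' where "F' = \<lparr> fobj = (\<lambda>X. forget_bdd (fobj F X)), fmor = fmor F \<rparr>"
  have F' [simp]: "fobj F' = (\<lambda>X. forget_bdd (fobj F X))" "fmor F' = fmor F" by (simp_all add: F'_def)
  have ObjC: "X \<in> Obj ?C" if "X \<in> Obj ?C'" for X using that by (simp add: SkeCCon_sub)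
  have Fb: "all_bounded (forget_bdd (fobj F X)) = fobj F X" if "X \<in> Obj ?C'" for X
    using that cp[of X] by (simp add: all_bounded_forget SkeCCon_sub)
  have FO: "forget_bdd (fobj F X) \<in> Obj (DSkeCCon S)" if X: "X \<in> Obj ?C'" for X
  proof -
    have "fobj F X \<in> Obj (DSkePerLCCon S)"
      using is_functorD(1)[OF F ObjC[OF X]] by (simp add: opposite_def)
    moreover have "bdd (fobj F X) = carrier (fobj F X)" using X cp[of X] by (simp add: SkeCCon_sub)
    ultimately show ?thesis
      by (simp add: DSkeCCon_def DSkePerLCCon_def forget_bdd_DCCon_algebra)
  qed
  have HomD: "Hom ?D' (fobj F' X) (fobj F' Y) = Hom ?D (fobj F X) (fobj F Y)"
    if "X \<in> Obj ?C'" "Y \<in> Obj ?C'" for X Y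
    using DSkeCCon_sub(5)[OF FO[OF that(2)] FO[OF that(1)]] Fb[OF that(1)] Fb[OF that(2)]
    by (simp add: opposite_def)
  have "is_functor ?C' ?D' F'"
    unfolding is_functor_def
  proof (intro conjI ballI)
    fix X assume X: "X \<in> Obj ?C'"
    show "fobj F' X \<in> Obj ?D'" using FO[OF X] by (simp add: opposite_def)
    show "fmor F' X X (Ident ?C' X) = Ident ?D' (fobj F' X)"
      using is_functorD(3)[OF F ObjC[OF X]]
      by (simp add: SkeCCon_sub(2) opposite_def DSkeCCon_sub(3) Fb[OF X])
  next
    fix X Y f assume X: "X \<in> Obj ?C'" and Y: "Y \<in> Obj ?C'" and f: "f \<in> Hom ?C' X Y"
    show "fmor F' X Y f \<in> Hom ?D' (fobj F' X) (fobj F' Y)"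
      using is_functorD(2)[OF F ObjC[OF X] ObjC[OF Y]] f HomD[OF X Y] SkeCCon_sub(4)[OF X Y] by simp
  next
    fix X Y Z f g assume X: "X \<in> Obj ?C'" and Y: "Y \<in> Obj ?C'" and Z: "Z \<in> Obj ?C'"
      and f: "f \<in> Hom ?C' X Y" and g: "g \<in> Hom ?C' Y Z"
    show "fmor F' X Z (Comp ?C' X Y Z g f) =
        Comp ?D' (fobj F' X) (fobj F' Y) (fobj F' Z) (fmor F' Y Z g) (fmor F' X Y f)"
      using is_functorD(4)[OF F ObjC[OF X] ObjC[OF Y] ObjC[OF Z]] f g
        SkeCCon_sub(4)[OF X Y] SkeCCon_sub(4)[OF Y Z]
      by (simp add: SkeCCon_sub(3) opposite_def DSkeCCon_sub(4) Fb[OF X] Fb[OF Y] Fb[OF Z])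
  qed
  moreover have "fully_faithful ?C' ?D' F'"
    unfolding fully_faithful_def
  proof (intro ballI)
    fix X Y assume X: "X \<in> Obj ?C'" and Y: "Y \<in> Obj ?C'"
    show "bij_betw (fmor F' X Y) (Hom ?C' X Y) (Hom ?D' (fobj F' X) (fobj F' Y))"
      using ff ObjC[OF X] ObjC[OF Y] HomD[OF X Y] SkeCCon_sub(4)[OF X Y]
      unfolding fully_faithful_def by simp
  qed
  moreover have "essentially_surjective ?C' ?D' F'"
    unfolding essentially_surjective_def
  proof
    fix B assume "B \<in> Obj ?D'"
    then have B: "B \<in> Obj (DSkeCCon S)" by (simp add: opposite_def)
    have AB: "all_bounded B \<in> Obj ?D" using DSkeCCon_sub(2)[OF B] by (simp add: opposite_def)
    obtain X e where X: "X \<in> Obj ?C" and e: "is_iso ?D (fobj F X) (all_bounded B) e"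
      using es AB unfolding essentially_surjective_def by blast
    have FX: "DLCCon_algebra (fobj F X)"
      using is_functorD(1)[OF F X] by (simp add: opposite_def DSkePerLCCon_def)
    interpret A: local_contact_algebra "fobj F X" by (rule DLCCon_local[OF FX])
    have eH: "e \<in> DSkePer_hom (all_bounded B) (fobj F X)"
      using e by (simp add: is_iso_def opposite_def DSkePerLCCon_def)
    have eb: "e b \<in> bdd (fobj F X)" if "b \<in> carrier B" for b
      using eH that by (simp add: DSkePer_hom_def)
    have ec: "complete_boolean_hom (all_bounded B) (fobj F X) e"
      using eH by (simp add: DSkePer_hom_def DSke_hom_def)
    interpret B: complete_lattice "all_bounded B" by (rule complete_boolean_homD(1)[OF ec])
    have "\<top>\<^bsub>fobj F X\<^esub> \<in> bdd (fobj F X)"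
      using eb[of "\<top>\<^bsub>all_bounded B\<^esub>"] complete_boolean_hom_top[OF ec] B.top_closed by simp
    then have "bdd (fobj F X) = carrier (fobj F X)"
      using A.bdd_sub A.bdd_down[OF _ _ A.top_higher] by blast
    then have X': "X \<in> Obj ?C'" using cp[OF X] X by (simp add: SkeCCon_sub(1))
    have "is_iso ?D' (fobj F' X) B e"
      using e DSkeCCon_sub(5)[OF FO[OF X'] B] DSkeCCon_sub(5)[OF B FO[OF X']]
      by (simp add: is_iso_def opposite_def DSkeCCon_sub(3,4) Fb[OF X'])
    then show "\<exists>X\<in>Obj ?C'. \<exists>e. is_iso ?D' (fobj F' X) B e" using X' by blast
  qed
  ultimately show ?thesis
    unfolding dually_equivalent_def
    using equivalent_categoriesI[OF is_category_SkeCCon is_category_opposite[OF is_category_DSkeCCon]]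
    by blast
qed

lemma RC_DCCon_algebra: "CCon_space X \<Longrightarrow> DCCon_algebra (RC X)"
  using forget_bdd_DCCon_algebra[OF RCL_DLCCon_algebra, of X] bdd_RCL_eq_carrier_iff[of X]
  by (simp add: CCon_iff forget_RCL)

lemma RC_map_bij_betw_compact:
  assumes X: "CCon_space X" and Y: "CCon_space Y"
  shows "bij_betw (RC_map X Y) (QOpen_hom X Y) (DSke_hom (RC Y) (RC X))"
proof -
  have L: "LCCon_space X" "LCCon_space Y" using X Y CCon_iff by blast+
  have "QOpen_hom X Y = SkePer_hom X Y"
    using X Y by (intro compact_QOpen_hom_eq) (simp_all add: CCon_space_def)
  moreover have "DSke_hom (RC Y) (RC X) = DSkePer_hom (RCL Y) (RCL X)"
    using DSke_hom_forget_bdd[OF RCL_DLCCon_algebra[OF L(2)] _ RCL_DLCCon_algebra[OF L(1)]] X Y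
    by (simp add: forget_RCL bdd_RCL_eq_carrier_iff CCon_iff del: RCL_simps)
  ultimately show ?thesis using RC_map_bij_betw[OF L] by simp
qed

lemma carrier_RC: "carrier (RC X) = carrier (RCL X)"
  by (simp add: RC_def)

lemma representation_compact:
  fixes B :: "'d contact_algebra"
  assumes B: "DCCon_algebra B"
  shows "\<exists>X :: 'd set topology. CCon_space X \<and> DSke_iso B (RC X)"
proof -
  let ?B = "all_bounded B"
  obtain X :: "'d set topology" where X: "LCCon_space X" "DSkePer_iso ?B (RCL X)"
    using representation[OF all_bounded_DLCCon_algebra[OF B]] by blast
  then obtain \<phi> \<psi> where h: "\<phi> \<in> DSkePer_hom ?B (RCL X)" "\<psi> \<in> DSkePer_hom (RCL X) ?B"
    and c: "compose (carrier ?B) \<psi> \<phi> = (\<lambda>a\<in>carrier ?B. a)"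
      "compose (carrier (RCL X)) \<phi> \<psi> = (\<lambda>b\<in>carrier (RCL X). b)"
    unfolding DSkePer_iso_def by blast
  have hom: "complete_boolean_hom ?B (RCL X) \<phi>" using h(1) by (simp add: DSkePer_hom_def DSke_hom_def)
  interpret B: complete_lattice ?B by (rule complete_boolean_homD(1)[OF hom])
  have "\<phi> \<top>\<^bsub>?B\<^esub> \<in> bdd (RCL X)" using h(1) B.top_closed by (simp add: DSkePer_hom_def)
  then have cp: "compact_space X"
    using complete_boolean_hom_top[OF hom] by (simp add: RCL_top compact_space_def)
  then have bdd: "bdd (RCL X) = carrier (RCL X)" using bdd_RCL_eq_carrier_iff by blast
  note hb = DSke_hom_forget_bdd[OF all_bounded_DLCCon_algebra[OF B] _ RCL_DLCCon_algebra[OF X(1)] bdd]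
    DSke_hom_forget_bdd[OF RCL_DLCCon_algebra[OF X(1)] bdd all_bounded_DLCCon_algebra[OF B]]
  have "DSke_hom B (RC X) = DSkePer_hom ?B (RCL X)" "DSke_hom (RC X) B = DSkePer_hom (RCL X) ?B"
    using hb by (simp_all add: forget_RCL)
  then have "DSke_iso B (RC X)"
    using h c unfolding DSke_iso_def carrier_RC by auto
  then show ?thesis using X(1) cp CCon_iff by blast
qed


section \<open>The duality theorem\<close>

theorem theorem3p2:
  shows
    "(\<forall>S :: 'u set \<Rightarrow> bool. universe S \<longrightarrow>
        dually_equivalent (SkePerLCCon S) (DSkePerLCCon S) \<and>
        dually_equivalent (SkeCCon S) (DSkeCCon S)) \<and>
     ((\<forall>X :: 'a topology. LCCon_space X \<longrightarrow> DLCCon_algebra (RCL X)) \<and>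
      (\<forall>(X :: 'a topology) (Y :: 'b topology). LCCon_space X \<and> LCCon_space Y \<longrightarrow>
         bij_betw (RC_map X Y) (SkePer_hom X Y) (DSkePer_hom (RCL Y) (RCL X))) \<and>
      (\<forall>X :: 'a topology. LCCon_space X \<longrightarrow>
         RC_map X X (\<lambda>x\<in>topspace X. x) = (\<lambda>F\<in>carrier (RCL X). F)) \<and>
      (\<forall>(X :: 'a topology) (Y :: 'b topology) (Z :: 'c topology).
         LCCon_space X \<and> LCCon_space Y \<and> LCCon_space Z \<longrightarrow>
         (\<forall>f\<in>SkePer_hom X Y. \<forall>g\<in>SkePer_hom Y Z.
            RC_map X Z (compose (topspace X) g f) =
              compose (carrier (RCL Z)) (RC_map X Y f) (RC_map Y Z g))) \<and>
      (\<forall>B :: 'd local_contact_algebra. DLCCon_algebra B \<longrightarrow>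
         (\<exists>X :: 'd set topology. LCCon_space X \<and> DSkePer_iso B (RCL X)))) \<and>
     ((\<forall>X :: 'a topology. CCon_space X \<longrightarrow> DCCon_algebra (RC X)) \<and>
      (\<forall>(X :: 'a topology) (Y :: 'b topology). CCon_space X \<and> CCon_space Y \<longrightarrow>
         bij_betw (RC_map X Y) (QOpen_hom X Y) (DSke_hom (RC Y) (RC X))) \<and>
      (\<forall>X :: 'a topology. CCon_space X \<longrightarrow>
         RC_map X X (\<lambda>x\<in>topspace X. x) = (\<lambda>F\<in>carrier (RC X). F)) \<and>
      (\<forall>(X :: 'a topology) (Y :: 'b topology) (Z :: 'c topology).
         CCon_space X \<and> CCon_space Y \<and> CCon_space Z \<longrightarrow>
         (\<forall>f\<in>QOpen_hom X Y. \<forall>g\<in>QOpen_hom Y Z.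
            RC_map X Z (compose (topspace X) g f) =
              compose (carrier (RC Z)) (RC_map X Y f) (RC_map Y Z g))) \<and>
      (\<forall>B :: 'd contact_algebra. DCCon_algebra B \<longrightarrow>
         (\<exists>X :: 'd set topology. CCon_space X \<and> DSke_iso B (RC X))))"
proof (intro conjI allI impI ballI)
  fix S :: "'u set \<Rightarrow> bool" assume "universe S"
  then show "dually_equivalent (SkePerLCCon S) (DSkePerLCCon S)"
    "dually_equivalent (SkeCCon S) (DSkeCCon S)"
    by (rule duality_LCCon, rule duality_CCon)
next
  fix X :: "'a topology" and Y :: "'b topology" and Z :: "'c topology" and f g
  assume "f \<in> SkePer_hom X Y" "g \<in> SkePer_hom Y Z"
  then show "RC_map X Z (compose (topspace X) g f) =
      compose (carrier (RCL Z)) (RC_map X Y f) (RC_map Y Z g)"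
    by (intro RC_map_compose) (auto simp: SkePer_hom_def)
next
  fix X :: "'a topology" and Y :: "'b topology" and Z :: "'c topology" and f g
  assume c: "CCon_space X \<and> CCon_space Y \<and> CCon_space Z" and "f \<in> QOpen_hom X Y" "g \<in> QOpen_hom Y Z"
  then have "f \<in> SkePer_hom X Y" "g \<in> SkePer_hom Y Z"
    using compact_QOpen_hom_eq[of X Y] compact_QOpen_hom_eq[of Y Z] by (auto simp: CCon_space_def)
  then show "RC_map X Z (compose (topspace X) g f) =
      compose (carrier (RC Z)) (RC_map X Y f) (RC_map Y Z g)"
    unfolding carrier_RC by (intro RC_map_compose) (auto simp: SkePer_hom_def)
next
  fix B :: "'d local_contact_algebra" assume "DLCCon_algebra B"
  from representation[OF this]
  show "\<exists>X :: 'd set topology. LCCon_space X \<and> DSkePer_iso B (RCL X)" by blast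
qed (simp_all add: RCL_DLCCon_algebra RC_map_bij_betw RC_map_ident RC_DCCon_algebra
    RC_map_bij_betw_compact carrier_RC representation_compact del: RCL_simps)

end
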